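(* Let $k$ be an algebraically closed field of characteristic $0$ and $\alpha\in k$ with $\alpha(1-\alpha^2)\neq 0$. Then the line scheme $\mathcal L(\alpha)\subset\mathbb P^5$ of $A(\alpha)$ is a reduced scheme of degree twenty.
   Context: $A(\alpha)$ is the $k$-algebra on degree-one generators $x_1,\dots,x_4$ with defining relations $x_3x_1+x_1x_3=0$, $x_3x_2-x_2x_3=0$, $2x_2^2+\alpha x_3^2=x_1^2$, $x_4x_1+x_1x_4=0$, $x_2^2-x_4^2=0$, $x_4x_2+x_2x_4=x_3^2$. Its line scheme is realized as follows. Let \[ \mathcal M(\alpha)=\begin{bmatrix} \alpha u_1 & u_4 & u_3 & 0 & \alpha v_1 & v_4 & v_3 & 0\\ 0 & u_1 & 0 & 0 & 0 & v_1 & 0 & 0\\ -u_3 & 0 & u_1 & 0 & -v_3 & 0 & v_1 & 0\\ -u_4 & 0 & 0 & u_1 & -v_4 & 0 & 0 & v_1\\ u_2 & 0 & 0 & 0 & v_2 & 0 & 0 & 0\\ 0 & \alpha u_2-2u_4 & -2u_3 & \alpha u_4 & 0 & \alpha v_2-2v_4 & -2v_3 & \alpha v_4\\ 0 & u_3 & u_2 & 0 & 0 & v_3 & v_2 & 0\\ 0 & -u_4 & 0 & u_2 & 0 & -v_4 & 0 & v_2\\ 0 & 0 & 0 & u_3 & 0 & 0 & 0 & v_3\\ 0 & 0 & u_4 & 0 & 0 & 0 & v_4 & 0 \end{bmatrix}. \] Each of its forty-five $8\times 8$ minors is a polynomial in $N_{ij}=u_iv_j-u_jv_i$, $1\le i<j\le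 4$. Substituting $N_{12}\mapsto M_{34}$, $N_{13}\mapsto -M_{24}$, $N_{14}\mapsto M_{23}$, $N_{23}\mapsto M_{14}$, $N_{24}\mapsto -M_{13}$, $N_{34}\mapsto M_{12}$ yields forty-five quartic forms in the homogeneous coordinates $(M_{12},M_{13},M_{14},M_{23},M_{24},M_{34})$ of $\mathbb P^5$. The line scheme $\mathcal L(\alpha)$ is the closed subscheme of $\mathbb P^5$ defined by these forty-five quartics together with $P=M_{12}M_{34}-M_{13}M_{24}+M_{14}M_{23}$. *)

theory Defs
  imports "HOL-Analysis.Analysis" "HOL-Library.Poly_Mapping" "HOL-Computational_Algebra.Polynomial"
begin

type_synonym 'k mpoly = "(nat \<Rightarrow>\<^sub>0 nat) \<Rightarrow>\<^sub>0 'k"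

definition Var :: "nat \<Rightarrow> 'k::comm_ring_1 mpoly" where
  "Var i = Poly_Mapping.single (Poly_Mapping.single i 1) 1"

definition Const :: "'k::comm_ring_1 \<Rightarrow> 'k mpoly" where
  "Const c = Poly_Mapping.single 0 c"

definition mon_deg :: "(nat \<Rightarrow>\<^sub>0 nat) \<Rightarrow> nat" where
  "mon_deg m = (\<Sum>i\<in>Poly_Mapping.keys m. Poly_Mapping.lookup m i)"

definition mvars :: "'k::comm_ring_1 mpoly \<Rightarrow> nat set" where
  "mvars f = (\<Union>m\<in>Poly_Mapping.keys f. Poly_Mapping.keys m)"

definition homog :: "nat \<Rightarrow> 'k::comm_ring_1 mpoly \<Rightarrow> bool" where
  "homog d f \<longleftrightarrow> (\<forall>m\<in>Poly_Mapping.keys f. mon_deg m = d)"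

definition msubst :: "(nat \<Rightarrow> 'k::comm_ring_1 mpoly) \<Rightarrow> 'k mpoly \<Rightarrow> 'k mpoly" where
  "msubst \<sigma> f = (\<Sum>m\<in>Poly_Mapping.keys f.
      Const (Poly_Mapping.lookup f m) * (\<Prod>i\<in>Poly_Mapping.keys m. \<sigma> i ^ Poly_Mapping.lookup m i))"

definition polyring :: "nat \<Rightarrow> 'k::comm_ring_1 mpoly set" where
  "polyring n = {f. mvars f \<subseteq> {..<n}}"

definition is_ideal :: "'k::comm_ring_1 mpoly set \<Rightarrow> 'k mpoly set \<Rightarrow> bool" where
  "is_ideal R J \<longleftrightarrow> J \<subseteq> R \<and> 0 \<in> J \<and> (\<forall>a\<in>J. \<forall>b\<in>J. a + b \<in> J)
      \<and> (\<forall>r\<in>R. \<forall>a\<in>J. r * a \<in> J)"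

definition ideal_gen :: "'k::comm_ring_1 mpoly set \<Rightarrow> 'k mpoly set \<Rightarrow> 'k mpoly set" where
  "ideal_gen R G = \<Inter>{J. is_ideal R J \<and> G \<subseteq> J}"

definition saturation :: "nat \<Rightarrow> 'k::comm_ring_1 mpoly set \<Rightarrow> 'k mpoly set" where
  "saturation n I = {f \<in> polyring n. \<exists>e. \<forall>i<n. Var i ^ e * f \<in> I}"

text \<open>A homogeneous ideal I of S = k[x_0..x_{n-1}] defines the closed subscheme Proj(S/I)
  of P^{n-1}; it is reduced iff the saturation of I is a radical ideal.\<close>
definition proj_reduced :: "nat \<Rightarrow> 'k::comm_ring_1 mpoly set \<Rightarrow> bool" where
  "proj_reduced n I \<longleftrightarrow>
     (\<forall>f\<in>polyring n. \<forall>e>0. f ^ e \<in> saturation n I \<longrightarrow> f \<in> saturation n I)"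

definition kscale :: "'k::field \<Rightarrow> 'k mpoly \<Rightarrow> 'k mpoly" where
  "kscale c f = Const c * f"

definition homog_part :: "nat \<Rightarrow> nat \<Rightarrow> 'k::field mpoly set" where
  "homog_part n d = {f \<in> polyring n. homog d f}"

definition hilbert_fun :: "nat \<Rightarrow> 'k::field mpoly set \<Rightarrow> nat \<Rightarrow> nat" where
  "hilbert_fun n I d = vector_space.dim (kscale :: 'k \<Rightarrow> _) (homog_part n d)
                       - vector_space.dim (kscale :: 'k \<Rightarrow> _) (I \<inter> homog_part n d)"

definition proj_degree :: "nat \<Rightarrow> 'k::field mpoly set \<Rightarrow> nat \<Rightarrow> bool" where
  "proj_degree n I D \<longleftrightarrow> (\<exists>p :: rat poly. \<exists>d0. (\<forall>d\<ge>d0. of_nat (hilbert_fun n I d) = poly p (of_nat d))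
        \<and> lead_coeff p * fact (Polynomial.degree p) = of_nat D)"

text \<open>u_i = Var (i-1), v_i = Var (i+3) for i = 1..4 in the ring k[u_1..u_4,v_1..v_4].\<close>
definition uu :: "nat \<Rightarrow> 'k::comm_ring_1 mpoly" where "uu i = Var (i - 1)"
definition vv :: "nat \<Rightarrow> 'k::comm_ring_1 mpoly" where "vv i = Var (i + 3)"

definition NN :: "nat \<Rightarrow> nat \<Rightarrow> 'k::comm_ring_1 mpoly" where
  "NN i j = uu i * vv j - uu j * vv i"

definition Mat :: "'k::comm_ring_1 \<Rightarrow> nat \<Rightarrow> nat \<Rightarrow> 'k mpoly" where
  "Mat a r c = (let A = Const a; u = uu; v = vv; C2 = Const 2 in
    [[A * u 1, u 4, u 3, 0, A * v 1, v 4, v 3, 0],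
     [0, u 1, 0, 0, 0, v 1, 0, 0],
     [-u 3, 0, u 1, 0, -v 3, 0, v 1, 0],
     [-u 4, 0, 0, u 1, -v 4, 0, 0, v 1],
     [u 2, 0, 0, 0, v 2, 0, 0, 0],
     [0, A * u 2 - C2 * u 4, -(C2 * u 3), A * u 4, 0, A * v 2 - C2 * v 4, -(C2 * v 3), A * v 4],
     [0, u 3, u 2, 0, 0, v 3, v 2, 0],
     [0, -u 4, 0, u 2, 0, -v 4, 0, v 2],
     [0, 0, 0, u 3, 0, 0, 0, v 3],
     [0, 0, u 4, 0, 0, 0, v 4, 0]] ! r ! c)"

definition det8 :: "(nat \<Rightarrow> nat \<Rightarrow> 'b::comm_ring_1) \<Rightarrow> 'b" where
  "det8 A = (\<Sum>p | p permutes {..<8}. of_int (sign p) * (\<Prod>i<8. A i (p i)))"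

definition minor8 :: "'k::comm_ring_1 \<Rightarrow> nat set \<Rightarrow> 'k mpoly" where
  "minor8 a S = det8 (\<lambda>i j. Mat a (sorted_list_of_set S ! i) j)"

text \<open>Coordinates of P^5: M12,M13,M14,M23,M24,M34 = Var 0..5. The map theta realizes the
  substitution N12->M34, N13->-M24, N14->M23, N23->M14, N24->-M13, N34->M12 backwards:
  a form F in the M's corresponds to the minor G(N) iff theta(F) = G(N).\<close>
definition theta :: "nat \<Rightarrow> 'k::comm_ring_1 mpoly" where
  "theta i = (if i = 0 then NN 3 4 else if i = 1 then - NN 2 4 else if i = 2 then NN 2 3
              else if i = 3 then NN 1 4 else if i = 4 then - NN 1 3 else if i = 5 then NN 1 2
              else 0)"

definition Pl :: "'k::comm_ring_1 mpoly" where
  "Pl = Var 0 * Var 5 - Var 1 * Var 4 + Var 2 * Var 3"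

definition minor_quartics :: "'k::comm_ring_1 \<Rightarrow> 'k mpoly set" where
  "minor_quartics a = {F \<in> polyring 6. homog 4 F \<and>
      (\<exists>S. S \<subseteq> {..<10} \<and> card S = 8 \<and> msubst theta F = minor8 a S)}"

definition line_ideal :: "'k::comm_ring_1 \<Rightarrow> 'k mpoly set" where
  "line_ideal a = ideal_gen (polyring 6) (insert Pl (minor_quartics a))"

definition alg_closed :: "'k::field itself \<Rightarrow> bool" where
  "alg_closed _ \<longleftrightarrow> (\<forall>p::'k poly. Polynomial.degree p > 0 \<longrightarrow> (\<exists>x. poly p x = 0))"

end

theory Submission
  imports Defs "Jordan_Normal_Form.Determinant"
begin

text \<open>Write $a,\dots,f$ for $M_{12},\dots,M_{34}$ and $Q = a^2+c^2+2e^2+\alpha d^2+\alpha f^2-2df$. The line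
  scheme is the union of eight curves: the lines $a=b=d=f=0$ and $a=b=c=f=0$, the conics $Q=0$ in
  $a=b=d=0$ and in $b=c=f=0$, the plane cubics $aQ=b^2c$ in $d=e=f=0$ and $fQ=b^2d$ in $a=c=e=0$, and the
  quartics $Q=0$ on the quadrics $af=be$ in $c=d=0$ and $af+cd=0$ in $b=e=0$. Their degrees add up to twenty.

  In each degree $n \ge 4$ the line ideal contains enough explicit elements to reduce every form to a
  combination of $20n-20$ standard monomials, and these are linearly independent as functions on the union
  of the eight curves, by evaluation along parametrizations of the curves as double covers of the line.
  Hence from degree 4 on the line ideal consists of all forms vanishing on the curves (which makes the scheme
  reduced), and its Hilbert function is $20n-20$.\<close>

section \<open>Polynomials in several variables\<close>

text \<open>The argument is a squeeze. The reductions show that the standard monomials span the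
  forms of degree \<open>n\<close> modulo the line ideal, the points show that they are independent
  modulo everything vanishing on the curves. Confluence of the rewriting and the fact that the
  curves account for the whole scheme come out of this comparison.

  Degree 4 is the threshold because the saturation contains cubics, while in degree 3 the line ideal
  holds only multiples of the Pluecker quadric; multiplication by any variable carries these cubics
  into the line ideal.

  Points are certified by kernel vectors of the 10 by 8 matrix. A minor has many lifts to
  \<open>P^5\<close>, differing by multiples of the quadric, and \<open>minor_quartics\<close>
  contains all of them; a kernel vector handles every lift at once. Explicit lifts serve the
  reductions, where members of the ideal have to be exhibited.

  The plane cubics have genus one, hence no rational parametrization. Functions are therefore
  compared on double covers \<open>y^2 = N/D\<close> of the line, where uniqueness of an expansion
  in base \<open>N/D\<close> takes the place of comparing coefficients.\<close>

lemma mpoly_eq_sum_single: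
  "f = (\<Sum>m\<in>Poly_Mapping.keys f. Poly_Mapping.single m (Poly_Mapping.lookup f m))"
  by (rule poly_mapping_eqI) (auto simp: lookup_sum lookup_single when_def in_keys_iff)

definition monom_value :: "(nat \<Rightarrow> 'r::comm_ring_1) \<Rightarrow> (nat \<Rightarrow>\<^sub>0 nat) \<Rightarrow> 'r" where
  "monom_value \<sigma> m = (\<Prod>i\<in>Poly_Mapping.keys m. \<sigma> i ^ Poly_Mapping.lookup m i)"

lemma monom_value_superset:
  assumes "finite K" "Poly_Mapping.keys m \<subseteq> K"
  shows "monom_value \<sigma> m = (\<Prod>i\<in>K. \<sigma> i ^ Poly_Mapping.lookup m i)"
  unfolding monom_value_def using assms
  by (intro prod.mono_neutral_left) (auto simp: in_keys_iff)

lemma monom_value_0 [simp]: "monom_value \<sigma> 0 = 1"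
  by (simp add: monom_value_def)

lemma monom_value_single [simp]: "monom_value \<sigma> (Poly_Mapping.single i (Suc 0)) = \<sigma> i"
  by (simp add: monom_value_def)

lemma monom_value_add: "monom_value \<sigma> (m + n) = monom_value \<sigma> m * monom_value \<sigma> n"
proof -
  let ?K = "Poly_Mapping.keys m \<union> Poly_Mapping.keys n"
  have "Poly_Mapping.keys (m + n) \<subseteq> ?K" by (rule Poly_Mapping.keys_add)
  then have "monom_value \<sigma> (m + n) = (\<Prod>i\<in>?K. \<sigma> i ^ Poly_Mapping.lookup (m + n) i)"
    by (intro monom_value_superset) auto
  also have "\<dots> = (\<Prod>i\<in>?K. \<sigma> i ^ Poly_Mapping.lookup m i) * (\<Prod>i\<in>?K. \<sigma> i ^ Poly_Mapping.lookup n i)"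
    by (simp add: lookup_add power_add prod.distrib)
  also have "\<dots> = monom_value \<sigma> m * monom_value \<sigma> n"
    using monom_value_superset[of ?K m \<sigma>] monom_value_superset[of ?K n \<sigma>] by simp
  finally show ?thesis .
qed

text \<open>The universal property of the polynomial ring, with coefficients mapped by
  \<open>\<phi>\<close> and variables by \<open>\<sigma>\<close>. Evaluation at a point and
  substitution of polynomials are its two instances, so the homomorphism laws are proved
  once.\<close>

locale mpoly_subst =
  fixes \<phi> :: "'k::comm_ring_1 \<Rightarrow> 'r::comm_ring_1" and \<sigma> :: "nat \<Rightarrow> 'r"
  assumes hom_0: "\<phi> 0 = 0" and hom_1: "\<phi> 1 = 1"
    and hom_add: "\<phi> (x + y) = \<phi> x + \<phi> y" and hom_mult: "\<phi> (x * y) = \<phi> x * \<phi> y"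
begin

definition subst :: "'k mpoly \<Rightarrow> 'r" where
  "subst f = (\<Sum>m\<in>Poly_Mapping.keys f. \<phi> (Poly_Mapping.lookup f m) * monom_value \<sigma> m)"

text \<open>A missing key contributes \<open>\<phi> 0 = 0\<close>; polynomials with different
  supports can thus share one index set, as additivity requires.\<close>

lemma subst_superset:
  assumes "finite K" "Poly_Mapping.keys f \<subseteq> K"
  shows "subst f = (\<Sum>m\<in>K. \<phi> (Poly_Mapping.lookup f m) * monom_value \<sigma> m)"
  unfolding subst_def using assms
  by (intro sum.mono_neutral_left) (auto simp: in_keys_iff hom_0)

lemma subst_0 [simp]: "subst 0 = 0"
  by (simp add: subst_def)

lemma subst_single [simp]: "subst (Poly_Mapping.single m c) = \<phi> c * monom_value \<sigma> m"
  by (simp add: subst_def hom_0)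

lemma subst_Const [simp]: "subst (Const c) = \<phi> c"
  by (simp add: Const_def)

lemma subst_1 [simp]: "subst 1 = 1"
  using subst_Const[of 1] by (simp add: Const_def hom_1)

lemma subst_Var [simp]: "subst (Var i) = \<sigma> i"
  by (simp add: Var_def hom_1)

lemma subst_add [simp]: "subst (f + g) = subst f + subst g"
proof -
  let ?K = "Poly_Mapping.keys f \<union> Poly_Mapping.keys g"
  have "Poly_Mapping.keys (f + g) \<subseteq> ?K" by (rule Poly_Mapping.keys_add)
  then show ?thesis
    using subst_superset[of ?K f] subst_superset[of ?K g] subst_superset[of ?K "f + g"]
    by (simp add: lookup_add hom_add sum.distrib distrib_right)
qed

lemma subst_uminus [simp]: "subst (- f) = - subst f"
  using subst_add[of f "- f"] by (simp add: eq_neg_iff_add_eq_0 add.commute)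

lemma subst_diff [simp]: "subst (f - g) = subst f - subst g"
  using subst_add[of f "- g"] by simp

lemma subst_sum: "subst (sum f A) = (\<Sum>x\<in>A. subst (f x))"
  by (induction A rule: infinite_finite_induct) auto

lemma subst_mult [simp]: "subst (f * g) = subst f * subst g"
proof -
  \<comment> \<open>By additivity it is enough to treat products of terms, where
    \<open>hom_mult\<close> and \<open>monom_value_add\<close> apply.\<close>
  have "f * g = (\<Sum>m\<in>Poly_Mapping.keys f. \<Sum>n\<in>Poly_Mapping.keys g. Poly_Mapping.single (m + n)
      (Poly_Mapping.lookup f m * Poly_Mapping.lookup g n))"
    by (subst mpoly_eq_sum_single[of f], subst mpoly_eq_sum_single[of g])
      (simp add: sum_product mult_single)
  then have "subst (f * g) = (\<Sum>m\<in>Poly_Mapping.keys f. \<Sum>n\<in>Poly_Mapping.keys g.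
      (\<phi> (Poly_Mapping.lookup f m) * monom_value \<sigma> m) * (\<phi> (Poly_Mapping.lookup g n) * monom_value \<sigma> n))"
    by (simp add: subst_sum hom_mult monom_value_add mult_ac)
  then show ?thesis by (simp add: subst_def sum_product)
qed

lemma subst_power [simp]: "subst (f ^ n) = subst f ^ n"
  by (induction n) auto

lemma subst_prod: "subst (prod f A) = (\<Prod>x\<in>A. subst (f x))"
  by (induction A rule: infinite_finite_induct) auto

lemma subst_of_nat [simp]: "subst (of_nat n) = of_nat n"
  by (induction n) auto

lemma subst_of_int [simp]: "subst (of_int n) = of_int n"
  by (cases n) auto

lemma subst_numeral [simp]: "subst (numeral n) = numeral n"
  using subst_of_nat[of "numeral n"] by simp

end

lemma Const_0 [simp]: "Const 0 = 0" and Const_1 [simp]: "Const 1 = 1"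
  and Const_add: "Const (x + y) = Const x + Const y"
  and Const_mult: "Const (x * y) = Const x * Const y"
  by (simp_all add: Const_def single_add mult_single)

lemma Const_uminus: "Const (- x) = - Const x"
  by (simp add: Const_def single_uminus)

lemma Const_numeral: "Const (numeral n) = numeral n"
  by (simp add: Const_def)

section \<open>Evaluation at points and substitution of polynomials\<close>

definition peval :: "(nat \<Rightarrow> 'k::comm_ring_1) \<Rightarrow> 'k mpoly \<Rightarrow> 'k" where
  "peval p f = (\<Sum>m\<in>Poly_Mapping.keys f. Poly_Mapping.lookup f m * monom_value p m)"

interpretation peval: mpoly_subst "\<lambda>x::'k::comm_ring_1. x" p
  rewrites "mpoly_subst.subst (\<lambda>x::'k. x) p = peval p"
  for p
proof -
  show "mpoly_subst (\<lambda>x::'k. x)" by unfold_locales auto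
  then show "mpoly_subst.subst (\<lambda>x::'k. x) p = peval p"
    by (intro ext) (simp add: mpoly_subst.subst_def peval_def)
qed

interpretation msubst: mpoly_subst "Const :: 'k::comm_ring_1 \<Rightarrow> 'k mpoly" \<sigma>
  rewrites "mpoly_subst.subst Const \<sigma> = msubst \<sigma>"
  for \<sigma>
proof -
  show "mpoly_subst (Const :: 'k \<Rightarrow> _)" by unfold_locales (auto simp: Const_add Const_mult)
  then show "mpoly_subst.subst Const \<sigma> = msubst \<sigma>"
    by (intro ext) (simp add: mpoly_subst.subst_def msubst_def monom_value_def)
qed

lemma peval_msubst: "peval p (msubst \<sigma> f) = peval (\<lambda>i. peval p (\<sigma> i)) f"
  unfolding msubst_def peval.subst_sum
  by (simp add: peval.subst_prod peval_def[of "\<lambda>i. peval p (\<sigma> i)"] monom_value_def)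

section \<open>Variables, degrees and homogeneity\<close>

lemma polyring_iff: "f \<in> polyring n \<longleftrightarrow> (\<forall>m\<in>Poly_Mapping.keys f. Poly_Mapping.keys m \<subseteq> {..<n})"
  by (auto simp: polyring_def mvars_def)

lemma polyring_0 [simp]: "0 \<in> polyring n"
  and polyring_Const [simp]: "Const c \<in> polyring n"
  and polyring_Var [simp]: "i < n \<Longrightarrow> Var i \<in> polyring n"
  by (auto simp: polyring_iff Const_def Var_def)

lemma polyring_1 [simp]: "1 \<in> polyring n"
  using polyring_Const[of 1] by simp

lemma polyring_numeral [simp]: "numeral k \<in> polyring n"
  using polyring_Const[of "numeral k"] by (simp add: Const_numeral)

lemma polyring_add [simp]: "f \<in> polyring n \<Longrightarrow> g \<in> polyring n \<Longrightarrow> f + g \<in> polyring n"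
  using Poly_Mapping.keys_add[of f g] by (fastforce simp: polyring_iff)

lemma polyring_uminus [simp]: "f \<in> polyring n \<Longrightarrow> - f \<in> polyring n"
  by (simp add: polyring_iff)

lemma polyring_diff [simp]: "f \<in> polyring n \<Longrightarrow> g \<in> polyring n \<Longrightarrow> f - g \<in> polyring n"
  using polyring_add[of f n "- g"] by simp

lemma polyring_mult [simp]:
  assumes "f \<in> polyring n" "g \<in> polyring n" shows "f * g \<in> polyring n"
  unfolding polyring_iff
proof
  fix m assume "m \<in> Poly_Mapping.keys (f * g)"
  then obtain k l where "m = k + l" "k \<in> Poly_Mapping.keys f" "l \<in> Poly_Mapping.keys g" using keys_mult[of f g] by blast
  then show "Poly_Mapping.keys m \<subseteq> {..<n}"
    using assms Poly_Mapping.keys_add[of k l] unfolding polyring_iff by blast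
qed

lemma polyring_power [simp]: "f \<in> polyring n \<Longrightarrow> f ^ k \<in> polyring n"
  by (induction k) auto

lemma mon_deg_superset:
  assumes "finite K" "Poly_Mapping.keys m \<subseteq> K"
  shows "mon_deg m = (\<Sum>i\<in>K. Poly_Mapping.lookup m i)"
  unfolding mon_deg_def using assms
  by (intro sum.mono_neutral_left) (auto simp: in_keys_iff)

lemma mon_deg_add: "mon_deg (m + n) = mon_deg m + mon_deg n"
proof -
  let ?K = "Poly_Mapping.keys m \<union> Poly_Mapping.keys n"
  have "Poly_Mapping.keys (m + n) \<subseteq> ?K" by (rule Poly_Mapping.keys_add)
  then show ?thesis
    using mon_deg_superset[of ?K m] mon_deg_superset[of ?K n] mon_deg_superset[of ?K "m + n"]
    by (simp add: lookup_add sum.distrib)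
qed

lemma homog_0 [simp]: "homog d 0"
  and homog_Const [simp]: "homog 0 (Const c)"
  and homog_Var [simp]: "homog 1 (Var i)"
  by (auto simp: homog_def Const_def Var_def mon_deg_def)

lemma homog_add: "homog d f \<Longrightarrow> homog d g \<Longrightarrow> homog d (f + g)"
  using Poly_Mapping.keys_add[of f g] by (fastforce simp: homog_def)

lemma homog_uminus: "homog d f \<Longrightarrow> homog d (- f)"
  by (simp add: homog_def)

lemma homog_diff: "homog d f \<Longrightarrow> homog d g \<Longrightarrow> homog d (f - g)"
  using homog_add[of d f "- g"] homog_uminus[of d g] by simp

lemma homog_mult:
  assumes "homog d f" "homog e g" shows "homog (d + e) (f * g)"
  unfolding homog_def
proof
  fix m assume "m \<in> Poly_Mapping.keys (f * g)"
  then obtain k l where "m = k + l" "k \<in> Poly_Mapping.keys f" "l \<in> Poly_Mapping.keys g" using keys_mult[of f g] by blast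
  then show "mon_deg m = d + e" using assms by (auto simp: homog_def mon_deg_add)
qed

lemma homog_power: "homog d f \<Longrightarrow> homog (d * k) (f ^ k)"
proof (induction k)
  case 0 show ?case using homog_Const[of 1] by simp
next
  case (Suc k) then show ?case using homog_mult[of d f "d * k" "f ^ k"] by simp
qed

lemma homog_numeral_mult: "homog d f \<Longrightarrow> homog d (numeral k * f)"
  using homog_mult[OF homog_Const[of "numeral k"], of d f] by (simp add: Const_numeral)

lemma homog_Const_mult: "homog d f \<Longrightarrow> homog d (Const c * f)"
  using homog_mult[of 0 "Const c" d f] by simp

section \<open>Generated ideals\<close>

lemma is_ideal_ideal_gen:
  assumes "G \<subseteq> polyring n"
  shows "is_ideal (polyring n) (ideal_gen (polyring n) G)"
proof -
  have top: "is_ideal (polyring n) (polyring n)" by (auto simp: is_ideal_def)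
  let ?C = "{J. is_ideal (polyring n) J \<and> G \<subseteq> J}"
  have "polyring n \<in> ?C" using top assms by simp
  then have "\<Inter>?C \<subseteq> polyring n" by (rule Inter_lower)
  moreover have "0 \<in> J" "\<And>a b. a \<in> J \<Longrightarrow> b \<in> J \<Longrightarrow> a + b \<in> J"
    "\<And>r a. r \<in> polyring n \<Longrightarrow> a \<in> J \<Longrightarrow> r * a \<in> J" if "J \<in> ?C" for J
    using that by (simp_all add: is_ideal_def)
  ultimately show ?thesis
    unfolding ideal_gen_def is_ideal_def[of _ "\<Inter>?C"] by (simp only: Inter_iff) blast
qed

lemma ideal_gen_superset: "G \<subseteq> ideal_gen R G"
  by (auto simp: ideal_gen_def)

lemma ideal_gen_least: "is_ideal R J \<Longrightarrow> G \<subseteq> J \<Longrightarrow> ideal_gen R G \<subseteq> J"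
  by (auto simp: ideal_gen_def)

section \<open>Eight by eight determinants\<close>

text \<open>Rows and columns are lists of indices, so deleting a row or column is an operation on
  lists and the entries keep their indices.\<close>

definition sub_det :: "(nat \<Rightarrow> nat \<Rightarrow> 'b::comm_ring_1) \<Rightarrow> nat list \<Rightarrow> nat list \<Rightarrow> 'b" where
  "sub_det A rs cs = det (mat (length cs) (length cs) (\<lambda>(i, j). A (rs ! i) (cs ! j)))"

lemma sub_det_Nil [simp]: "sub_det A [] [] = 1"
  by (simp add: sub_det_def det_dim_zero)

text \<open>Laplace expansion along the last row. Keeping the expanded row at the end leaves
  \<open>rs\<close> itself as the rows of the minors, which makes the later recursion structural on
  the reversed row list.\<close>

lemma sub_det_snoc:
  assumes "length cs = Suc (length rs)"
  shows "sub_det A (rs @ [r]) cs = (\<Sum>j<length cs. (-1) ^ (length rs + j) * A r (cs ! j)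
           * sub_det A rs (take j cs @ drop (Suc j) cs))"
proof -
  define n where "n = length rs"
  define M where "M = mat (Suc n) (Suc n) (\<lambda>(i, j). A ((rs @ [r]) ! i) (cs ! j))"
  have "sub_det A (rs @ [r]) cs = det M" using assms by (simp add: sub_det_def M_def n_def)
  also have "\<dots> = (\<Sum>j<Suc n. M $$ (n, j) * cofactor M n j)"
    by (rule laplace_expansion_row) (simp_all add: M_def)
  also have "\<dots> = (\<Sum>j<Suc n. (-1) ^ (n + j) * A r (cs ! j)
           * sub_det A rs (take j cs @ drop (Suc j) cs))"
  proof (rule sum.cong)
    fix j assume j: "j \<in> {..<Suc n}"
    have "mat_delete M n j = mat n n (\<lambda>(i, k). A (rs ! i) ((take j cs @ drop (Suc j) cs) ! k))"
      using j assms by (intro eq_matI) (auto simp: mat_delete_def M_def n_def nth_append min_def)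
    then have "cofactor M n j = (-1) ^ (n + j) * sub_det A rs (take j cs @ drop (Suc j) cs)"
      using j assms by (simp add: cofactor_def sub_det_def n_def)
    moreover have "M $$ (n, j) = A r (cs ! j)"
      using j by (simp add: M_def n_def)
    ultimately show "M $$ (n, j) * cofactor M n j = (-1) ^ (n + j) * A r (cs ! j)
           * sub_det A rs (take j cs @ drop (Suc j) cs)"
      by (simp only: mult_ac)
  qed auto
  finally show ?thesis by (simp only: assms n_def)
qed

text \<open>Connects the Leibniz sum of the statement with matrix determinants, to which Laplace
  expansion and the kernel criterion apply.\<close>

lemma det8_eq_det: "det8 A = det (mat 8 8 (\<lambda>(i, j). A i j))"
proof -
  have *: "(\<Prod>i<8. A i (p i)) = (\<Prod>i=0..<8. mat 8 8 (\<lambda>(i, j). A i j) $$ (i, p i))"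
    if "p permutes {..<8}" for p
  proof (rule prod.cong)
    fix i :: nat assume "i \<in> {0..<8}"
    then show "A i (p i) = mat 8 8 (\<lambda>(i, j). A i j) $$ (i, p i)"
      using permutes_in_image[OF that, of i] by simp
  qed auto
  have "det8 A = (\<Sum>p | p permutes {0..<8}. signof p * (\<Prod>i=0..<8. mat 8 8 (\<lambda>(i, j). A i j) $$ (i, p i)))"
    unfolding det8_def using * by (intro sum.cong) (auto simp: lessThan_atLeast0)
  then show ?thesis by (subst det_def'[of _ 8]) simp_all
qed

lemma det8_eq_sub_det:
  assumes "length rs = 8"
  shows "det8 (\<lambda>i j. A (rs ! i) j) = sub_det A rs [0..<8]"
proof -
  have "mat 8 8 (\<lambda>(i, j). A (rs ! i) j) = mat 8 8 (\<lambda>(i, j). A (rs ! i) ([0..<8] ! j))"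
    by (intro eq_matI) auto
  then show ?thesis by (simp add: det8_eq_det sub_det_def)
qed

text \<open>The vector \<open>w\<close> is a nonzero kernel vector. This is how minors are shown to
  vanish at points, without expanding them.\<close>

lemma det8_eq_0:
  fixes A :: "nat \<Rightarrow> nat \<Rightarrow> 'b::field"
  assumes w: "\<And>i. i < 8 \<Longrightarrow> (\<Sum>j<8. A i j * w j) = 0" and "k < 8" "w k \<noteq> 0"
  shows "det8 A = 0"
proof -
  have "mat 8 8 (\<lambda>(i, j). A i j) *\<^sub>v vec 8 w = 0\<^sub>v 8"
    using w by (intro eq_vecI) (auto simp: scalar_prod_def lessThan_atLeast0)
  moreover have "vec 8 w \<noteq> 0\<^sub>v 8"
  proof
    assume "vec 8 w = 0\<^sub>v 8"
    then have "vec 8 w $ k = 0\<^sub>v 8 $ k" by simp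
    with assms show False by simp
  qed
  ultimately have "det (mat 8 8 (\<lambda>(i, j). A i j)) = 0"
    by (subst det_0_iff_vec_prod_zero_field[of _ 8]) (auto intro!: exI[of _ "vec 8 w"])
  then show ?thesis by (simp add: det8_eq_det)
qed

text \<open>\<open>pre\<close> collects the columns already passed, so \<open>pre @ cs\<close> is
  the column list with \<open>c\<close> deleted; the nested subtraction produces the alternating
  signs. No index arithmetic is left to the simplifier.\<close>

fun altsum :: "('c \<Rightarrow> 'c list \<Rightarrow> 'b::comm_ring_1) \<Rightarrow> 'c list \<Rightarrow> 'c list \<Rightarrow> 'b" where
  "altsum f pre [] = 0"
| "altsum f pre (c # cs) = f c (pre @ cs) - altsum f (pre @ [c]) cs"

lemma altsum_eq_sum:
  "altsum f pre cs = (\<Sum>j<length cs. (-1) ^ j * f (cs ! j) (pre @ take j cs @ drop (Suc j) cs))"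
proof (induction cs arbitrary: pre)
  case (Cons c cs)
  show ?case by (simp add: Cons sum.lessThan_Suc_shift sum_negf del: sum.lessThan_Suc)
qed simp

text \<open>Laplace expansion along the last row (the row list is reversed), with a predicate for the entries
  that may be nonzero: skipping the others early keeps the symbolic evaluation of the minors small.\<close>
fun sparse_det :: "(nat \<Rightarrow> nat \<Rightarrow> 'b::comm_ring_1) \<Rightarrow> (nat \<Rightarrow> nat \<Rightarrow>
    bool) \<Rightarrow> nat list \<Rightarrow> nat list \<Rightarrow> 'b" where
  "sparse_det A nz [] cs = 1"
| "sparse_det A nz (r # rs) cs =
     altsum (\<lambda>c cs'. if nz r c then A r c * sparse_det A nz rs cs' else 0) [] cs"

text \<open>At every level \<open>sparse_det\<close> omits the sign that the position of the last
  row contributes; the omitted signs collect in the exponent on the right.\<close>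

lemma sub_det_eq_sparse_det:
  assumes "\<And>r c. \<not> nz r c \<Longrightarrow> A r c = 0" "length cs = length rs"
  shows "sub_det A (rev rs) cs = (-1) ^ (\<Sum>i<length rs. i) * sparse_det A nz rs cs"
  using assms(2)
proof (induction rs arbitrary: cs)
  case (Cons r rs)
  have "sub_det A (rev (r # rs)) cs = (\<Sum>j<length cs. (-1) ^ (length rs + j) * A r (cs ! j)
           * sub_det A (rev rs) (take j cs @ drop (Suc j) cs))"
    using Cons.prems by (simp add: sub_det_snoc)
  also have "\<dots> = (\<Sum>j<length cs. (-1) ^ (length rs + j) * A r (cs ! j)
           * ((-1) ^ (\<Sum>i<length rs. i) * sparse_det A nz rs (take j cs @ drop (Suc j) cs)))"
    using Cons.prems by (intro sum.cong refl) (simp add: Cons.IH)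
  also have "\<dots> = (-1) ^ (\<Sum>i<length (r # rs). i) * sparse_det A nz (r # rs) cs"
    using assms(1)[of r "cs ! _"]
    by (auto simp: altsum_eq_sum sum_distrib_left power_add mult_ac intro!: sum.cong)
  finally show ?case .
qed simp

text \<open>Outside the ten rows and eight columns the predicate is true, so its negation confines
  the indices to the matrix and \<open>Mat_nz\<close> holds for all indices.\<close>

definition nz :: "nat \<Rightarrow> nat \<Rightarrow> bool" where
  "nz r c \<longleftrightarrow> r < 10 \<longrightarrow> c < 8 \<longrightarrow> c \<in> set ([[0,1,2,4,5,6],[1,5],[0,2,4,6],[0,3,4,7],[0,4],[1,2,3,5,6,7],[1,2,5,6],
     [1,3,5,7],[3,7],[2,6]] ! r)"

abbreviation "M12 \<equiv> Var 0"
abbreviation "M13 \<equiv> Var 1"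
abbreviation "M14 \<equiv> Var 2"
abbreviation "M23 \<equiv> Var 3"
abbreviation "M24 \<equiv> Var 4"
abbreviation "M34 \<equiv> Var 5"

text \<open>Only the positions marked by \<open>nz\<close> are listed. \<open>Var 0\<close> to
  \<open>Var 3\<close> stand for the coordinates of \<open>u\<close>, \<open>Var 4\<close> to
  \<open>Var 7\<close> for those of \<open>v\<close>.\<close>

lemma Mat_entries:
  fixes a :: "'k::comm_ring_1"
  shows "Mat a 0 0 = Const a * Var 0"
  and "Mat a 0 1 = Var 3"
  and "Mat a 0 2 = Var 2"
  and "Mat a 0 4 = Const a * Var 4"
  and "Mat a 0 5 = Var 7"
  and "Mat a 0 6 = Var 6"
  and "Mat a 1 1 = Var 0"
  and "Mat a 1 5 = Var 4"
  and "Mat a 2 0 = -Var 2"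
  and "Mat a 2 2 = Var 0"
  and "Mat a 2 4 = -Var 6"
  and "Mat a 2 6 = Var 4"
  and "Mat a 3 0 = -Var 3"
  and "Mat a 3 3 = Var 0"
  and "Mat a 3 4 = -Var 7"
  and "Mat a 3 7 = Var 4"
  and "Mat a 4 0 = Var 1"
  and "Mat a 4 4 = Var 5"
  and "Mat a 5 1 = Const a * Var 1 - 2 * Var 3"
  and "Mat a 5 2 = -(2 * Var 2)"
  and "Mat a 5 3 = Const a * Var 3"
  and "Mat a 5 5 = Const a * Var 5 - 2 * Var 7"
  and "Mat a 5 6 = -(2 * Var 6)"
  and "Mat a 5 7 = Const a * Var 7"
  and "Mat a 6 1 = Var 2"
  and "Mat a 6 2 = Var 1"
  and "Mat a 6 5 = Var 6"
  and "Mat a 6 6 = Var 5"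
  and "Mat a 7 1 = -Var 3"
  and "Mat a 7 3 = Var 1"
  and "Mat a 7 5 = -Var 7"
  and "Mat a 7 7 = Var 5"
  and "Mat a 8 3 = Var 2"
  and "Mat a 8 7 = Var 6"
  and "Mat a 9 2 = Var 3"
  and "Mat a 9 6 = Var 7"
  by (simp_all add: Mat_def uu_def vv_def Const_numeral)

text \<open>All eighty values are tabulated so that the expansion decides each position by a single
  rewrite.\<close>

lemma nz_table: "nz 0 0 = True"
  "nz 0 1 = True"
  "nz 0 2 = True"
  "nz 0 3 = False"
  "nz 0 4 = True"
  "nz 0 5 = True"
  "nz 0 6 = True"
  "nz 0 7 = False"
  "nz 1 0 = False"
  "nz 1 1 = True"
  "nz 1 2 = False"
  "nz 1 3 = False"
  "nz 1 4 = False"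
  "nz 1 5 = True"
  "nz 1 6 = False"
  "nz 1 7 = False"
  "nz 2 0 = True"
  "nz 2 1 = False"
  "nz 2 2 = True"
  "nz 2 3 = False"
  "nz 2 4 = True"
  "nz 2 5 = False"
  "nz 2 6 = True"
  "nz 2 7 = False"
  "nz 3 0 = True"
  "nz 3 1 = False"
  "nz 3 2 = False"
  "nz 3 3 = True"
  "nz 3 4 = True"
  "nz 3 5 = False"
  "nz 3 6 = False"
  "nz 3 7 = True"
  "nz 4 0 = True"
  "nz 4 1 = False"
  "nz 4 2 = False"
  "nz 4 3 = False"
  "nz 4 4 = True"
  "nz 4 5 = False"
  "nz 4 6 = False"
  "nz 4 7 = False"
  "nz 5 0 = False"
  "nz 5 1 = True"
  "nz 5 2 = True"
  "nz 5 3 = True"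
  "nz 5 4 = False"
  "nz 5 5 = True"
  "nz 5 6 = True"
  "nz 5 7 = True"
  "nz 6 0 = False"
  "nz 6 1 = True"
  "nz 6 2 = True"
  "nz 6 3 = False"
  "nz 6 4 = False"
  "nz 6 5 = True"
  "nz 6 6 = True"
  "nz 6 7 = False"
  "nz 7 0 = False"
  "nz 7 1 = True"
  "nz 7 2 = False"
  "nz 7 3 = True"
  "nz 7 4 = False"
  "nz 7 5 = True"
  "nz 7 6 = False"
  "nz 7 7 = True"
  "nz 8 0 = False"
  "nz 8 1 = False"
  "nz 8 2 = False"
  "nz 8 3 = True"
  "nz 8 4 = False"
  "nz 8 5 = False"
  "nz 8 6 = False"
  "nz 8 7 = True"
  "nz 9 0 = False"
  "nz 9 1 = False"
  "nz 9 2 = True"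
  "nz 9 3 = False"
  "nz 9 4 = False"
  "nz 9 5 = False"
  "nz 9 6 = True"
  "nz 9 7 = False"
  by (simp_all add: nz_def)

text \<open>The pattern \<open>c # cs\<close> delays unfolding until the column list is concrete;
  otherwise the expansion would proceed under the lambda, where the columns are a bound
  variable.\<close>

lemma sparse_det_Cons:
  "sparse_det A nz (r # rs) (c # cs) =
     altsum (\<lambda>c cs'. if nz r c then A r c * sparse_det A nz rs cs' else 0) [] (c # cs)"
  by simp

text \<open>Structural rules and the cancellation of zeros, ones and double signs; polynomial
  arithmetic is left to the final comparison with the image under \<open>theta\<close>.\<close>

lemmas det_rules = sparse_det_Cons sparse_det.simps(1) altsum.simps append.simps nz_table if_True if_False Mat_entries diff_0_right diff_0 mult_1_right mult_zero_right minus_minus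

lemma Mat_nz: "\<not> nz r c \<Longrightarrow> Mat a r c = 0"
proof -
  assume *: "\<not> nz r c"
  then have "r \<in> {0,1,2,3,4,5,6,7,8,9}" "c \<in> {0,1,2,3,4,5,6,7}" by (auto simp: nz_def)
  with * show ?thesis by (auto simp: nz_def Mat_def)
qed

lemma Pl_polyring [simp]: "Pl \<in> polyring 6"
  by (simp add: Pl_def)

lemma is_ideal_line_ideal: "is_ideal (polyring 6) (line_ideal \<alpha>)"
  unfolding line_ideal_def by (rule is_ideal_ideal_gen) (auto simp: minor_quartics_def)

lemma upt_0_8: "[0..<8] = [0,1,2,3,4,5,6,7]"
  by (simp add: upt_rec numeral_eq_Suc)

text \<open>Membership becomes a polynomial identity in the variables of the matrix, since
  \<open>F\<close> only has to be a lift of the minor along \<open>theta\<close>. The row list is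
  reversed because \<open>sparse_det\<close> expands the last row first.\<close>

lemma quartic_in_line_ideal:
  assumes "length xs = 8" "sorted xs" "distinct xs" "set xs \<subseteq> {..<10}" "F \<in> polyring 6" "homog 4 F"
    and eq: "sparse_det (Mat \<alpha>) nz (rev xs) [0,1,2,3,4,5,6,7] = msubst theta F"
  shows "F \<in> line_ideal \<alpha>"
proof -
  have "sub_det (Mat \<alpha>) (rev (rev xs)) [0,1,2,3,4,5,6,7]
      = (-1) ^ (\<Sum>i<length (rev xs). i) * sparse_det (Mat \<alpha>) nz (rev xs) [0,1,2,3,4,5,6,7]"
    using assms(1) by (intro sub_det_eq_sparse_det Mat_nz) auto
  \<comment> \<open>The exponent is 0 + 1 + ... + 7 = 28, which is even.\<close>
  also have "(-1) ^ (\<Sum>i<length (rev xs). i) = (1 :: 'a mpoly)"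
    by (simp add: assms(1) lessThan_nat_numeral lessThan_Suc)
  finally have "det8 (\<lambda>i j. Mat \<alpha> (xs ! i) j) = msubst theta F"
    using assms(1) eq by (simp add: det8_eq_sub_det upt_0_8 del: One_nat_def)
  moreover have "sorted_list_of_set (set xs) = xs"
    using assms by (simp add: sorted_list_of_set.idem_if_sorted_distinct)
  ultimately have "msubst theta F = minor8 \<alpha> (set xs)"
    by (simp add: minor8_def)
  moreover have "card (set xs) = 8" using assms by (simp add: distinct_card)
  ultimately have "F \<in> minor_quartics \<alpha>"
    using assms unfolding minor_quartics_def by blast
  then show ?thesis
    using ideal_gen_superset unfolding line_ideal_def by blast
qed

section \<open>The forty-five quartics\<close>

lemma homog_4: "homog 4 (Var i * Var j * Var k * Var l)"
  using homog_mult[OF homog_mult[OF homog_mult[OF homog_Var homog_Var] homog_Var] homog_Var, of i j k l]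
  by (simp add: numeral_eq_Suc)

lemmas homog_intros = homog_4 homog_add homog_diff homog_uminus homog_numeral_mult homog_Const_mult

lemmas theta_simps = theta_def NN_def uu_def vv_def

text \<open>The two digits in the name of a minor are the indices (from 0) of the omitted rows.\<close>

lemma minor_89:
  "(Const \<alpha> * (Const \<alpha> * (M34 * M34 * M34 * M34))) + 2 * (Const \<alpha> * (M24 * M24
   * M34 * M34)) + (Const \<alpha> * (Const \<alpha> * (M23 * M23 * M34 * M34))) + (Const \<alpha>
   * (M14 * M14 * M34 * M34)) + (Const \<alpha> * (M14 * M14 * M23 * M23)) + (Const \<alpha> * (M13
   * M13 * M24 * M24)) - 2 * (Const \<alpha> * (M23 * M34 * M34 * M34)) - (Const \<alpha> * (M13 *
   M13 * M23 * M34)) \<in> line_ideal \<alpha>"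
  by (rule quartic_in_line_ideal[of "[0,1,2,3,4,5,6,7]"],
      simp, simp, simp, simp, simp, intro homog_intros, simp only: rev.simps det_rules cong: if_weak_cong,
      simp add: theta_simps, simp add: algebra_simps)

lemma minor_79:
  "2 * (Const \<alpha> * (M23 * M24 * M34 * M34)) + (Const \<alpha> * (M12 * M13 * M23 * M34)) -
   (Const \<alpha> * (Const \<alpha> * (M24 * M34 * M34 * M34))) - 2 * (Const \<alpha> * (M24 * M24
   * M24 * M34)) - (Const \<alpha> * (M14 * M14 * M24 * M34)) - (Const \<alpha> * (M12 * M13 * M24
   * M24)) \<in> line_ideal \<alpha>"
  by (rule quartic_in_line_ideal[of "[0,1,2,3,4,5,6,8]"],
      simp, simp, simp, simp, simp, intro homog_intros, simp only: rev.simps det_rules cong: if_weak_cong,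
      simp add: theta_simps, simp add: algebra_simps)

lemma minor_78:
  "(Const \<alpha> * (M12 * M14 * M23 * M24)) - (Const \<alpha> * (Const \<alpha> * (M23 * M23 *
   M24 * M34))) - (Const \<alpha> * (M13 * M14 * M23 * M23)) \<in> line_ideal \<alpha>"
  by (rule quartic_in_line_ideal[of "[0,1,2,3,4,5,6,9]"],
      simp, simp, simp, simp, simp, intro homog_intros, simp only: rev.simps det_rules cong: if_weak_cong,
      simp add: theta_simps, simp add: algebra_simps)

lemma minor_69:
  "(Const \<alpha> * (M13 * M14 * M24 * M34)) - 2 * (Const \<alpha> * (M23 * M24 * M24 * M34)) -
   (Const \<alpha> * (M12 * M13 * M23 * M24)) \<in> line_ideal \<alpha>"
  by (rule quartic_in_line_ideal[of "[0,1,2,3,4,5,7,8]"],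
      simp, simp, simp, simp, simp, intro homog_intros, simp only: rev.simps det_rules cong: if_weak_cong,
      simp add: theta_simps, simp add: algebra_simps)

lemma minor_68:
  "2 * (Const \<alpha> * (M23 * M23 * M34 * M34)) + (Const \<alpha> * (M13 * M13 * M23 * M23)) +
   (Const \<alpha> * (M12 * M14 * M34 * M34)) + (Const \<alpha> * (M12 * M14 * M23 * M23)) - (Const
   \<alpha> * (Const \<alpha> * (M23 * M34 * M34 * M34))) - (Const \<alpha> * (Const \<alpha> *
   (M23 * M23 * M23 * M34))) \<in> line_ideal \<alpha>"
  by (rule quartic_in_line_ideal[of "[0,1,2,3,4,5,7,9]"],
      simp, simp, simp, simp, simp, intro homog_intros, simp only: rev.simps det_rules cong: if_weak_cong,
      simp add: theta_simps, simp add: algebra_simps)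

lemma minor_67:
  "(Const \<alpha> * (Const \<alpha> * (M23 * M24 * M34 * M34))) - 2 * (Const \<alpha> * (M23 * M23
   * M24 * M34)) - (Const \<alpha> * (M12 * M14 * M24 * M34)) - (Const \<alpha> * (M12 * M13 * M23
   * M23)) \<in> line_ideal \<alpha>"
  by (rule quartic_in_line_ideal[of "[0,1,2,3,4,5,8,9]"],
      simp, simp, simp, simp, simp, intro homog_intros, simp only: rev.simps det_rules cong: if_weak_cong,
      simp add: theta_simps, simp add: algebra_simps)

lemma minor_59:
  "(M13 * M14 * M23 * M34) - (Const \<alpha> * (M23 * M24 * M34 * M34)) - (M14 * M14 * M23 * M24) -
   (M13 * M14 * M24 * M24) \<in> line_ideal \<alpha>"
  by (rule quartic_in_line_ideal[of "[0,1,2,3,4,6,7,8]"],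
      simp, simp, simp, simp, simp, intro homog_intros, simp only: rev.simps det_rules cong: if_weak_cong,
      simp add: theta_simps, simp add: algebra_simps)

lemma minor_58:
  "(Const \<alpha> * (M23 * M24 * M34 * M34)) + (M13 * M14 * M23 * M34) - (M12 * M14 * M24 * M34)
   \<in> line_ideal \<alpha>"
  by (rule quartic_in_line_ideal[of "[0,1,2,3,4,6,7,9]"],
      simp, simp, simp, simp, simp, intro homog_intros, simp only: rev.simps det_rules cong: if_weak_cong,
      simp add: theta_simps, simp add: algebra_simps)

lemma minor_57:
  "(M12 * M14 * M24 * M24) - (Const \<alpha> * (M23 * M24 * M24 * M34)) - (M13 * M14 * M23 * M24)
   \<in> line_ideal \<alpha>"
  by (rule quartic_in_line_ideal[of "[0,1,2,3,4,6,8,9]"],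
      simp, simp, simp, simp, simp, intro homog_intros, simp only: rev.simps det_rules cong: if_weak_cong,
      simp add: theta_simps, simp add: algebra_simps)

lemma minor_56:
  "(M13 * M14 * M23 * M23) + (M12 * M14 * M23 * M24) - (Const \<alpha> * (M23 * M23 * M24 * M34))
   \<in> line_ideal \<alpha>"
  by (rule quartic_in_line_ideal[of "[0,1,2,3,4,7,8,9]"],
      simp, simp, simp, simp, simp, intro homog_intros, simp only: rev.simps det_rules cong: if_weak_cong,
      simp add: theta_simps, simp add: algebra_simps)

lemma minor_49:
  "(Const \<alpha> * (Const \<alpha> * (M14 * M23 * M34 * M34))) + 4 * (Const \<alpha> * (M14 * M23
   * M24 * M24)) + (Const \<alpha> * (M12 * M12 * M14 * M23)) - 2 * (Const \<alpha> * (M14 * M23 *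
   M23 * M34)) - (Const \<alpha> * (Const \<alpha> * (M12 * M23 * M23 * M34))) - (Const \<alpha> *
   (M12 * M14 * M14 * M34)) \<in> line_ideal \<alpha>"
  by (rule quartic_in_line_ideal[of "[0,1,2,3,5,6,7,8]"],
      simp, simp, simp, simp, simp, intro homog_intros, simp only: rev.simps det_rules cong: if_weak_cong,
      simp add: theta_simps, simp add: algebra_simps)

lemma minor_48:
  "(Const \<alpha> * (Const \<alpha> * (M13 * M24 * M34 * M34))) + 2 * (Const \<alpha> * (Const
   \<alpha> * (M13 * M23 * M23 * M24))) + 2 * (Const \<alpha> * (M12 * M24 * M24 * M34)) + (Const
   \<alpha> * (M12 * M12 * M13 * M24)) - 2 * (Const \<alpha> * (M13 * M23 * M24 * M34)) - (Const
   \<alpha> * (M12 * M13 * M13 * M23)) \<in> line_ideal \<alpha>"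
  by (rule quartic_in_line_ideal[of "[0,1,2,3,5,6,7,9]"],
      simp, simp, simp, simp, simp, intro homog_intros, simp only: rev.simps det_rules cong: if_weak_cong,
      simp add: theta_simps, simp add: algebra_simps)

lemma minor_47:
  "2 * (Const \<alpha> * (M13 * M23 * M24 * M24)) + (Const \<alpha> * (M12 * M12 * M13 * M23)) -
   (Const \<alpha> * (Const \<alpha> * (M13 * M24 * M24 * M34))) - 2 * (Const \<alpha> * (M12 * M24
   * M24 * M24)) - (Const \<alpha> * (Const \<alpha> * (M12 * M23 * M23 * M24))) - (Const \<alpha>
   * (M12 * M12 * M12 * M24)) \<in> line_ideal \<alpha>"
  by (rule quartic_in_line_ideal[of "[0,1,2,3,5,6,8,9]"],
      simp, simp, simp, simp, simp, intro homog_intros, simp only: rev.simps det_rules cong: if_weak_cong,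
      simp add: theta_simps, simp add: algebra_simps)

lemma minor_46:
  "(Const \<alpha> * (Const \<alpha> * (M14 * M23 * M23 * M34))) + (Const \<alpha> * (M12 * M12 *
   M14 * M34)) - 2 * (Const \<alpha> * (M14 * M23 * M23 * M23)) - 2 * (Const \<alpha> * (M12 * M23
   * M24 * M24)) - (Const \<alpha> * (Const \<alpha> * (M12 * M23 * M23 * M23))) - (Const \<alpha>
   * (M12 * M12 * M12 * M23)) \<in> line_ideal \<alpha>"
  by (rule quartic_in_line_ideal[of "[0,1,2,3,5,7,8,9]"],
      simp, simp, simp, simp, simp, intro homog_intros, simp only: rev.simps det_rules cong: if_weak_cong,
      simp add: theta_simps, simp add: algebra_simps)

lemma minor_45:
  "(M12 * M13 * M14 * M23) - (Const \<alpha> * (M14 * M23 * M23 * M24)) - (Const \<alpha> * (M13 *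
   M23 * M24 * M24)) - (M12 * M12 * M14 * M24) \<in> line_ideal \<alpha>"
  by (rule quartic_in_line_ideal[of "[0,1,2,3,6,7,8,9]"],
      simp, simp, simp, simp, simp, intro homog_intros, simp only: rev.simps det_rules cong: if_weak_cong,
      simp add: theta_simps, simp add: algebra_simps)

lemma minor_39:
  "2 * (Const \<alpha> * (M14 * M23 * M34 * M34)) + (Const \<alpha> * (Const \<alpha> * (M12 * M23
   * M34 * M34))) + (Const \<alpha> * (M12 * M14 * M14 * M23)) - (Const \<alpha> * (Const \<alpha>
   * (M14 * M34 * M34 * M34))) - 2 * (Const \<alpha> * (M14 * M24 * M24 * M34)) - (Const \<alpha> *
   (M14 * M14 * M14 * M34)) \<in> line_ideal \<alpha>"
  by (rule quartic_in_line_ideal[of "[0,1,2,4,5,6,7,8]"],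
      simp, simp, simp, simp, simp, intro homog_intros, simp only: rev.simps det_rules cong: if_weak_cong,
      simp add: theta_simps, simp add: algebra_simps)

lemma minor_38:
  "(Const \<alpha> * (M12 * M13 * M14 * M24)) - (Const \<alpha> * (Const \<alpha> * (M13 * M23 *
   M24 * M34))) - (Const \<alpha> * (M13 * M13 * M14 * M23)) \<in> line_ideal \<alpha>"
  by (rule quartic_in_line_ideal[of "[0,1,2,4,5,6,7,9]"],
      simp, simp, simp, simp, simp, intro homog_intros, simp only: rev.simps det_rules cong: if_weak_cong,
      simp add: theta_simps, simp add: algebra_simps)

lemma minor_37:
  "(Const \<alpha> * (Const \<alpha> * (M12 * M23 * M24 * M34))) + (Const \<alpha> * (M12 * M13 *
   M14 * M23)) - (Const \<alpha> * (M12 * M12 * M14 * M24)) \<in> line_ideal \<alpha>"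
  by (rule quartic_in_line_ideal[of "[0,1,2,4,5,6,8,9]"],
      simp, simp, simp, simp, simp, intro homog_intros, simp only: rev.simps det_rules cong: if_weak_cong,
      simp add: theta_simps, simp add: algebra_simps)

lemma minor_36:
  "2 * (Const \<alpha> * (M14 * M23 * M23 * M34)) + (Const \<alpha> * (Const \<alpha> * (M12 * M23
   * M23 * M34))) + (Const \<alpha> * (M12 * M14 * M14 * M34)) - (Const \<alpha> * (Const \<alpha>
   * (M14 * M23 * M34 * M34))) - (Const \<alpha> * (M12 * M12 * M14 * M23)) \<in> line_ideal
   \<alpha>"
  by (rule quartic_in_line_ideal[of "[0,1,2,4,5,7,8,9]"],
      simp, simp, simp, simp, simp, intro homog_intros, simp only: rev.simps det_rules cong: if_weak_cong,
      simp add: theta_simps, simp add: algebra_simps)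

lemma minor_35:
  "(Const \<alpha> * (M14 * M23 * M24 * M34)) + (M13 * M14 * M14 * M23) - (M12 * M14 * M14 * M24)
   \<in> line_ideal \<alpha>"
  by (rule quartic_in_line_ideal[of "[0,1,2,4,6,7,8,9]"],
      simp, simp, simp, simp, simp, intro homog_intros, simp only: rev.simps det_rules cong: if_weak_cong,
      simp add: theta_simps, simp add: algebra_simps)

lemma minor_34:
  "(Const \<alpha> * (Const \<alpha> * (M13 * M14 * M24 * M34))) + 2 * (Const \<alpha> * (M12 * M14
   * M24 * M24)) - 2 * (Const \<alpha> * (M13 * M14 * M23 * M24)) - (Const \<alpha> * (Const
   \<alpha> * (M12 * M13 * M23 * M24))) \<in> line_ideal \<alpha>"
  by (rule quartic_in_line_ideal[of "[0,1,2,5,6,7,8,9]"],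
      simp, simp, simp, simp, simp, intro homog_intros, simp only: rev.simps det_rules cong: if_weak_cong,
      simp add: theta_simps, simp add: algebra_simps)

lemma minor_29:
  "(Const \<alpha> * (M13 * M14 * M14 * M34)) - 2 * (Const \<alpha> * (M14 * M23 * M24 * M34)) -
   (Const \<alpha> * (M12 * M13 * M14 * M23)) \<in> line_ideal \<alpha>"
  by (rule quartic_in_line_ideal[of "[0,1,3,4,5,6,7,8]"],
      simp, simp, simp, simp, simp, intro homog_intros, simp only: rev.simps det_rules cong: if_weak_cong,
      simp add: theta_simps, simp add: algebra_simps)

lemma minor_28:
  "2 * (Const \<alpha> * (M13 * M23 * M34 * M34)) + (Const \<alpha> * (M13 * M13 * M13 * M23)) -
   (Const \<alpha> * (Const \<alpha> * (M13 * M34 * M34 * M34))) - (Const \<alpha> * (Const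
   \<alpha> * (M13 * M23 * M23 * M34))) - 2 * (Const \<alpha> * (M12 * M24 * M34 * M34)) - (Const
   \<alpha> * (M12 * M13 * M13 * M24)) \<in> line_ideal \<alpha>"
  by (rule quartic_in_line_ideal[of "[0,1,3,4,5,6,7,9]"],
      simp, simp, simp, simp, simp, intro homog_intros, simp only: rev.simps det_rules cong: if_weak_cong,
      simp add: theta_simps, simp add: algebra_simps)

lemma minor_27:
  "(Const \<alpha> * (Const \<alpha> * (M13 * M24 * M34 * M34))) + 2 * (Const \<alpha> * (M12 * M24
   * M24 * M34)) + (Const \<alpha> * (M12 * M12 * M13 * M24)) - 2 * (Const \<alpha> * (M13 * M23 *
   M24 * M34)) - (Const \<alpha> * (M12 * M13 * M13 * M23)) \<in> line_ideal \<alpha>"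
  by (rule quartic_in_line_ideal[of "[0,1,3,4,5,6,8,9]"],
      simp, simp, simp, simp, simp, intro homog_intros, simp only: rev.simps det_rules cong: if_weak_cong,
      simp add: theta_simps, simp add: algebra_simps)

lemma minor_26:
  "2 * (Const \<alpha> * (M12 * M23 * M24 * M34)) + (Const \<alpha> * (M12 * M12 * M13 * M23)) -
   (Const \<alpha> * (M12 * M13 * M14 * M34)) \<in> line_ideal \<alpha>"
  by (rule quartic_in_line_ideal[of "[0,1,3,4,5,7,8,9]"],
      simp, simp, simp, simp, simp, intro homog_intros, simp only: rev.simps det_rules cong: if_weak_cong,
      simp add: theta_simps, simp add: algebra_simps)

lemma minor_25:
  "(Const \<alpha> * (M13 * M23 * M24 * M34)) + (M12 * M13 * M14 * M24) - (M13 * M13 * M14 * M23)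
   \<in> line_ideal \<alpha>"
  by (rule quartic_in_line_ideal[of "[0,1,3,4,6,7,8,9]"],
      simp, simp, simp, simp, simp, intro homog_intros, simp only: rev.simps det_rules cong: if_weak_cong,
      simp add: theta_simps, simp add: algebra_simps)

lemma minor_24:
  "2 * (Const \<alpha> * (M13 * M14 * M23 * M23)) + (Const \<alpha> * (Const \<alpha> * (M12 * M13
   * M23 * M23))) - (Const \<alpha> * (Const \<alpha> * (M13 * M14 * M23 * M34))) - 2 * (Const
   \<alpha> * (M12 * M14 * M23 * M24)) \<in> line_ideal \<alpha>"
  by (rule quartic_in_line_ideal[of "[0,1,3,5,6,7,8,9]"],
      simp, simp, simp, simp, simp, intro homog_intros, simp only: rev.simps det_rules cong: if_weak_cong,
      simp add: theta_simps, simp add: algebra_simps)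

lemma minor_23:
  "(Const \<alpha> * (Const \<alpha> * (M13 * M14 * M34 * M34))) + 2 * (Const \<alpha> * (M12 * M14
   * M24 * M34)) - 2 * (Const \<alpha> * (M13 * M14 * M23 * M34)) - (Const \<alpha> * (Const
   \<alpha> * (M12 * M13 * M23 * M34))) \<in> line_ideal \<alpha>"
  by (rule quartic_in_line_ideal[of "[0,1,4,5,6,7,8,9]"],
      simp, simp, simp, simp, simp, intro homog_intros, simp only: rev.simps det_rules cong: if_weak_cong,
      simp add: theta_simps, simp add: algebra_simps)

lemma minor_19:
  "(Const \<alpha> * (M13 * M13 * M14 * M34)) - (Const \<alpha> * (Const \<alpha> * (M13 * M24 *
   M34 * M34))) - 2 * (Const \<alpha> * (M13 * M14 * M14 * M24)) - 2 * (Const \<alpha> * (M12 * M24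
   * M24 * M34)) - (Const \<alpha> * (M12 * M12 * M13 * M24)) \<in> line_ideal \<alpha>"
  by (rule quartic_in_line_ideal[of "[0,2,3,4,5,6,7,8]"],
      simp, simp, simp, simp, simp, intro homog_intros, simp only: rev.simps det_rules cong: if_weak_cong,
      simp add: theta_simps, simp add: algebra_simps)

lemma minor_18:
  "(Const \<alpha> * (Const \<alpha> * (M14 * M23 * M34 * M34))) + (Const \<alpha> * (M13 * M13 *
   M14 * M34)) + 2 * (Const \<alpha> * (M12 * M23 * M34 * M34)) + (Const \<alpha> * (M12 * M13 *
   M13 * M23)) + (Const \<alpha> * (M12 * M12 * M14 * M23)) - (Const \<alpha> * (Const \<alpha> *
   (M12 * M23 * M23 * M34))) - (Const \<alpha> * (M12 * M14 * M14 * M34)) \<in> line_ideal \<alpha>"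
  by (rule quartic_in_line_ideal[of "[0,2,3,4,5,6,7,9]"],
      simp, simp, simp, simp, simp, intro homog_intros, simp only: rev.simps det_rules cong: if_weak_cong,
      simp add: theta_simps, simp add: algebra_simps)

lemma minor_17:
  "(Const \<alpha> * (M12 * M14 * M14 * M24)) - (Const \<alpha> * (Const \<alpha> * (M14 * M23 *
   M24 * M34))) - (Const \<alpha> * (M13 * M13 * M14 * M24)) - 2 * (Const \<alpha> * (M12 * M23 *
   M24 * M34)) - (Const \<alpha> * (M12 * M12 * M13 * M23)) \<in> line_ideal \<alpha>"
  by (rule quartic_in_line_ideal[of "[0,2,3,4,5,6,8,9]"],
      simp, simp, simp, simp, simp, intro homog_intros, simp only: rev.simps det_rules cong: if_weak_cong,
      simp add: theta_simps, simp add: algebra_simps)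

lemma minor_16:
  "(Const \<alpha> * (M13 * M13 * M14 * M23)) + (Const \<alpha> * (M12 * M13 * M14 * M24)) - (Const
   \<alpha> * (Const \<alpha> * (M13 * M23 * M24 * M34))) \<in> line_ideal \<alpha>"
  by (rule quartic_in_line_ideal[of "[0,2,3,4,5,7,8,9]"],
      simp, simp, simp, simp, simp, intro homog_intros, simp only: rev.simps det_rules cong: if_weak_cong,
      simp add: theta_simps, simp add: algebra_simps)

lemma minor_15:
  "(Const \<alpha> * (M12 * M23 * M24 * M34)) - (M12 * M13 * M14 * M23) - (M12 * M12 * M14 * M24)
   \<in> line_ideal \<alpha>"
  by (rule quartic_in_line_ideal[of "[0,2,3,4,6,7,8,9]"],
      simp, simp, simp, simp, simp, intro homog_intros, simp only: rev.simps det_rules cong: if_weak_cong,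
      simp add: theta_simps, simp add: algebra_simps)

lemma minor_14:
  "(Const \<alpha> * (Const \<alpha> * (M14 * M14 * M23 * M23))) + (Const \<alpha> * (Const
   \<alpha> * (M13 * M13 * M24 * M24))) + 2 * (Const \<alpha> * (M12 * M14 * M23 * M23)) + 2 *
   (Const \<alpha> * (M12 * M12 * M24 * M24)) + (Const \<alpha> * (Const \<alpha> * (M12 * M12 *
   M23 * M23))) + (Const \<alpha> * (M12 * M12 * M14 * M14)) + (Const \<alpha> * (M12 * M12 * M12 *
   M12)) - (Const \<alpha> * (M12 * M13 * M13 * M14)) \<in> line_ideal \<alpha>"
  by (rule quartic_in_line_ideal[of "[0,2,3,5,6,7,8,9]"],
      simp, simp, simp, simp, simp, intro homog_intros, simp only: rev.simps det_rules cong: if_weak_cong,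
      simp add: theta_simps, simp add: algebra_simps)

lemma minor_13:
  "(Const \<alpha> * (M12 * M14 * M14 * M14)) + (Const \<alpha> * (M12 * M12 * M12 * M14)) - (Const
   \<alpha> * (Const \<alpha> * (M14 * M14 * M23 * M34))) - (Const \<alpha> * (M13 * M13 * M14 *
   M14)) - 2 * (Const \<alpha> * (M12 * M14 * M23 * M34)) - (Const \<alpha> * (Const \<alpha> *
   (M12 * M12 * M23 * M34))) \<in> line_ideal \<alpha>"
  by (rule quartic_in_line_ideal[of "[0,2,4,5,6,7,8,9]"],
      simp, simp, simp, simp, simp, intro homog_intros, simp only: rev.simps det_rules cong: if_weak_cong,
      simp add: theta_simps, simp add: algebra_simps)

lemma minor_12:
  "(Const \<alpha> * (M13 * M13 * M13 * M14)) - (Const \<alpha> * (Const \<alpha> * (M13 * M13 *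
   M24 * M34))) - (Const \<alpha> * (M12 * M13 * M14 * M14)) - 2 * (Const \<alpha> * (M12 * M12 *
   M24 * M34)) - (Const \<alpha> * (M12 * M12 * M12 * M13)) \<in> line_ideal \<alpha>"
  by (rule quartic_in_line_ideal[of "[0,3,4,5,6,7,8,9]"],
      simp, simp, simp, simp, simp, intro homog_intros, simp only: rev.simps det_rules cong: if_weak_cong,
      simp add: theta_simps, simp add: algebra_simps)

lemma minor_09:
  "2 * (M14 * M14 * M23 * M24) + (Const \<alpha> * (M13 * M14 * M34 * M34)) + 2 * (M13 * M14 * M24
   * M24) - 2 * (M13 * M14 * M23 * M34) - (Const \<alpha> * (M12 * M13 * M23 * M34)) \<in>
   line_ideal \<alpha>"
  by (rule quartic_in_line_ideal[of "[1,2,3,4,5,6,7,8]"],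
      simp, simp, simp, simp, simp, intro homog_intros, simp only: rev.simps det_rules cong: if_weak_cong,
      simp add: theta_simps, simp add: algebra_simps)

lemma minor_08:
  "(Const \<alpha> * (M13 * M14 * M34 * M34)) + (Const \<alpha> * (M13 * M14 * M23 * M23)) + (Const
   \<alpha> * (M13 * M13 * M23 * M24)) + 2 * (M12 * M14 * M24 * M34) - 2 * (M13 * M14 * M23 * M34)
   \<in> line_ideal \<alpha>"
  by (rule quartic_in_line_ideal[of "[1,2,3,4,5,6,7,9]"],
      simp, simp, simp, simp, simp, intro homog_intros, simp only: rev.simps det_rules cong: if_weak_cong,
      simp add: theta_simps, simp add: algebra_simps)

lemma minor_07:
  "2 * (M13 * M14 * M23 * M24) - (Const \<alpha> * (M13 * M14 * M24 * M34)) - 2 * (M12 * M14 * M24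
   * M24) - (Const \<alpha> * (M12 * M13 * M23 * M24)) \<in> line_ideal \<alpha>"
  by (rule quartic_in_line_ideal[of "[1,2,3,4,5,6,8,9]"],
      simp, simp, simp, simp, simp, intro homog_intros, simp only: rev.simps det_rules cong: if_weak_cong,
      simp add: theta_simps, simp add: algebra_simps)

lemma minor_06:
  "(Const \<alpha> * (M13 * M14 * M23 * M34)) - 2 * (M13 * M14 * M23 * M23) - 2 * (M12 * M14 * M23
   * M24) - (Const \<alpha> * (M12 * M13 * M23 * M23)) \<in> line_ideal \<alpha>"
  by (rule quartic_in_line_ideal[of "[1,2,3,4,5,7,8,9]"],
      simp, simp, simp, simp, simp, intro homog_intros, simp only: rev.simps det_rules cong: if_weak_cong,
      simp add: theta_simps, simp add: algebra_simps)

text \<open>The one minor with a single term. It puts \<open>bcde\<close> into the ideal, which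
  serves the four cubics \<open>bcd\<close>, \<open>bce\<close>, \<open>bde\<close>,
  \<open>cde\<close> at once.\<close>

lemma minor_05:
  "- (2 * (M13 * M14 * M23 * M24)) \<in> line_ideal \<alpha>"
  by (rule quartic_in_line_ideal[of "[1,2,3,4,6,7,8,9]"],
      simp, simp, simp, simp, simp, intro homog_intros, simp only: rev.simps det_rules cong: if_weak_cong,
      simp add: theta_simps, simp add: algebra_simps)

lemma minor_04:
  "2 * (M12 * M13 * M14 * M23) + (Const \<alpha> * (M12 * M12 * M13 * M23)) - (Const \<alpha> *
   (M12 * M13 * M14 * M34)) - 2 * (M12 * M12 * M14 * M24) \<in> line_ideal \<alpha>"
  by (rule quartic_in_line_ideal[of "[1,2,3,5,6,7,8,9]"],
      simp, simp, simp, simp, simp, intro homog_intros, simp only: rev.simps det_rules cong: if_weak_cong,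
      simp add: theta_simps, simp add: algebra_simps)

lemma minor_03:
  "2 * (M13 * M14 * M14 * M23) + (Const \<alpha> * (M12 * M13 * M14 * M23)) - (Const \<alpha> *
   (M13 * M14 * M14 * M34)) - 2 * (M12 * M14 * M14 * M24) \<in> line_ideal \<alpha>"
  by (rule quartic_in_line_ideal[of "[1,2,4,5,6,7,8,9]"],
      simp, simp, simp, simp, simp, intro homog_intros, simp only: rev.simps det_rules cong: if_weak_cong,
      simp add: theta_simps, simp add: algebra_simps)

lemma minor_02:
  "(Const \<alpha> * (M13 * M13 * M14 * M34)) + 2 * (M12 * M13 * M14 * M24) - 2 * (M13 * M13 * M14
   * M23) - (Const \<alpha> * (M12 * M13 * M13 * M23)) \<in> line_ideal \<alpha>"
  by (rule quartic_in_line_ideal[of "[1,3,4,5,6,7,8,9]"],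
      simp, simp, simp, simp, simp, intro homog_intros, simp only: rev.simps det_rules cong: if_weak_cong,
      simp add: theta_simps, simp add: algebra_simps)

lemma minor_01:
  "- ((Const \<alpha> * (M13 * M14 * M14 * M23))) - (Const \<alpha> * (M13 * M13 * M14 * M24)) - 2
   * (M12 * M13 * M14 * M23) - 2 * (M12 * M12 * M14 * M24) - (Const \<alpha> * (M12 * M12 * M13 *
   M23)) \<in> line_ideal \<alpha>"
  by (rule quartic_in_line_ideal[of "[2,3,4,5,6,7,8,9]"],
      simp, simp, simp, simp, simp, intro homog_intros, simp only: rev.simps det_rules cong: if_weak_cong,
      simp add: theta_simps, simp add: algebra_simps)

section \<open>Calculus with members of the line ideal\<close>

lemma line_add: "x \<in> line_ideal \<alpha> \<Longrightarrow> y \<in> line_ideal \<alpha> \<Longrightarrow> x + y \<in> line_ideal \<alpha>"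
  and line_mult: "r \<in> polyring 6 \<Longrightarrow> x \<in> line_ideal \<alpha> \<Longrightarrow> r * x \<in> line_ideal \<alpha>"
  and line_0 [simp]: "0 \<in> line_ideal \<alpha>"
  and line_polyring: "x \<in> line_ideal \<alpha> \<Longrightarrow> x \<in> polyring 6"
  using is_ideal_line_ideal[of \<alpha>] unfolding is_ideal_def by auto

lemma line_scale: "x \<in> line_ideal \<alpha> \<Longrightarrow> Const c * x \<in> line_ideal \<alpha>"
  by (simp add: line_mult)

lemma line_uminus: "x \<in> line_ideal \<alpha> \<Longrightarrow> - x \<in> line_ideal \<alpha>"
  using line_scale[of x \<alpha> "-1"] by (simp add: Const_uminus)

lemma Pl_line: "Pl \<in> line_ideal \<alpha>"
  using ideal_gen_superset unfolding line_ideal_def by blast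

lemma Pl_mult: "i < 6 \<Longrightarrow> j < 6 \<Longrightarrow> Var i * Var j * Pl \<in> line_ideal \<alpha>"
  by (intro line_mult Pl_line) simp

text \<open>The membership certificates have the form \<open>Const c * t = s\<close> with
  coefficients polynomial in \<alpha>. Division by \<open>c\<close> happens only here, so the
  identities to be checked contain no fractions.\<close>

lemma line_cancel:
  fixes c :: "'k::field"
  assumes "c \<noteq> 0" "s \<in> line_ideal \<alpha>" "Const c * t = s"
  shows "t \<in> line_ideal \<alpha>"
proof -
  have "t = Const (inverse c * c) * t" using assms(1) by simp
  also have "\<dots> = Const (inverse c) * s" using assms(3) by (simp only: Const_mult mult.assoc)
  finally show ?thesis using assms(2) by (simp add: line_scale)
qed

section \<open>The saturation\<close>

text \<open>The colon ideal of the line ideal by the ideal of the six variables, that is, one step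
  of the saturation. The cubics of the saturation already lie in it.\<close>

definition linsat :: "'k::comm_ring_1 \<Rightarrow> 'k mpoly set" where
  "linsat \<alpha> = {g \<in> polyring 6. \<forall>i<6. Var i * g \<in> line_ideal \<alpha>}"

lemma linsatI:
  assumes "g \<in> polyring 6" "M12 * g \<in> line_ideal \<alpha>" "M13 * g \<in> line_ideal \<alpha>" "M14 * g \<in> line_ideal \<alpha>"
    "M23 * g \<in> line_ideal \<alpha>" "M24 * g \<in> line_ideal \<alpha>" "M34 * g \<in> line_ideal \<alpha>"
  shows "g \<in> linsat \<alpha>"
proof -
  have "i \<in> {0,1,2,3,4,5}" if "i < 6" for i :: nat using that by auto
  then show ?thesis using assms by (auto simp: linsat_def)
qed

definition QQ :: "'k::comm_ring_1 \<Rightarrow> 'k mpoly" where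
  "QQ \<alpha> = M12 * M12 + M14 * M14 + 2 * (M24 * M24) + Const \<alpha> * (M23 * M23) + Const \<alpha> * (M34 * M34)
     - 2 * (M23 * M34)"

text \<open>All eight curves lie on this cubic: \<open>Q\<close> and \<open>b^2c\<close> both vanish
  on the conics and quartics, \<open>a\<close> and \<open>b^2c\<close> on the lines and on the plane
  cubic in \<open>a = c = e = 0\<close>, and on the other plane cubic it is the equation.
  \<open>cubic2\<close> is its counterpart for the plane cubic in
  \<open>a = c = e = 0\<close>.\<close>

definition cubic1 :: "'k::comm_ring_1 \<Rightarrow> 'k mpoly" where
  "cubic1 \<alpha> = M12 * QQ \<alpha> - M13 * M13 * M14"

definition cubic2 :: "'k::comm_ring_1 \<Rightarrow> 'k mpoly" where
  "cubic2 \<alpha> = M34 * QQ \<alpha> - M13 * M13 * M23"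

lemma QQ_polyring [simp]: "QQ \<alpha> \<in> polyring 6"
  and cubic1_polyring [simp]: "cubic1 \<alpha> \<in> polyring 6"
  and cubic2_polyring [simp]: "cubic2 \<alpha> \<in> polyring 6"
  by (simp_all add: QQ_def cubic1_def cubic2_def)

lemmas cert_simps = Const_mult Const_uminus Const_numeral power2_eq_square power3_eq_cube Pl_def
  QQ_def cubic1_def cubic2_def algebra_simps

text \<open>With $a,\dots,f$ for $M_{12},\dots,M_{34}$, the saturation of the line ideal is generated by the
  Pluecker quadric, the cubics $abd, ace, bcd, bce, bcf, bde, cde, def$, the two cubics above and $cdQ$. It
  agrees with the line ideal from degree 4 on; the coefficients below solve the resulting linear systems.\<close>

lemma sat_abd:
  assumes "\<alpha> \<noteq> (0::'k::field_char_0)"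
  shows "M12 * M13 * M23 \<in> linsat \<alpha>"
proof -
  have "M12 * (M12 * M13 * M23) \<in> line_ideal \<alpha>"
    by (rule line_cancel[of "2 * \<alpha>^2", OF _ line_add[OF line_add[OF line_add[OF line_add[OF line_scale[of _ _ "-(\<alpha>)", OF minor_17]
      line_scale[of _ _ "-(\<alpha>^2)", OF minor_35]]
      line_scale[of _ _ "\<alpha>", OF minor_04]]
      line_scale[of _ _ "-2", OF minor_37]]
      line_scale[of _ _ "\<alpha>^2", OF Pl_mult[of 1 2]]]])
      (use assms in \<open>simp_all add: cert_simps\<close>)
  moreover have "M13 * (M12 * M13 * M23) \<in> line_ideal \<alpha>"
    by (rule line_cancel[of "2 * \<alpha>^2", OF _ line_add[OF line_add[OF line_add[OF line_add[OF line_scale[of _ _ "\<alpha>", OF minor_18]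
      line_scale[of _ _ "-2 * \<alpha>^2", OF Pl_mult[of 3 5]]]
      line_scale[of _ _ "-(\<alpha>)", OF minor_02]]
      line_scale[of _ _ "\<alpha>", OF minor_36]]
      line_scale[of _ _ "2", OF minor_38]]])
      (use assms in \<open>simp_all add: cert_simps\<close>)
  moreover have "M14 * (M12 * M13 * M23) \<in> line_ideal \<alpha>"
    by (rule line_cancel[of "2 * \<alpha>", OF _ line_add[OF line_scale[of _ _ "1", OF minor_37]
      line_scale[of _ _ "-(\<alpha>)", OF minor_15]]])
      (use assms in \<open>simp_all add: cert_simps\<close>)
  moreover have "M23 * (M12 * M13 * M23) \<in> line_ideal \<alpha>"
    by (rule line_cancel[of "2 * \<alpha>^2", OF _ line_add[OF line_add[OF line_add[OF line_scale[of _ _ "-(\<alpha>)", OF minor_67]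
      line_scale[of _ _ "2", OF minor_78]]
      line_scale[of _ _ "\<alpha>^2", OF minor_58]]
      line_scale[of _ _ "1", OF minor_24]]])
      (use assms in \<open>simp_all add: cert_simps\<close>)
  moreover have "M24 * (M12 * M13 * M23) \<in> line_ideal \<alpha>"
    by (rule line_cancel[of "2 * \<alpha>^2", OF _ line_add[OF line_scale[of _ _ "-(\<alpha>)", OF minor_07]
      line_scale[of _ _ "-1", OF minor_34]]])
      (use assms in \<open>simp_all add: cert_simps\<close>)
  moreover have "M34 * (M12 * M13 * M23) \<in> line_ideal \<alpha>"
    by (rule line_cancel[of "2 * \<alpha>^2", OF _ line_add[OF line_add[OF line_add[OF line_add[OF line_scale[of _ _ "\<alpha>", OF minor_08]
      line_scale[of _ _ "\<alpha>^2", OF Pl_mult[of 1 3]]]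
      line_scale[of _ _ "-(\<alpha>^2)", OF minor_56]]
      line_scale[of _ _ "\<alpha>", OF minor_78]]
      line_scale[of _ _ "-1", OF minor_23]]])
      (use assms in \<open>simp_all add: cert_simps\<close>)
  ultimately show ?thesis by (intro linsatI) simp_all
qed

lemma sat_ace:
  assumes "\<alpha> \<noteq> (0::'k::field_char_0)"
  shows "M12 * M14 * M24 \<in> linsat \<alpha>"
proof -
  have "M12 * (M12 * M14 * M24) \<in> line_ideal \<alpha>"
    by (rule line_cancel[of "4", OF _ line_add[OF line_add[OF line_scale[of _ _ "-2", OF minor_15]
      line_scale[of _ _ "-1", OF minor_04]]
      line_scale[of _ _ "1", OF minor_26]]])
      (use assms in \<open>simp_all add: cert_simps\<close>)
  moreover have "M13 * (M12 * M14 * M24) \<in> line_ideal \<alpha>"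
    by (rule line_cancel[of "2 * \<alpha>", OF _ line_add[OF line_scale[of _ _ "\<alpha>", OF minor_25]
      line_scale[of _ _ "1", OF minor_16]]])
      (use assms in \<open>simp_all add: cert_simps\<close>)
  moreover have "M14 * (M12 * M14 * M24) \<in> line_ideal \<alpha>"
    by (rule line_cancel[of "4 * \<alpha>", OF _ line_add[OF line_add[OF line_add[OF line_add[OF line_scale[of _ _ "-(\<alpha>)", OF minor_03]
      line_scale[of _ _ "-(\<alpha>)", OF minor_29]]
      line_scale[of _ _ "-2", OF minor_01]]
      line_scale[of _ _ "4", OF minor_15]]
      line_scale[of _ _ "2", OF minor_17]]])
      (use assms in \<open>simp_all add: cert_simps\<close>)
  moreover have "M23 * (M12 * M14 * M24) \<in> line_ideal \<alpha>"
    by (rule line_cancel[of "4 * \<alpha>", OF _ line_add[OF line_scale[of _ _ "-1", OF minor_24]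
      line_scale[of _ _ "-(\<alpha>)", OF minor_06]]])
      (use assms in \<open>simp_all add: cert_simps\<close>)
  moreover have "M24 * (M12 * M14 * M24) \<in> line_ideal \<alpha>"
    by (rule line_cancel[of "4 * \<alpha>", OF _ line_add[OF line_add[OF line_add[OF line_scale[of _ _ "-(\<alpha>)", OF minor_69]
      line_scale[of _ _ "2 * \<alpha>", OF minor_57]]
      line_scale[of _ _ "-2 * \<alpha>", OF minor_05]]
      line_scale[of _ _ "1", OF minor_34]]])
      (use assms in \<open>simp_all add: cert_simps\<close>)
  moreover have "M34 * (M12 * M14 * M24) \<in> line_ideal \<alpha>"
    by (rule line_cancel[of "4 * \<alpha>", OF _ line_add[OF line_add[OF line_add[OF line_add[OF line_add[OF line_scale[of _ _ "-(\<alpha>)", OF minor_09]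
      line_scale[of _ _ "-2 * \<alpha>", OF minor_59]]
      line_scale[of _ _ "2", OF minor_06]]
      line_scale[of _ _ "4", OF minor_56]]
      line_scale[of _ _ "-2", OF minor_67]]
      line_scale[of _ _ "1", OF minor_23]]])
      (use assms in \<open>simp_all add: cert_simps\<close>)
  ultimately show ?thesis by (intro linsatI) simp_all
qed

lemma sat_bcd:
  assumes "\<alpha> \<noteq> (0::'k::field_char_0)"
  shows "M13 * M14 * M23 \<in> linsat \<alpha>"
proof -
  have "M12 * (M13 * M14 * M23) \<in> line_ideal \<alpha>"
    by (rule line_cancel[of "2 * \<alpha>", OF _ line_add[OF line_scale[of _ _ "1", OF minor_37]
      line_scale[of _ _ "-(\<alpha>)", OF minor_15]]])
      (use assms in \<open>simp_all add: cert_simps\<close>)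
  moreover have "M13 * (M13 * M14 * M23) \<in> line_ideal \<alpha>"
    by (rule line_cancel[of "2 * \<alpha>", OF _ line_add[OF line_scale[of _ _ "1", OF minor_16]
      line_scale[of _ _ "-1", OF minor_38]]])
      (use assms in \<open>simp_all add: cert_simps\<close>)
  moreover have "M14 * (M13 * M14 * M23) \<in> line_ideal \<alpha>"
    by (rule line_cancel[of "2 * \<alpha>", OF _ line_add[OF line_add[OF line_add[OF line_scale[of _ _ "-1", OF minor_01]
      line_scale[of _ _ "2", OF minor_15]]
      line_scale[of _ _ "1", OF minor_17]]
      line_scale[of _ _ "\<alpha>", OF minor_35]]])
      (use assms in \<open>simp_all add: cert_simps\<close>)
  moreover have "M23 * (M13 * M14 * M23) \<in> line_ideal \<alpha>"
    by (rule line_cancel[of "2 * \<alpha>", OF _ line_add[OF line_scale[of _ _ "\<alpha>", OF minor_56]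
      line_scale[of _ _ "-1", OF minor_78]]])
      (use assms in \<open>simp_all add: cert_simps\<close>)
  moreover have "M24 * (M13 * M14 * M23) \<in> line_ideal \<alpha>"
    by (rule line_cancel[of "2", OF _ line_scale[of _ _ "-1", OF minor_05]])
      (use assms in \<open>simp_all add: cert_simps\<close>)
  moreover have "M34 * (M13 * M14 * M23) \<in> line_ideal \<alpha>"
    by (rule line_cancel[of "2 * \<alpha>", OF _ line_add[OF line_add[OF line_add[OF line_scale[of _ _ "1", OF minor_06]
      line_scale[of _ _ "2", OF minor_56]]
      line_scale[of _ _ "-1", OF minor_67]]
      line_scale[of _ _ "\<alpha>", OF minor_58]]])
      (use assms in \<open>simp_all add: cert_simps\<close>)
  ultimately show ?thesis by (intro linsatI) simp_all
qed

lemma sat_bce: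
  assumes "\<alpha> \<noteq> (0::'k::field_char_0)"
  shows "M13 * M14 * M24 \<in> linsat \<alpha>"
proof -
  have "M12 * (M13 * M14 * M24) \<in> line_ideal \<alpha>"
    by (rule line_cancel[of "2 * \<alpha>", OF _ line_add[OF line_scale[of _ _ "\<alpha>", OF minor_25]
      line_scale[of _ _ "1", OF minor_16]]])
      (use assms in \<open>simp_all add: cert_simps\<close>)
  moreover have "M13 * (M13 * M14 * M24) \<in> line_ideal \<alpha>"
    by (rule line_cancel[of "2 * \<alpha>", OF _ line_add[OF line_add[OF line_add[OF line_scale[of _ _ "-(\<alpha>)", OF Pl_mult[of 1 2]]
      line_scale[of _ _ "-1", OF minor_26]]
      line_scale[of _ _ "-1", OF minor_01]]
      line_scale[of _ _ "2", OF minor_15]]])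
      (use assms in \<open>simp_all add: cert_simps\<close>)
  moreover have "M14 * (M13 * M14 * M24) \<in> line_ideal \<alpha>"
    by (rule line_cancel[of "2 * \<alpha>", OF _ line_add[OF line_add[OF line_add[OF line_scale[of _ _ "-1", OF minor_19]
      line_scale[of _ _ "-1", OF minor_27]]
      line_scale[of _ _ "1", OF minor_02]]
      line_scale[of _ _ "-2", OF minor_25]]])
      (use assms in \<open>simp_all add: cert_simps\<close>)
  moreover have "M23 * (M13 * M14 * M24) \<in> line_ideal \<alpha>"
    by (rule line_cancel[of "2", OF _ line_scale[of _ _ "-1", OF minor_05]])
      (use assms in \<open>simp_all add: cert_simps\<close>)
  moreover have "M24 * (M13 * M14 * M24) \<in> line_ideal \<alpha>"
    by (rule line_cancel[of "2 * \<alpha>", OF _ line_add[OF line_add[OF line_add[OF line_add[OF line_scale[of _ _ "-(\<alpha>)", OF Pl_mult[of 2 4]]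
      line_scale[of _ _ "-(\<alpha>)", OF minor_59]]
      line_scale[of _ _ "1", OF minor_06]]
      line_scale[of _ _ "2", OF minor_56]]
      line_scale[of _ _ "-1", OF minor_67]]])
      (use assms in \<open>simp_all add: cert_simps\<close>)
  moreover have "M34 * (M13 * M14 * M24) \<in> line_ideal \<alpha>"
    by (rule line_cancel[of "2 * \<alpha>", OF _ line_add[OF line_add[OF line_scale[of _ _ "-1", OF minor_07]
      line_scale[of _ _ "1", OF minor_69]]
      line_scale[of _ _ "-2", OF minor_57]]])
      (use assms in \<open>simp_all add: cert_simps\<close>)
  ultimately show ?thesis by (intro linsatI) simp_all
qed

lemma sat_bcf:
  assumes "\<alpha> \<noteq> (0::'k::field_char_0)"
  shows "M13 * M14 * M34 \<in> linsat \<alpha>"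
proof -
  have "M12 * (M13 * M14 * M34) \<in> line_ideal \<alpha>"
    by (rule line_cancel[of "2 * \<alpha>", OF _ line_add[OF line_add[OF line_add[OF line_scale[of _ _ "-1", OF minor_26]
      line_scale[of _ _ "-1", OF minor_17]]
      line_scale[of _ _ "-(\<alpha>)", OF minor_35]]
      line_scale[of _ _ "\<alpha>", OF Pl_mult[of 1 2]]]])
      (use assms in \<open>simp_all add: cert_simps\<close>)
  moreover have "M13 * (M13 * M14 * M34) \<in> line_ideal \<alpha>"
    by (rule line_cancel[of "2 * \<alpha>", OF _ line_add[OF line_add[OF line_add[OF line_add[OF line_scale[of _ _ "1", OF minor_02]
      line_scale[of _ _ "1", OF minor_18]]
      line_scale[of _ _ "-2 * \<alpha>", OF Pl_mult[of 3 5]]]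
      line_scale[of _ _ "1", OF minor_36]]
      line_scale[of _ _ "-2", OF minor_25]]])
      (use assms in \<open>simp_all add: cert_simps\<close>)
  moreover have "M14 * (M13 * M14 * M34) \<in> line_ideal \<alpha>"
    by (rule line_cancel[of "2 * \<alpha>", OF _ line_add[OF line_add[OF line_add[OF line_add[OF line_scale[of _ _ "1", OF minor_29]
      line_scale[of _ _ "2", OF minor_35]]
      line_scale[of _ _ "-1", OF minor_03]]
      line_scale[of _ _ "1", OF minor_37]]
      line_scale[of _ _ "-(\<alpha>)", OF minor_15]]])
      (use assms in \<open>simp_all add: cert_simps\<close>)
  moreover have "M23 * (M13 * M14 * M34) \<in> line_ideal \<alpha>"
    by (rule line_cancel[of "2 * \<alpha>", OF _ line_add[OF line_add[OF line_add[OF line_scale[of _ _ "1", OF minor_06]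
      line_scale[of _ _ "2", OF minor_56]]
      line_scale[of _ _ "-1", OF minor_67]]
      line_scale[of _ _ "\<alpha>", OF minor_58]]])
      (use assms in \<open>simp_all add: cert_simps\<close>)
  moreover have "M24 * (M13 * M14 * M34) \<in> line_ideal \<alpha>"
    by (rule line_cancel[of "2 * \<alpha>", OF _ line_add[OF line_add[OF line_scale[of _ _ "-1", OF minor_07]
      line_scale[of _ _ "1", OF minor_69]]
      line_scale[of _ _ "-2", OF minor_57]]])
      (use assms in \<open>simp_all add: cert_simps\<close>)
  moreover have "M34 * (M13 * M14 * M34) \<in> line_ideal \<alpha>"
    by (rule line_cancel[of "2 * \<alpha>", OF _ line_add[OF line_add[OF line_add[OF line_add[OF line_add[OF line_add[OF line_scale[of _ _ "-(\<alpha>)", OF minor_56]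
      line_scale[of _ _ "2", OF minor_58]]
      line_scale[of _ _ "1", OF minor_08]]
      line_scale[of _ _ "\<alpha>", OF Pl_mult[of 1 3]]]
      line_scale[of _ _ "1", OF minor_78]]
      line_scale[of _ _ "1", OF minor_09]]
      line_scale[of _ _ "2", OF minor_59]]])
      (use assms in \<open>simp_all add: cert_simps\<close>)
  ultimately show ?thesis by (intro linsatI) simp_all
qed

lemma sat_bde:
  assumes "\<alpha> \<noteq> (0::'k::field_char_0)"
  shows "M13 * M23 * M24 \<in> linsat \<alpha>"
proof -
  have "M12 * (M13 * M23 * M24) \<in> line_ideal \<alpha>"
    by (rule line_cancel[of "2 * \<alpha>^2", OF _ line_add[OF line_scale[of _ _ "-(\<alpha>)", OF minor_07]
      line_scale[of _ _ "-1", OF minor_34]]])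
      (use assms in \<open>simp_all add: cert_simps\<close>)
  moreover have "M13 * (M13 * M23 * M24) \<in> line_ideal \<alpha>"
    by (rule line_cancel[of "2 * \<alpha>^2", OF _ line_add[OF line_add[OF line_scale[of _ _ "-(\<alpha>^2)", OF Pl_mult[of 1 3]]
      line_scale[of _ _ "\<alpha>", OF minor_08]]
      line_scale[of _ _ "-1", OF minor_23]]])
      (use assms in \<open>simp_all add: cert_simps\<close>)
  moreover have "M14 * (M13 * M23 * M24) \<in> line_ideal \<alpha>"
    by (rule line_cancel[of "2", OF _ line_scale[of _ _ "-1", OF minor_05]])
      (use assms in \<open>simp_all add: cert_simps\<close>)
  moreover have "M23 * (M13 * M23 * M24) \<in> line_ideal \<alpha>"
    by (rule line_cancel[of "2 * \<alpha>^2", OF _ line_add[OF line_scale[of _ _ "1", OF minor_48]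
      line_scale[of _ _ "-1", OF minor_27]]])
      (use assms in \<open>simp_all add: cert_simps\<close>)
  moreover have "M24 * (M13 * M23 * M24) \<in> line_ideal \<alpha>"
    by (rule line_cancel[of "2 * \<alpha>^2", OF _ line_add[OF line_add[OF line_scale[of _ _ "-(\<alpha>^2)", OF Pl_mult[of 3 4]]
      line_scale[of _ _ "-(\<alpha>)", OF minor_45]]
      line_scale[of _ _ "1", OF minor_37]]])
      (use assms in \<open>simp_all add: cert_simps\<close>)
  moreover have "M34 * (M13 * M23 * M24) \<in> line_ideal \<alpha>"
    by (rule line_cancel[of "2 * \<alpha>^2", OF _ line_add[OF line_scale[of _ _ "-1", OF minor_38]
      line_scale[of _ _ "\<alpha>", OF minor_25]]])
      (use assms in \<open>simp_all add: cert_simps\<close>)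
  ultimately show ?thesis by (intro linsatI) simp_all
qed

lemma sat_cde:
  assumes "\<alpha> \<noteq> (0::'k::field_char_0)"
  shows "M14 * M23 * M24 \<in> linsat \<alpha>"
proof -
  have "M12 * (M14 * M23 * M24) \<in> line_ideal \<alpha>"
    by (rule line_cancel[of "4 * \<alpha>", OF _ line_add[OF line_scale[of _ _ "-1", OF minor_24]
      line_scale[of _ _ "-(\<alpha>)", OF minor_06]]])
      (use assms in \<open>simp_all add: cert_simps\<close>)
  moreover have "M13 * (M14 * M23 * M24) \<in> line_ideal \<alpha>"
    by (rule line_cancel[of "2", OF _ line_scale[of _ _ "-1", OF minor_05]])
      (use assms in \<open>simp_all add: cert_simps\<close>)
  moreover have "M14 * (M14 * M23 * M24) \<in> line_ideal \<alpha>"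
    by (rule line_cancel[of "4 * \<alpha>", OF _ line_add[OF line_add[OF line_scale[of _ _ "2 * \<alpha>", OF Pl_mult[of 2 4]]
      line_scale[of _ _ "\<alpha>", OF minor_09]]
      line_scale[of _ _ "-1", OF minor_23]]])
      (use assms in \<open>simp_all add: cert_simps\<close>)
  moreover have "M23 * (M14 * M23 * M24) \<in> line_ideal \<alpha>"
    by (rule line_cancel[of "4 * \<alpha>", OF _ line_add[OF line_add[OF line_add[OF line_scale[of _ _ "-2", OF minor_45]
      line_scale[of _ _ "2 * \<alpha>", OF Pl_mult[of 3 4]]]
      line_scale[of _ _ "1", OF minor_04]]
      line_scale[of _ _ "-1", OF minor_26]]])
      (use assms in \<open>simp_all add: cert_simps\<close>)
  moreover have "M24 * (M14 * M23 * M24) \<in> line_ideal \<alpha>"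
    by (rule line_cancel[of "4 * \<alpha>", OF _ line_add[OF line_scale[of _ _ "1", OF minor_49]
      line_scale[of _ _ "1", OF minor_36]]])
      (use assms in \<open>simp_all add: cert_simps\<close>)
  moreover have "M34 * (M14 * M23 * M24) \<in> line_ideal \<alpha>"
    by (rule line_cancel[of "4 * \<alpha>", OF _ line_add[OF line_add[OF line_scale[of _ _ "2", OF minor_35]
      line_scale[of _ _ "-1", OF minor_03]]
      line_scale[of _ _ "-1", OF minor_29]]])
      (use assms in \<open>simp_all add: cert_simps\<close>)
  ultimately show ?thesis by (intro linsatI) simp_all
qed

lemma sat_def:
  assumes "\<alpha> \<noteq> (0::'k::field_char_0)"
  shows "M23 * M24 * M34 \<in> linsat \<alpha>"
proof -
  have "M12 * (M23 * M24 * M34) \<in> line_ideal \<alpha>"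
    by (rule line_cancel[of "4 * \<alpha>^2", OF _ line_add[OF line_add[OF line_scale[of _ _ "-(\<alpha>)", OF minor_04]
      line_scale[of _ _ "\<alpha>", OF minor_26]]
      line_scale[of _ _ "2", OF minor_37]]])
      (use assms in \<open>simp_all add: cert_simps\<close>)
  moreover have "M13 * (M23 * M24 * M34) \<in> line_ideal \<alpha>"
    by (rule line_cancel[of "2 * \<alpha>^2", OF _ line_add[OF line_scale[of _ _ "-1", OF minor_38]
      line_scale[of _ _ "\<alpha>", OF minor_25]]])
      (use assms in \<open>simp_all add: cert_simps\<close>)
  moreover have "M14 * (M23 * M24 * M34) \<in> line_ideal \<alpha>"
    by (rule line_cancel[of "4 * \<alpha>", OF _ line_add[OF line_add[OF line_scale[of _ _ "2", OF minor_35]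
      line_scale[of _ _ "-1", OF minor_03]]
      line_scale[of _ _ "-1", OF minor_29]]])
      (use assms in \<open>simp_all add: cert_simps\<close>)
  moreover have "M23 * (M23 * M24 * M34) \<in> line_ideal \<alpha>"
    by (rule line_cancel[of "4 * \<alpha>^2", OF _ line_add[OF line_add[OF line_add[OF line_scale[of _ _ "-2", OF minor_78]
      line_scale[of _ _ "-1", OF minor_24]]
      line_scale[of _ _ "-(\<alpha>)", OF minor_06]]
      line_scale[of _ _ "-2 * \<alpha>", OF minor_56]]])
      (use assms in \<open>simp_all add: cert_simps\<close>)
  moreover have "M24 * (M23 * M24 * M34) \<in> line_ideal \<alpha>"
    by (rule line_cancel[of "4 * \<alpha>^2", OF _ line_add[OF line_add[OF line_scale[of _ _ "-2 * \<alpha>", OF minor_57]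
      line_scale[of _ _ "-(\<alpha>)", OF minor_69]]
      line_scale[of _ _ "1", OF minor_34]]])
      (use assms in \<open>simp_all add: cert_simps\<close>)
  moreover have "M34 * (M23 * M24 * M34) \<in> line_ideal \<alpha>"
    by (rule line_cancel[of "4 * \<alpha>^2", OF _ line_add[OF line_add[OF line_add[OF line_scale[of _ _ "2 * \<alpha>", OF minor_58]
      line_scale[of _ _ "-(\<alpha>)", OF minor_09]]
      line_scale[of _ _ "-2 * \<alpha>", OF minor_59]]
      line_scale[of _ _ "1", OF minor_23]]])
      (use assms in \<open>simp_all add: cert_simps\<close>)
  ultimately show ?thesis by (intro linsatI) simp_all
qed

lemma sat_cubic1:
  assumes "\<alpha> \<noteq> (0::'k::field_char_0)"
  shows "cubic1 \<alpha> \<in> linsat \<alpha>"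
proof -
  have "M12 * (cubic1 \<alpha>) \<in> line_ideal \<alpha>"
    by (rule line_cancel[of "\<alpha>^2", OF _ line_add[OF line_add[OF line_add[OF line_add[OF line_add[OF line_add[OF line_add[OF line_scale[of _ _ "\<alpha>", OF minor_14]
      line_scale[of _ _ "-2 * \<alpha>^2", OF Pl_mult[of 0 3]]]
      line_scale[of _ _ "\<alpha>^3", OF Pl_mult[of 0 5]]]
      line_scale[of _ _ "\<alpha>^3", OF Pl_mult[of 1 4]]]
      line_scale[of _ _ "\<alpha>^3", OF minor_05]]
      line_scale[of _ _ "-(\<alpha>^3)", OF Pl_mult[of 2 3]]]
      line_scale[of _ _ "\<alpha>", OF minor_07]]
      line_scale[of _ _ "1", OF minor_34]]])
      (use assms in \<open>simp_all add: cert_simps\<close>)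
  moreover have "M13 * (cubic1 \<alpha>) \<in> line_ideal \<alpha>"
    by (rule line_cancel[of "\<alpha>^2", OF _ line_add[OF line_add[OF line_add[OF line_add[OF line_add[OF line_add[OF line_scale[of _ _ "-(\<alpha>)", OF minor_12]
      line_scale[of _ _ "-2 * \<alpha>^2", OF Pl_mult[of 0 4]]]
      line_scale[of _ _ "\<alpha>^3", OF Pl_mult[of 1 5]]]
      line_scale[of _ _ "-(\<alpha>^2)", OF minor_06]]
      line_scale[of _ _ "-(\<alpha>)", OF minor_08]]
      line_scale[of _ _ "-(\<alpha>^2)", OF Pl_mult[of 1 3]]]
      line_scale[of _ _ "1", OF minor_23]]])
      (use assms in \<open>simp_all add: cert_simps\<close>)
  moreover have "M14 * (cubic1 \<alpha>) \<in> line_ideal \<alpha>"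
    by (rule line_cancel[of "\<alpha>", OF _ line_add[OF line_add[OF line_add[OF line_add[OF line_scale[of _ _ "1", OF minor_13]
      line_scale[of _ _ "\<alpha>^2", OF Pl_mult[of 0 3]]]
      line_scale[of _ _ "\<alpha>^2", OF Pl_mult[of 2 5]]]
      line_scale[of _ _ "-(\<alpha>)", OF minor_05]]
      line_scale[of _ _ "-(\<alpha>)", OF minor_07]]])
      (use assms in \<open>simp_all add: cert_simps\<close>)
  moreover have "M23 * (cubic1 \<alpha>) \<in> line_ideal \<alpha>"
    by (rule line_cancel[of "\<alpha>^2", OF _ line_add[OF line_add[OF line_add[OF line_add[OF line_add[OF line_add[OF line_scale[of _ _ "-(\<alpha>)", OF minor_46]
      line_scale[of _ _ "\<alpha>^2", OF Pl_mult[of 0 2]]]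
      line_scale[of _ _ "-2 * \<alpha>^2", OF Pl_mult[of 3 3]]]
      line_scale[of _ _ "-1", OF minor_48]]
      line_scale[of _ _ "1", OF minor_27]]
      line_scale[of _ _ "\<alpha>^3", OF Pl_mult[of 3 5]]]
      line_scale[of _ _ "\<alpha>^2", OF minor_25]]])
      (use assms in \<open>simp_all add: cert_simps\<close>)
  moreover have "M24 * (cubic1 \<alpha>) \<in> line_ideal \<alpha>"
    by (rule line_cancel[of "\<alpha>^2", OF _ line_add[OF line_add[OF line_add[OF line_add[OF line_add[OF line_add[OF line_add[OF line_scale[of _ _ "-(\<alpha>)", OF minor_47]
      line_scale[of _ _ "\<alpha>^3", OF Pl_mult[of 4 5]]]
      line_scale[of _ _ "-(\<alpha>^2)", OF Pl_mult[of 3 4]]]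
      line_scale[of _ _ "-(\<alpha>)", OF minor_45]]
      line_scale[of _ _ "-(\<alpha>^2)", OF minor_35]]
      line_scale[of _ _ "\<alpha>", OF minor_04]]
      line_scale[of _ _ "\<alpha>^2", OF Pl_mult[of 1 2]]]
      line_scale[of _ _ "-1", OF minor_37]]])
      (use assms in \<open>simp_all add: cert_simps\<close>)
  moreover have "M34 * (cubic1 \<alpha>) \<in> line_ideal \<alpha>"
    by (rule line_cancel[of "\<alpha>^2", OF _ line_add[OF line_add[OF line_add[OF line_add[OF line_add[OF line_add[OF line_add[OF line_scale[of _ _ "\<alpha>^2", OF Pl_mult[of 0 0]]
      line_scale[of _ _ "\<alpha>", OF minor_27]]
      line_scale[of _ _ "\<alpha>^3", OF Pl_mult[of 5 5]]]
      line_scale[of _ _ "-2 * \<alpha>^2", OF Pl_mult[of 3 5]]]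
      line_scale[of _ _ "-(\<alpha>)", OF minor_02]]
      line_scale[of _ _ "\<alpha>", OF minor_36]]
      line_scale[of _ _ "\<alpha>", OF minor_25]]
      line_scale[of _ _ "1", OF minor_38]]])
      (use assms in \<open>simp_all add: cert_simps\<close>)
  ultimately show ?thesis by (intro linsatI) simp_all
qed

lemma sat_cubic2:
  assumes "\<alpha> \<noteq> (0::'k::field_char_0)"
  shows "cubic2 \<alpha> \<in> linsat \<alpha>"
proof -
  have "M12 * (cubic2 \<alpha>) \<in> line_ideal \<alpha>"
    by (rule line_cancel[of "\<alpha>", OF _ line_add[OF line_add[OF line_add[OF line_add[OF line_scale[of _ _ "\<alpha>", OF Pl_mult[of 0 0]]
      line_scale[of _ _ "1", OF minor_27]]
      line_scale[of _ _ "\<alpha>^2", OF Pl_mult[of 5 5]]]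
      line_scale[of _ _ "-2 * \<alpha>", OF Pl_mult[of 3 5]]]
      line_scale[of _ _ "1", OF minor_36]]])
      (use assms in \<open>simp_all add: cert_simps\<close>)
  moreover have "M13 * (cubic2 \<alpha>) \<in> line_ideal \<alpha>"
    by (rule line_cancel[of "\<alpha>", OF _ line_add[OF line_add[OF line_add[OF line_add[OF line_scale[of _ _ "-1", OF minor_28]
      line_scale[of _ _ "\<alpha>", OF Pl_mult[of 0 1]]]
      line_scale[of _ _ "-2 * \<alpha>", OF Pl_mult[of 4 5]]]
      line_scale[of _ _ "2", OF minor_35]]
      line_scale[of _ _ "-1", OF minor_03]]])
      (use assms in \<open>simp_all add: cert_simps\<close>)
  moreover have "M14 * (cubic2 \<alpha>) \<in> line_ideal \<alpha>"
    by (rule line_cancel[of "\<alpha>", OF _ line_add[OF line_add[OF line_add[OF line_scale[of _ _ "-1", OF minor_39]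
      line_scale[of _ _ "\<alpha>", OF Pl_mult[of 0 2]]]
      line_scale[of _ _ "\<alpha>^2", OF Pl_mult[of 3 5]]]
      line_scale[of _ _ "\<alpha>", OF minor_25]]])
      (use assms in \<open>simp_all add: cert_simps\<close>)
  moreover have "M23 * (cubic2 \<alpha>) \<in> line_ideal \<alpha>"
    by (rule line_cancel[of "\<alpha>", OF _ line_add[OF line_add[OF line_add[OF line_add[OF line_scale[of _ _ "-1", OF minor_68]
      line_scale[of _ _ "\<alpha>", OF Pl_mult[of 0 3]]]
      line_scale[of _ _ "\<alpha>", OF Pl_mult[of 2 5]]]
      line_scale[of _ _ "-2", OF minor_57]]
      line_scale[of _ _ "-1", OF minor_07]]])
      (use assms in \<open>simp_all add: cert_simps\<close>)
  moreover have "M24 * (cubic2 \<alpha>) \<in> line_ideal \<alpha>"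
    by (rule line_cancel[of "\<alpha>", OF _ line_add[OF line_add[OF line_add[OF line_scale[of _ _ "-1", OF minor_79]
      line_scale[of _ _ "\<alpha>", OF Pl_mult[of 0 4]]]
      line_scale[of _ _ "\<alpha>", OF Pl_mult[of 1 3]]]
      line_scale[of _ _ "-(\<alpha>)", OF minor_56]]])
      (use assms in \<open>simp_all add: cert_simps\<close>)
  moreover have "M34 * (cubic2 \<alpha>) \<in> line_ideal \<alpha>"
    by (rule line_cancel[of "\<alpha>", OF _ line_add[OF line_add[OF line_add[OF line_add[OF line_scale[of _ _ "1", OF minor_89]
      line_scale[of _ _ "\<alpha>", OF Pl_mult[of 0 5]]]
      line_scale[of _ _ "\<alpha>", OF Pl_mult[of 1 4]]]
      line_scale[of _ _ "\<alpha>", OF minor_05]]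
      line_scale[of _ _ "-(\<alpha>)", OF Pl_mult[of 2 3]]]])
      (use assms in \<open>simp_all add: cert_simps\<close>)
  ultimately show ?thesis by (intro linsatI) simp_all
qed

text \<open>\<open>Q\<close> vanishes on the conics and quartics, and \<open>c\<close> or
  \<open>d\<close> on each line and plane cubic. Having degree 4, the product lies in the line ideal
  itself.\<close>

lemma quartic_cdQ:
  assumes "\<alpha> \<noteq> (0::'k::field_char_0)"
  shows "M14 * M23 * QQ \<alpha> \<in> line_ideal \<alpha>"
  by (rule line_cancel[of "2 * \<alpha>", OF _ line_add[OF line_add[OF line_add[OF line_add[OF line_add[OF line_add[OF line_add[OF line_add[OF line_scale[of _ _ "2 * \<alpha>", OF Pl_mult[of 2 2]]
      line_scale[of _ _ "-1", OF minor_19]]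
      line_scale[of _ _ "2 * \<alpha>^2", OF Pl_mult[of 3 3]]]
      line_scale[of _ _ "1", OF minor_48]]
      line_scale[of _ _ "-2", OF minor_27]]
      line_scale[of _ _ "1", OF minor_49]]
      line_scale[of _ _ "1", OF minor_02]]
      line_scale[of _ _ "-1", OF minor_36]]
      line_scale[of _ _ "-2", OF minor_25]]])
    (use assms in \<open>simp_all add: cert_simps\<close>)

section \<open>Monomials in the six coordinates\<close>

definition mon6 :: "nat \<Rightarrow> nat \<Rightarrow> nat \<Rightarrow> nat \<Rightarrow> nat \<Rightarrow> nat
    \<Rightarrow> 'k::comm_ring_1 mpoly" where
  "mon6 a b c d e f = M12 ^ a * M13 ^ b * M14 ^ c * M23 ^ d * M24 ^ e * M34 ^ f"

fun mon6_of :: "nat \<times> nat \<times> nat \<times> nat \<times> nat \<times> nat \<Rightarrow> 'k::comm_ring_1 mpoly" where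
  "mon6_of (a, b, c, d, e, f) = mon6 a b c d e f"

lemma mon6_polyring [simp]: "mon6 a b c d e f \<in> polyring 6"
  by (simp add: mon6_def)

lemma linsat_add: "g \<in> linsat \<alpha> \<Longrightarrow> h \<in> linsat \<alpha> \<Longrightarrow> g + h \<in> linsat \<alpha>"
  by (simp add: linsat_def distrib_left line_add)

lemma line_linsat: "g \<in> line_ideal \<alpha> \<Longrightarrow> g \<in> linsat \<alpha>"
  by (simp add: linsat_def line_mult line_polyring)

lemma linsat_mult:
  assumes "r \<in> polyring 6" "g \<in> linsat \<alpha>" shows "r * g \<in> linsat \<alpha>"
proof -
  have "Var i * (r * g) \<in> line_ideal \<alpha>" if "i < 6" for i
    using line_mult[of r "Var i * g" \<alpha>] that assms by (simp add: linsat_def mult_ac)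
  then show ?thesis using assms by (simp add: linsat_def)
qed

lemma mon6_Suc:
  "mon6 (Suc a) b c d e f = M12 * mon6 a b c d e f" "mon6 a (Suc b) c d e f = M13 * mon6 a b c d e f"
  "mon6 a b (Suc c) d e f = M14 * mon6 a b c d e f" "mon6 a b c (Suc d) e f = M23 * mon6 a b c d e f"
  "mon6 a b c d (Suc e) f = M24 * mon6 a b c d e f" "mon6 a b c d e (Suc f) = M34 * mon6 a b c d e f"
  by (simp_all add: mon6_def mult_ac)

lemma linsat_linear:
  assumes "g \<in> linsat \<alpha>" "r \<in> polyring 6" "i < 6"
  shows "r * Var i * g \<in> line_ideal \<alpha>"
  using line_mult[of r "Var i * g" \<alpha>] assms by (simp add: linsat_def mult.assoc)

text \<open>One variable of the monomial carries \<open>g\<close> from \<open>linsat\<close> into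
  the line ideal, and the remaining factor is an arbitrary multiplier.\<close>

lemma linsat_mon:
  assumes g: "g \<in> linsat \<alpha>" and "0 < a + b + c + d + e + f"
  shows "mon6 a b c d e f * g \<in> line_ideal \<alpha>"
proof -
  have *: "Var i * mon6 a b c d e f * g \<in> line_ideal \<alpha>" if "i < 6" for i a b c d e f
    using linsat_linear[OF g, of "mon6 a b c d e f" i] that by (simp add: mult_ac)
  consider k where "a = Suc k" | k where "b = Suc k" | k where "c = Suc k"
    | k where "d = Suc k" | k where "e = Suc k" | k where "f = Suc k"
    using assms(2) by (metis add_eq_0_iff_both_eq_0 gr0_conv_Suc less_numeral_extra(3) neq0_conv)
  then show ?thesis
    by cases (simp_all add: mon6_Suc *)
qed

section \<open>Standard monomials\<close>

text \<open>The monomials of degree $n$ not divisible by any of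
  $abd, ace, bcd, bce, bcf, bde, cde, def, be, acf, adf, ae^2, e^2f, a^3b, a^2bf, a^3c, df^3, a^2cd$,
  grouped by the component of the line scheme on which they are detected.\<close>
definition std :: "nat \<Rightarrow> (nat \<times> nat \<times> nat \<times> nat \<times> nat \<times> nat) list" where
  "std n =
     map (\<lambda>i. (0, 0, i, 0, n - i, 0)) [0..<n + 1] @
     map (\<lambda>i. (0, 0, 0, Suc i, n - 1 - i, 0)) [0..<n] @
     map (\<lambda>i. (0, 0, i, 0, 0, Suc (n - 1 - i))) [0..<n] @
     map (\<lambda>i. (0, 0, i, 0, 1, Suc (n - 2 - i))) [0..<n - 1] @
     map (\<lambda>i. (Suc (n - 1 - i), 0, 0, i, 0, 0)) [0..<n] @
     map (\<lambda>i. (Suc (n - 2 - i), 0, 0, i, 1, 0)) [0..<n - 1] @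
     map (\<lambda>i. (0, Suc i, n - 1 - i, 0, 0, 0)) [0..<n] @
     map (\<lambda>i. (1, i, n - 1 - i, 0, 0, 0)) [0..<n] @
     map (\<lambda>i. (2, i, n - 2 - i, 0, 0, 0)) [0..<n - 1] @
     map (\<lambda>i. (Suc i, 0, 0, 0, 0, Suc (n - 2 - i))) [0..<n - 1] @
     map (\<lambda>i. (Suc i, 0, 0, 0, 1, Suc (n - 3 - i))) [0..<n - 2] @
     map (\<lambda>i. (0, Suc i, 0, 0, 0, Suc (n - 2 - i))) [0..<n - 1] @
     map (\<lambda>i. (1, Suc i, 0, 0, 0, Suc (n - 3 - i))) [0..<n - 2] @
     map (\<lambda>i. (0, Suc i, 0, Suc (n - 2 - i), 0, 0)) [0..<n - 1] @
     map (\<lambda>i. (0, i, 0, Suc (n - 2 - i), 0, 1)) [0..<n - 1] @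
     map (\<lambda>i. (0, i, 0, Suc (n - 3 - i), 0, 2)) [0..<n - 2] @
     map (\<lambda>i. (0, 0, Suc i, Suc (n - 2 - i), 0, 0)) [0..<n - 1] @
     map (\<lambda>i. (1, 0, Suc i, Suc (n - 3 - i), 0, 0)) [0..<n - 2] @
     map (\<lambda>i. (0, 0, Suc i, Suc (n - 3 - i), 0, 1)) [0..<n - 2] @
     map (\<lambda>i. (0, 0, Suc i, Suc (n - 4 - i), 0, 2)) [0..<n - 3]"

section \<open>Relations for the remaining leading monomials\<close>

lemma rel_acf:
  assumes "\<alpha> \<noteq> (0::'k::field_char_0)"
  shows "M12 * M14 * M34 + M14 * M14 * M23 \<in> linsat \<alpha>"
  using linsat_add[OF linsat_mult[of "M14", OF _ line_linsat[OF Pl_line]]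
      linsat_mult[of "1", OF _ sat_bce[OF assms]]]
  by (simp add: cert_simps)

lemma rel_adf:
  assumes "\<alpha> \<noteq> (0::'k::field_char_0)"
  shows "M12 * M23 * M34 + M14 * M23 * M23 \<in> linsat \<alpha>"
  using linsat_add[OF linsat_mult[of "M23", OF _ line_linsat[OF Pl_line]]
      linsat_mult[of "1", OF _ sat_bde[OF assms]]]
  by (simp add: cert_simps)

text \<open>The term \<open>-2adf\<close> of \<open>aQ\<close> is exchanged for
  \<open>2cd^2\<close>, since \<open>adf\<close> is a leading monomial of its own.\<close>

lemma rel_aee:
  assumes "\<alpha> \<noteq> (0::'k::field_char_0)"
  shows "2 * (M12 * M24 * M24) + M12 * M12 * M12 + M12 * M14 * M14 + Const \<alpha> * (M12 * M23 * M23) + Const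
      \<alpha> * (M12 * M34 * M34) + 2 * (M14 * M23 * M23) - M13 * M13 * M14 \<in> linsat \<alpha>"
  using linsat_add[OF linsat_mult[of "1", OF _ sat_cubic1[OF assms]]
      linsat_mult[of "2", OF _ rel_adf[OF assms]]]
  by (simp add: cert_simps)

lemma rel_eef:
  assumes "\<alpha> \<noteq> (0::'k::field_char_0)"
  shows "2 * (M24 * M24 * M34) + M12 * M12 * M34 + M14 * M14 * M34 + Const \<alpha> * (M23 * M23 * M34) + Const
      \<alpha> * (M34 * M34 * M34) - 2 * (M23 * M34 * M34) - M13 * M13 * M23 \<in> linsat \<alpha>"
  using linsat_mult[of "1", OF _ sat_cubic2[OF assms]]
  by (simp add: cert_simps)

text \<open>Here and in the next four relations a term heavier than the intended leading monomial is
  cancelled: \<open>abe^2\<close> and \<open>be^2f\<close> against the Pluecker quadric, then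
  \<open>ace^2\<close>, \<open>de^2f\<close> and \<open>cde^2\<close> against the cubics
  \<open>ace\<close>, \<open>def\<close> and \<open>cde\<close>. The other summands replace terms
  that are themselves reducible.\<close>

lemma rel_aaab:
  assumes "\<alpha> \<noteq> (0::'k::field_char_0)"
  shows "M12 * M12 * M12 * M13 + M12 * M13 * M14 * M14 + 2 * (M12 * M12 * M24 * M34) + Const \<alpha> * (M12 *
      M13 * M34 * M34) - M13 * M13 * M13 * M14 \<in> line_ideal \<alpha>"
  using line_add[OF line_add[OF line_add[OF line_add[OF linsat_linear[OF sat_cubic1[OF assms], of "1" 1]
      linsat_linear[OF sat_cde[OF assms], of "- 2" 0]]
      line_mult[of "2 * (M12 * M24)", OF _ Pl_line[of \<alpha>]]]
      linsat_linear[OF sat_abd[OF assms], of "- Const \<alpha>" 3]]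
      linsat_linear[OF sat_abd[OF assms], of "2" 5]]
  by (simp add: cert_simps)

lemma rel_aabf:
  assumes "\<alpha> \<noteq> (0::'k::field_char_0)"
  shows "M12 * M12 * M13 * M34 + Const \<alpha> * (M13 * M23 * M23 * M34) + Const \<alpha> * (M13 * M34 * M34 *
      M34) - 2 * (M13 * M23 * M34 * M34) - M13 * M13 * M13 * M23 + 2 * (M12 * M24 * M34 * M34) \<in>
      line_ideal \<alpha>"
  using line_add[OF line_add[OF line_add[OF linsat_linear[OF sat_cubic2[OF assms], of "1" 1]
      linsat_linear[OF sat_bcf[OF assms], of "- 1" 2]]
      linsat_linear[OF sat_cde[OF assms], of "- 2" 5]]
      line_mult[of "2 * (M24 * M34)", OF _ Pl_line[of \<alpha>]]]
  by (simp add: cert_simps)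

lemma rel_aaac:
  assumes "\<alpha> \<noteq> (0::'k::field_char_0)"
  shows "M12 * M12 * M12 * M14 + M12 * M14 * M14 * M14 + Const \<alpha> * (M12 * M14 * M23 * M23) + 2 * (M14 *
      M14 * M23 * M23) - Const \<alpha> * (M14 * M14 * M23 * M34) - M13 * M13 * M14 * M14 \<in> line_ideal
      \<alpha>"
  using line_add[OF line_add[OF line_add[OF linsat_linear[OF sat_cubic1[OF assms], of "1" 2]
      linsat_linear[OF sat_ace[OF assms], of "- 2" 4]]
      linsat_linear[OF rel_acf[OF assms], of "- Const \<alpha>" 5]]
      linsat_linear[OF rel_acf[OF assms], of "2" 3]]
  by (simp add: cert_simps)

lemma rel_dfff:
  assumes "\<alpha> \<noteq> (0::'k::field_char_0)"
  shows "Const \<alpha> * (M23 * M34 * M34 * M34) - M12 * M14 * M23 * M23 + M14 * M14 * M23 * M34 + Const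
      \<alpha> * (M23 * M23 * M23 * M34) - 2 * (M23 * M23 * M34 * M34) - M13 * M13 * M23 * M23 \<in>
      line_ideal \<alpha>"
  using line_add[OF line_add[OF linsat_linear[OF sat_cubic2[OF assms], of "1" 3]
      linsat_linear[OF rel_adf[OF assms], of "- 1" 0]]
      linsat_linear[OF sat_def[OF assms], of "- 2" 4]]
  by (simp add: cert_simps)

lemma rel_aacd:
  assumes "\<alpha> \<noteq> (0::'k::field_char_0)"
  shows "M12 * M12 * M14 * M23 + M14 * M14 * M14 * M23 + Const \<alpha> * (M14 * M23 * M23 * M23) + Const
      \<alpha> * (M14 * M23 * M34 * M34) - 2 * (M14 * M23 * M23 * M34) \<in> line_ideal \<alpha>"
  using line_add[OF quartic_cdQ[OF assms]
      linsat_linear[OF sat_cde[OF assms], of "- 2" 4]]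
  by (simp add: cert_simps)

section \<open>Reduction to standard monomials modulo the line ideal\<close>

definition std_reducible :: "'k::comm_ring_1 \<Rightarrow> nat \<Rightarrow> 'k mpoly set" where
  "std_reducible \<alpha> n =
     {h. \<exists>c. h - (\<Sum>t\<in>set (std n). Const (c t) * mon6_of t) \<in> line_ideal \<alpha>}"

lemma std_reducible_line: "h \<in> line_ideal \<alpha> \<Longrightarrow> h \<in> std_reducible \<alpha> n"
  unfolding std_reducible_def by (intro CollectI exI[of _ "\<lambda>_. 0"]) simp

lemma std_reducible_std:
  assumes "t \<in> set (std n)" shows "mon6_of t \<in> std_reducible \<alpha> n"
proof -
  have "(\<Sum>s\<in>set (std n). Const (if s = t then 1 else 0) * mon6_of s) = (mon6_of t :: 'a mpoly)"
    using assms by (simp add: if_distrib[of Const] if_distrib[of "\<lambda>x. x * _"] sum.delta cong: if_cong)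
  then show ?thesis
    unfolding std_reducible_def by (intro CollectI exI[of _ "\<lambda>s. if s = t then 1 else 0"]) simp
qed

lemma std_reducible_add:
  assumes "g \<in> std_reducible \<alpha> n" "h \<in> std_reducible \<alpha> n" shows "g + h \<in> std_reducible \<alpha> n"
proof -
  let ?s = "\<lambda>c. \<Sum>t\<in>set (std n). Const (c t) * mon6_of t :: 'a mpoly"
  obtain c e where "g - ?s c \<in> line_ideal \<alpha>" "h - ?s e \<in> line_ideal \<alpha>"
    using assms by (auto simp: std_reducible_def)
  then have "(g - ?s c) + (h - ?s e) \<in> line_ideal \<alpha>" by (rule line_add)
  also have "(g - ?s c) + (h - ?s e) = g + h - ?s (\<lambda>t. c t + e t)"
    by (simp add: Const_add distrib_right sum.distrib)
  finally show ?thesis unfolding std_reducible_def by (intro CollectI exI[of _ "\<lambda>t. c t + e t"])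
qed

lemma std_reducible_scale:
  assumes "g \<in> std_reducible \<alpha> n" shows "Const k * g \<in> std_reducible \<alpha> n"
proof -
  let ?s = "\<lambda>c. \<Sum>t\<in>set (std n). Const (c t) * mon6_of t :: 'a mpoly"
  obtain c where "g - ?s c \<in> line_ideal \<alpha>"
    using assms by (auto simp: std_reducible_def)
  then have "Const k * (g - ?s c) \<in> line_ideal \<alpha>" by (rule line_scale)
  also have "Const k * (g - ?s c) = Const k * g - ?s (\<lambda>t. k * c t)"
    by (simp add: Const_mult right_diff_distrib sum_distrib_left mult.assoc)
  finally show ?thesis unfolding std_reducible_def by (intro CollectI exI[of _ "\<lambda>t. k * c t"])
qed

lemma std_reducible_numeral: "g \<in> std_reducible \<alpha> n \<Longrightarrow> numeral k * g \<in> std_reducible \<alpha> n"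
  using std_reducible_scale[of g \<alpha> n "numeral k"] by (simp add: Const_numeral)

lemma std_reducible_diff:
  "g \<in> std_reducible \<alpha> n \<Longrightarrow> h \<in> std_reducible \<alpha> n \<Longrightarrow> g - h \<in> std_reducible \<alpha> n"
  using std_reducible_add[of g \<alpha> n "- h"] std_reducible_scale[of h \<alpha> n "- 1"]
  by (simp add: Const_uminus)

lemma std_reducible_0: "0 \<in> std_reducible \<alpha> n"
  by (simp add: std_reducible_line)

lemma std_reducible_sum: "(\<And>x. x \<in> A \<Longrightarrow> f x \<in> std_reducible \<alpha> n) \<Longrightarrow> sum f A
    \<in> std_reducible \<alpha> n"
  by (induction A rule: infinite_finite_induct) (auto intro: std_reducible_add std_reducible_0)

lemma std_reducible_cancel:
  fixes k :: "'k::field"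
  assumes "k \<noteq> 0" "Const k * g \<in> std_reducible \<alpha> n" shows "g \<in> std_reducible \<alpha> n"
  using std_reducible_scale[OF assms(2), of "inverse k"] assms(1)
  by (simp add: mult.assoc[symmetric] Const_mult[symmetric])

text \<open>The hypotheses say that none of the eighteen leading monomials divides. They restrict
  the support so strongly that at most two exponents are free and the others are at most 2, which
  gives the twenty families.\<close>

lemma nonlead_in_std:
  fixes a b c d e f n :: nat
  assumes "a + b + c + d + e + f = n" "4 \<le> n"
    and "a = 0 \<or> b = 0 \<or> d = 0"
    and "a = 0 \<or> c = 0 \<or> e = 0"
    and "b = 0 \<or> c = 0 \<or> d = 0"
    and "b = 0 \<or> c = 0 \<or> e = 0"
    and "b = 0 \<or> c = 0 \<or> f = 0"
    and "b = 0 \<or> d = 0 \<or> e = 0"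
    and "c = 0 \<or> d = 0 \<or> e = 0"
    and "d = 0 \<or> e = 0 \<or> f = 0"
    and "b = 0 \<or> e = 0"
    and "a = 0 \<or> c = 0 \<or> f = 0"
    and "a = 0 \<or> d = 0 \<or> f = 0"
    and "a = 0 \<or> e < 2"
    and "e < 2 \<or> f = 0"
    and "a < 3 \<or> b = 0"
    and "a < 2 \<or> b = 0 \<or> f = 0"
    and "a < 3 \<or> c = 0"
    and "d = 0 \<or> f < 3"
    and "a < 2 \<or> c = 0 \<or> d = 0"
  shows "(a, b, c, d, e, f) \<in> set (std n)"
proof -
  note std = std_def set_append set_map set_upt Un_iff
  have "(a = 0 \<and> b = 0 \<and> d = 0 \<and> f = 0)
    \<or> (a = 0 \<and> b = 0 \<and> c = 0 \<and> f = 0 \<and> d \<ge> 1)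
    \<or> (a = 0 \<and> b = 0 \<and> d = 0 \<and> e = 0 \<and> f \<ge> 1)
    \<or> (a = 0 \<and> b = 0 \<and> d = 0 \<and> e = 1 \<and> f \<ge> 1)
    \<or> (b = 0 \<and> c = 0 \<and> e = 0 \<and> f = 0 \<and> a \<ge> 1)
    \<or> (b = 0 \<and> c = 0 \<and> f = 0 \<and> e = 1 \<and> a \<ge> 1)
    \<or> (a = 0 \<and> d = 0 \<and> e = 0 \<and> f = 0 \<and> b \<ge> 1)
    \<or> (a = 1 \<and> d = 0 \<and> e = 0 \<and> f = 0)
    \<or> (a = 2 \<and> d = 0 \<and> e = 0 \<and> f = 0)
    \<or> (b = 0 \<and> c = 0 \<and> d = 0 \<and> e = 0 \<and> a \<ge> 1 \<and> f \<ge> 1)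
    \<or> (b = 0 \<and> c = 0 \<and> d = 0 \<and> e = 1 \<and> a \<ge> 1 \<and> f \<ge> 1)
    \<or> (a = 0 \<and> c = 0 \<and> d = 0 \<and> e = 0 \<and> b \<ge> 1 \<and> f \<ge> 1)
    \<or> (a = 1 \<and> c = 0 \<and> d = 0 \<and> e = 0 \<and> b \<ge> 1 \<and> f \<ge> 1)
    \<or> (a = 0 \<and> c = 0 \<and> e = 0 \<and> f = 0 \<and> b \<ge> 1 \<and> d \<ge> 1)
    \<or> (a = 0 \<and> c = 0 \<and> e = 0 \<and> f = 1 \<and> d \<ge> 1)
    \<or> (a = 0 \<and> c = 0 \<and> e = 0 \<and> f = 2 \<and> d \<ge> 1)
    \<or> (a = 0 \<and> b = 0 \<and> e = 0 \<and> f = 0 \<and> c \<ge> 1 \<and> d \<ge> 1)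
    \<or> (a = 1 \<and> b = 0 \<and> e = 0 \<and> f = 0 \<and> c \<ge> 1 \<and> d \<ge> 1)
    \<or> (a = 0 \<and> b = 0 \<and> e = 0 \<and> f = 1 \<and> c \<ge> 1 \<and> d \<ge> 1)
    \<or> (a = 0 \<and> b = 0 \<and> e = 0 \<and> f = 2 \<and> c \<ge> 1 \<and> d \<ge> 1)"
    \<comment> \<open>Splitting each exponent into zero and successor fixes the support; what
      remains are bounds on single exponents.\<close>
    by (insert assms(3-); cases a; cases b; cases c; cases d; cases e; cases f; simp; arith)
  then show ?thesis
  proof (elim disjE)
    assume "a = 0 \<and> b = 0 \<and> d = 0 \<and> f = 0"
    then have "\<exists>i\<in>{0..<n + 1}. (a, b, c, d, e, f) = (0, 0, i, 0, n - i, 0)"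
      using assms(1,2) by (intro bexI[of _ "c"]) auto
    then show ?thesis unfolding std image_iff by blast
  next
    assume "a = 0 \<and> b = 0 \<and> c = 0 \<and> f = 0 \<and> d \<ge> 1"
    then have "\<exists>i\<in>{0..<n}. (a, b, c, d, e, f) = (0, 0, 0, Suc i, n - 1 - i, 0)"
      using assms(1,2) by (intro bexI[of _ "d - 1"]) auto
    then show ?thesis unfolding std image_iff by blast
  next
    assume "a = 0 \<and> b = 0 \<and> d = 0 \<and> e = 0 \<and> f \<ge> 1"
    then have "\<exists>i\<in>{0..<n}. (a, b, c, d, e, f) = (0, 0, i, 0, 0, Suc (n - 1 - i))"
      using assms(1,2) by (intro bexI[of _ "c"]) auto
    then show ?thesis unfolding std image_iff by blast
  next
    assume "a = 0 \<and> b = 0 \<and> d = 0 \<and> e = 1 \<and> f \<ge> 1"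
    then have "\<exists>i\<in>{0..<n - 1}. (a, b, c, d, e, f) = (0, 0, i, 0, 1, Suc (n - 2 - i))"
      using assms(1,2) by (intro bexI[of _ "c"]) auto
    then show ?thesis unfolding std image_iff by blast
  next
    assume "b = 0 \<and> c = 0 \<and> e = 0 \<and> f = 0 \<and> a \<ge> 1"
    then have "\<exists>i\<in>{0..<n}. (a, b, c, d, e, f) = (Suc (n - 1 - i), 0, 0, i, 0, 0)"
      using assms(1,2) by (intro bexI[of _ "d"]) auto
    then show ?thesis unfolding std image_iff by blast
  next
    assume "b = 0 \<and> c = 0 \<and> f = 0 \<and> e = 1 \<and> a \<ge> 1"
    then have "\<exists>i\<in>{0..<n - 1}. (a, b, c, d, e, f) = (Suc (n - 2 - i), 0, 0, i, 1, 0)"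
      using assms(1,2) by (intro bexI[of _ "d"]) auto
    then show ?thesis unfolding std image_iff by blast
  next
    assume "a = 0 \<and> d = 0 \<and> e = 0 \<and> f = 0 \<and> b \<ge> 1"
    then have "\<exists>i\<in>{0..<n}. (a, b, c, d, e, f) = (0, Suc i, n - 1 - i, 0, 0, 0)"
      using assms(1,2) by (intro bexI[of _ "b - 1"]) auto
    then show ?thesis unfolding std image_iff by blast
  next
    assume "a = 1 \<and> d = 0 \<and> e = 0 \<and> f = 0"
    then have "\<exists>i\<in>{0..<n}. (a, b, c, d, e, f) = (1, i, n - 1 - i, 0, 0, 0)"
      using assms(1,2) by (intro bexI[of _ "b"]) auto
    then show ?thesis unfolding std image_iff by blast
  next
    assume "a = 2 \<and> d = 0 \<and> e = 0 \<and> f = 0"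
    then have "\<exists>i\<in>{0..<n - 1}. (a, b, c, d, e, f) = (2, i, n - 2 - i, 0, 0, 0)"
      using assms(1,2) by (intro bexI[of _ "b"]) auto
    then show ?thesis unfolding std image_iff by blast
  next
    assume "b = 0 \<and> c = 0 \<and> d = 0 \<and> e = 0 \<and> a \<ge> 1 \<and> f \<ge> 1"
    then have "\<exists>i\<in>{0..<n - 1}. (a, b, c, d, e, f) = (Suc i, 0, 0, 0, 0, Suc (n - 2 - i))"
      using assms(1,2) by (intro bexI[of _ "a - 1"]) auto
    then show ?thesis unfolding std image_iff by blast
  next
    assume "b = 0 \<and> c = 0 \<and> d = 0 \<and> e = 1 \<and> a \<ge> 1 \<and> f \<ge> 1"
    then have "\<exists>i\<in>{0..<n - 2}. (a, b, c, d, e, f) = (Suc i, 0, 0, 0, 1, Suc (n - 3 - i))"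
      using assms(1,2) by (intro bexI[of _ "a - 1"]) auto
    then show ?thesis unfolding std image_iff by blast
  next
    assume "a = 0 \<and> c = 0 \<and> d = 0 \<and> e = 0 \<and> b \<ge> 1 \<and> f \<ge> 1"
    then have "\<exists>i\<in>{0..<n - 1}. (a, b, c, d, e, f) = (0, Suc i, 0, 0, 0, Suc (n - 2 - i))"
      using assms(1,2) by (intro bexI[of _ "b - 1"]) auto
    then show ?thesis unfolding std image_iff by blast
  next
    assume "a = 1 \<and> c = 0 \<and> d = 0 \<and> e = 0 \<and> b \<ge> 1 \<and> f \<ge> 1"
    then have "\<exists>i\<in>{0..<n - 2}. (a, b, c, d, e, f) = (1, Suc i, 0, 0, 0, Suc (n - 3 - i))"
      using assms(1,2) by (intro bexI[of _ "b - 1"]) auto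
    then show ?thesis unfolding std image_iff by blast
  next
    assume "a = 0 \<and> c = 0 \<and> e = 0 \<and> f = 0 \<and> b \<ge> 1 \<and> d \<ge> 1"
    then have "\<exists>i\<in>{0..<n - 1}. (a, b, c, d, e, f) = (0, Suc i, 0, Suc (n - 2 - i), 0, 0)"
      using assms(1,2) by (intro bexI[of _ "b - 1"]) auto
    then show ?thesis unfolding std image_iff by blast
  next
    assume "a = 0 \<and> c = 0 \<and> e = 0 \<and> f = 1 \<and> d \<ge> 1"
    then have "\<exists>i\<in>{0..<n - 1}. (a, b, c, d, e, f) = (0, i, 0, Suc (n - 2 - i), 0, 1)"
      using assms(1,2) by (intro bexI[of _ "b"]) auto
    then show ?thesis unfolding std image_iff by blast
  next
    assume "a = 0 \<and> c = 0 \<and> e = 0 \<and> f = 2 \<and> d \<ge> 1"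
    then have "\<exists>i\<in>{0..<n - 2}. (a, b, c, d, e, f) = (0, i, 0, Suc (n - 3 - i), 0, 2)"
      using assms(1,2) by (intro bexI[of _ "b"]) auto
    then show ?thesis unfolding std image_iff by blast
  next
    assume "a = 0 \<and> b = 0 \<and> e = 0 \<and> f = 0 \<and> c \<ge> 1 \<and> d \<ge> 1"
    then have "\<exists>i\<in>{0..<n - 1}. (a, b, c, d, e, f) = (0, 0, Suc i, Suc (n - 2 - i), 0, 0)"
      using assms(1,2) by (intro bexI[of _ "c - 1"]) auto
    then show ?thesis unfolding std image_iff by blast
  next
    assume "a = 1 \<and> b = 0 \<and> e = 0 \<and> f = 0 \<and> c \<ge> 1 \<and> d \<ge> 1"
    then have "\<exists>i\<in>{0..<n - 2}. (a, b, c, d, e, f) = (1, 0, Suc i, Suc (n - 3 - i), 0, 0)"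
      using assms(1,2) by (intro bexI[of _ "c - 1"]) auto
    then show ?thesis unfolding std image_iff by blast
  next
    assume "a = 0 \<and> b = 0 \<and> e = 0 \<and> f = 1 \<and> c \<ge> 1 \<and> d \<ge> 1"
    then have "\<exists>i\<in>{0..<n - 2}. (a, b, c, d, e, f) = (0, 0, Suc i, Suc (n - 3 - i), 0, 1)"
      using assms(1,2) by (intro bexI[of _ "c - 1"]) auto
    then show ?thesis unfolding std image_iff by blast
  next
    assume "a = 0 \<and> b = 0 \<and> e = 0 \<and> f = 2 \<and> c \<ge> 1 \<and> d \<ge> 1"
    then have "\<exists>i\<in>{0..<n - 3}. (a, b, c, d, e, f) = (0, 0, Suc i, Suc (n - 4 - i), 0, 2)"
      using assms(1,2) by (intro bexI[of _ "c - 1"]) auto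
    then show ?thesis unfolding std image_iff by blast
  qed
qed

text \<open>Each relation rewrites its leading monomial into monomials of smaller weight, where $a,\dots,f$
  have the weights $10, 9, 0, 0, 11, 7$.\<close>
lemma mon6_std_reducible:
  fixes \<alpha> :: "'k::field_char_0"
  assumes \<alpha>: "\<alpha> \<noteq> 0" and n: "4 \<le> n"
  shows "a + b + c + d + e + f = n \<Longrightarrow> mon6 a b c d e f \<in> std_reducible \<alpha> n"
proof (induction "10 * a + 9 * b + 11 * e + 7 * f" arbitrary: a b c d e f rule: less_induct)
  case less
  note deg = less.prems
  \<comment> \<open>Rewriting preserves the degree, so only the weight has to drop.\<close>
  have IH: "mon6 p q r s t u \<in> std_reducible \<alpha> n"
    if "10 * p + 9 * q + 11 * t + 7 * u < 10 * a + 9 * b + 11 * e + 7 * f" "p + q + r + s + t + u = n"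
    for p q r s t u
    using less.hyps that by blast
  consider
    (std) "(a, b, c, d, e, f) \<in> set (std n)"
    | (abd) a' b' d' where "a = Suc a'" "b = Suc b'" "d = Suc d'"
    | (ace) a' c' e' where "a = Suc a'" "c = Suc c'" "e = Suc e'"
    | (bcd) b' c' d' where "b = Suc b'" "c = Suc c'" "d = Suc d'"
    | (bce) b' c' e' where "b = Suc b'" "c = Suc c'" "e = Suc e'"
    | (bcf) b' c' f' where "b = Suc b'" "c = Suc c'" "f = Suc f'"
    | (bde) b' d' e' where "b = Suc b'" "d = Suc d'" "e = Suc e'"
    | (cde) c' d' e' where "c = Suc c'" "d = Suc d'" "e = Suc e'"
    | (def) d' e' f' where "d = Suc d'" "e = Suc e'" "f = Suc f'"
    | (be) b' e' where "b = Suc b'" "e = Suc e'"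
    | (acf) a' c' f' where "a = Suc a'" "c = Suc c'" "f = Suc f'"
    | (adf) a' d' f' where "a = Suc a'" "d = Suc d'" "f = Suc f'"
    | (aee) a' e' where "a = Suc a'" "e = Suc (Suc e')"
    | (eef) e' f' where "e = Suc (Suc e')" "f = Suc f'"
    | (aaab) a' b' where "a = Suc (Suc (Suc a'))" "b = Suc b'"
    | (aabf) a' b' f' where "a = Suc (Suc a')" "b = Suc b'" "f = Suc f'"
    | (aaac) a' c' where "a = Suc (Suc (Suc a'))" "c = Suc c'"
    | (dfff) d' f' where "d = Suc d'" "f = Suc (Suc (Suc f'))"
    | (aacd) a' c' d' where "a = Suc (Suc a')" "c = Suc c'" "d = Suc d'"
  \<comment> \<open>If no case applied, no leading monomial would divide, and the first case would
    hold after all. The witnesses are the exponents of the quotient monomial.\<close>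
  proof (rule ccontr)
    assume neg: "\<not> thesis"
    have "(a, b, c, d, e, f) \<in> set (std n)"
    proof (rule nonlead_in_std[OF deg n])
      show "a = 0 \<or> b = 0 \<or> d = 0"
        by (rule ccontr, rule notE[OF neg], rule that(2)[of "a - 1" "b - 1" "d - 1"]) auto
      show "a = 0 \<or> c = 0 \<or> e = 0"
        by (rule ccontr, rule notE[OF neg], rule that(3)[of "a - 1" "c - 1" "e - 1"]) auto
      show "b = 0 \<or> c = 0 \<or> d = 0"
        by (rule ccontr, rule notE[OF neg], rule that(4)[of "b - 1" "c - 1" "d - 1"]) auto
      show "b = 0 \<or> c = 0 \<or> e = 0"
        by (rule ccontr, rule notE[OF neg], rule that(5)[of "b - 1" "c - 1" "e - 1"]) auto
      show "b = 0 \<or> c = 0 \<or> f = 0"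
        by (rule ccontr, rule notE[OF neg], rule that(6)[of "b - 1" "c - 1" "f - 1"]) auto
      show "b = 0 \<or> d = 0 \<or> e = 0"
        by (rule ccontr, rule notE[OF neg], rule that(7)[of "b - 1" "d - 1" "e - 1"]) auto
      show "c = 0 \<or> d = 0 \<or> e = 0"
        by (rule ccontr, rule notE[OF neg], rule that(8)[of "c - 1" "d - 1" "e - 1"]) auto
      show "d = 0 \<or> e = 0 \<or> f = 0"
        by (rule ccontr, rule notE[OF neg], rule that(9)[of "d - 1" "e - 1" "f - 1"]) auto
      show "b = 0 \<or> e = 0"
        by (rule ccontr, rule notE[OF neg], rule that(10)[of "b - 1" "e - 1"]) auto
      show "a = 0 \<or> c = 0 \<or> f = 0"
        by (rule ccontr, rule notE[OF neg], rule that(11)[of "a - 1" "c - 1" "f - 1"]) auto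
      show "a = 0 \<or> d = 0 \<or> f = 0"
        by (rule ccontr, rule notE[OF neg], rule that(12)[of "a - 1" "d - 1" "f - 1"]) auto
      show "a = 0 \<or> e < 2"
        by (rule ccontr, rule notE[OF neg], rule that(13)[of "a - 1" "e - 2"]) auto
      show "e < 2 \<or> f = 0"
        by (rule ccontr, rule notE[OF neg], rule that(14)[of "e - 2" "f - 1"]) auto
      show "a < 3 \<or> b = 0"
        by (rule ccontr, rule notE[OF neg], rule that(15)[of "a - 3" "b - 1"]) auto
      show "a < 2 \<or> b = 0 \<or> f = 0"
        by (rule ccontr, rule notE[OF neg], rule that(16)[of "a - 2" "b - 1" "f - 1"]) auto
      show "a < 3 \<or> c = 0"
        by (rule ccontr, rule notE[OF neg], rule that(17)[of "a - 3" "c - 1"]) auto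
      show "d = 0 \<or> f < 3"
        by (rule ccontr, rule notE[OF neg], rule that(18)[of "d - 1" "f - 3"]) auto
      show "a < 2 \<or> c = 0 \<or> d = 0"
        by (rule ccontr, rule notE[OF neg], rule that(19)[of "a - 2" "c - 1" "d - 1"]) auto
    qed
    then show False using neg that(1) by blast
  qed
  then show ?case
  proof cases
    case std
    then show ?thesis using std_reducible_std[of "(a, b, c, d, e, f)" n \<alpha>] by simp
  next
    case abd
    \<comment> \<open>The cofactor has degree \<open>n - 3\<close>, which is positive because
      \<open>n\<close> is at least 4; this is what \<open>linsat_mon\<close> asks for.\<close>
    have "mon6 a' b' c d' e f * (M12 * M13 * M23) \<in> line_ideal \<alpha>"
      using deg n unfolding abd by (intro linsat_mon sat_abd \<alpha>) linarith
    then show ?thesis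
      unfolding abd by (intro std_reducible_line) (simp add: mon6_Suc mult_ac)
  next
    case ace
    have "mon6 a' b c' d e' f * (M12 * M14 * M24) \<in> line_ideal \<alpha>"
      using deg n unfolding ace by (intro linsat_mon sat_ace \<alpha>) linarith
    then show ?thesis
      unfolding ace by (intro std_reducible_line) (simp add: mon6_Suc mult_ac)
  next
    case bcd
    have "mon6 a b' c' d' e f * (M13 * M14 * M23) \<in> line_ideal \<alpha>"
      using deg n unfolding bcd by (intro linsat_mon sat_bcd \<alpha>) linarith
    then show ?thesis
      unfolding bcd by (intro std_reducible_line) (simp add: mon6_Suc mult_ac)
  next
    case bce
    have "mon6 a b' c' d e' f * (M13 * M14 * M24) \<in> line_ideal \<alpha>"
      using deg n unfolding bce by (intro linsat_mon sat_bce \<alpha>) linarith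
    then show ?thesis
      unfolding bce by (intro std_reducible_line) (simp add: mon6_Suc mult_ac)
  next
    case bcf
    have "mon6 a b' c' d e f' * (M13 * M14 * M34) \<in> line_ideal \<alpha>"
      using deg n unfolding bcf by (intro linsat_mon sat_bcf \<alpha>) linarith
    then show ?thesis
      unfolding bcf by (intro std_reducible_line) (simp add: mon6_Suc mult_ac)
  next
    case bde
    have "mon6 a b' c d' e' f * (M13 * M23 * M24) \<in> line_ideal \<alpha>"
      using deg n unfolding bde by (intro linsat_mon sat_bde \<alpha>) linarith
    then show ?thesis
      unfolding bde by (intro std_reducible_line) (simp add: mon6_Suc mult_ac)
  next
    case cde
    have "mon6 a b c' d' e' f * (M14 * M23 * M24) \<in> line_ideal \<alpha>"
      using deg n unfolding cde by (intro linsat_mon sat_cde \<alpha>) linarith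
    then show ?thesis
      unfolding cde by (intro std_reducible_line) (simp add: mon6_Suc mult_ac)
  next
    case def
    have "mon6 a b c d' e' f' * (M23 * M24 * M34) \<in> line_ideal \<alpha>"
      using deg n unfolding def by (intro linsat_mon sat_def \<alpha>) linarith
    then show ?thesis
      unfolding def by (intro std_reducible_line) (simp add: mon6_Suc mult_ac)
  next
    case be
    \<comment> \<open>The sign gives \<open>be\<close> the coefficient 1. The pattern from here on:
      a multiple of the relation \<open>?g\<close> lies in the ideal, and removing its lower terms,
      which reduce by induction, leaves the leading monomial.\<close>
    let ?g = "- Pl"
    have "mon6 a b' c d e' f * ?g \<in> line_ideal \<alpha>"
      using deg n unfolding be by (intro line_mult line_uminus Pl_line mon6_polyring)
    then have "mon6 a b' c d e' f * ?g
        + mon6 (Suc a) b' c d e' (Suc f)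
        + mon6 a b' (Suc c) (Suc d) e' f \<in> std_reducible \<alpha> n" (is "?h \<in> _")
      using deg unfolding be
      by (intro std_reducible_add std_reducible_diff std_reducible_scale std_reducible_numeral IH
          std_reducible_line[where h = "mon6 a b' c d e' f * _"]) (simp_all add: be)
    also have "?h = mon6 a (Suc b') c d (Suc e') f"
      by (simp add: mon6_Suc Pl_def Const_numeral algebra_simps)
    finally show ?thesis
      unfolding be .
  next
    case acf
    let ?g = "M12 * M14 * M34 + M14 * M14 * M23"
    have "mon6 a' b c' d e f' * ?g \<in> line_ideal \<alpha>"
      using deg n unfolding acf by (intro linsat_mon rel_acf \<alpha>) linarith
    then have "mon6 a' b c' d e f' * ?g
        - mon6 a' b (Suc (Suc c')) (Suc d) e f' \<in> std_reducible \<alpha> n" (is "?h \<in> _")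
      using deg unfolding acf
      by (intro std_reducible_add std_reducible_diff std_reducible_scale std_reducible_numeral IH
          std_reducible_line[where h = "mon6 a' b c' d e f' * _"]) (simp_all add: acf)
    also have "?h = mon6 (Suc a') b (Suc c') d e (Suc f')"
      by (simp add: mon6_Suc Pl_def Const_numeral algebra_simps)
    finally show ?thesis
      unfolding acf .
  next
    case adf
    let ?g = "M12 * M23 * M34 + M14 * M23 * M23"
    have "mon6 a' b c d' e f' * ?g \<in> line_ideal \<alpha>"
      using deg n unfolding adf by (intro linsat_mon rel_adf \<alpha>) linarith
    then have "mon6 a' b c d' e f' * ?g
        - mon6 a' b (Suc c) (Suc (Suc d')) e f' \<in> std_reducible \<alpha> n" (is "?h \<in> _")
      using deg unfolding adf
      by (intro std_reducible_add std_reducible_diff std_reducible_scale std_reducible_numeral IH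
          std_reducible_line[where h = "mon6 a' b c d' e f' * _"]) (simp_all add: adf)
    also have "?h = mon6 (Suc a') b c (Suc d') e (Suc f')"
      by (simp add: mon6_Suc Pl_def Const_numeral algebra_simps)
    finally show ?thesis
      unfolding adf .
  next
    case aee
    let ?g = "2 * (M12 * M24 * M24) + M12 * M12 * M12 + M12 * M14 * M14 + Const \<alpha> * (M12 * M23 * M23) + Const
        \<alpha> * (M12 * M34 * M34) + 2 * (M14 * M23 * M23) - M13 * M13 * M14"
    have "mon6 a' b c d e' f * ?g \<in> line_ideal \<alpha>"
      using deg n unfolding aee by (intro linsat_mon rel_aee \<alpha>) linarith
    then have "mon6 a' b c d e' f * ?g
        - mon6 (Suc (Suc (Suc a'))) b c d e' f
        - mon6 (Suc a') b (Suc (Suc c)) d e' f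
        - Const \<alpha> * mon6 (Suc a') b c (Suc (Suc d)) e' f
        - Const \<alpha> * mon6 (Suc a') b c d e' (Suc (Suc f))
        - 2 * mon6 a' b (Suc c) (Suc (Suc d)) e' f
        + mon6 a' (Suc (Suc b)) (Suc c) d e' f \<in> std_reducible \<alpha> n" (is "?h \<in> _")
      using deg unfolding aee
      by (intro std_reducible_add std_reducible_diff std_reducible_scale std_reducible_numeral IH
          std_reducible_line[where h = "mon6 a' b c d e' f * _"]) (simp_all add: aee)
    also have "?h = Const 2 * mon6 (Suc a') b c d (Suc (Suc e')) f"
      by (simp add: mon6_Suc Pl_def Const_numeral algebra_simps)
    finally show ?thesis
      \<comment> \<open>The leading coefficient 2 is cancelled at the end; the relation for
        \<open>df^3\<close> has \<alpha> in this place.\<close>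
      unfolding aee by (rule std_reducible_cancel[rotated]) (use \<alpha> in simp_all)
  next
    case eef
    let ?g = "2 * (M24 * M24 * M34) + M12 * M12 * M34 + M14 * M14 * M34 + Const \<alpha> * (M23 * M23 * M34) + Const
        \<alpha> * (M34 * M34 * M34) - 2 * (M23 * M34 * M34) - M13 * M13 * M23"
    have "mon6 a b c d e' f' * ?g \<in> line_ideal \<alpha>"
      using deg n unfolding eef by (intro linsat_mon rel_eef \<alpha>) linarith
    then have "mon6 a b c d e' f' * ?g
        - mon6 (Suc (Suc a)) b c d e' (Suc f')
        - mon6 a b (Suc (Suc c)) d e' (Suc f')
        - Const \<alpha> * mon6 a b c (Suc (Suc d)) e' (Suc f')
        - Const \<alpha> * mon6 a b c d e' (Suc (Suc (Suc f')))
        + 2 * mon6 a b c (Suc d) e' (Suc (Suc f'))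
        + mon6 a (Suc (Suc b)) c (Suc d) e' f' \<in> std_reducible \<alpha> n" (is "?h \<in> _")
      using deg unfolding eef
      by (intro std_reducible_add std_reducible_diff std_reducible_scale std_reducible_numeral IH
          std_reducible_line[where h = "mon6 a b c d e' f' * _"]) (simp_all add: eef)
    also have "?h = Const 2 * mon6 a b c d (Suc (Suc e')) (Suc f')"
      by (simp add: mon6_Suc Pl_def Const_numeral algebra_simps)
    finally show ?thesis
      unfolding eef by (rule std_reducible_cancel[rotated]) (use \<alpha> in simp_all)
  next
    case aaab
    let ?g = "M12 * M12 * M12 * M13 + M12 * M13 * M14 * M14 + 2 * (M12 * M12 * M24 * M34) + Const \<alpha> * (M12 *
        M13 * M34 * M34) - M13 * M13 * M13 * M14"
    have "mon6 a' b' c d e f * ?g \<in> line_ideal \<alpha>"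
      using deg n unfolding aaab by (intro line_mult rel_aaab \<alpha> mon6_polyring)
    then have "mon6 a' b' c d e f * ?g
        - mon6 (Suc a') (Suc b') (Suc (Suc c)) d e f
        - 2 * mon6 (Suc (Suc a')) b' c d (Suc e) (Suc f)
        - Const \<alpha> * mon6 (Suc a') (Suc b') c d e (Suc (Suc f))
        + mon6 a' (Suc (Suc (Suc b'))) (Suc c) d e f \<in> std_reducible \<alpha> n" (is "?h \<in> _")
      using deg unfolding aaab
      by (intro std_reducible_add std_reducible_diff std_reducible_scale std_reducible_numeral IH
          std_reducible_line[where h = "mon6 a' b' c d e f * _"]) (simp_all add: aaab)
    also have "?h = mon6 (Suc (Suc (Suc a'))) (Suc b') c d e f"
      by (simp add: mon6_Suc Pl_def Const_numeral algebra_simps)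
    finally show ?thesis
      unfolding aaab .
  next
    case aabf
    let ?g = "M12 * M12 * M13 * M34 + Const \<alpha> * (M13 * M23 * M23 * M34) + Const \<alpha> * (M13 * M34 * M34 *
        M34) - 2 * (M13 * M23 * M34 * M34) - M13 * M13 * M13 * M23 + 2 * (M12 * M24 * M34 * M34)"
    have "mon6 a' b' c d e f' * ?g \<in> line_ideal \<alpha>"
      using deg n unfolding aabf by (intro line_mult rel_aabf \<alpha> mon6_polyring)
    then have "mon6 a' b' c d e f' * ?g
        - Const \<alpha> * mon6 a' (Suc b') c (Suc (Suc d)) e (Suc f')
        - Const \<alpha> * mon6 a' (Suc b') c d e (Suc (Suc (Suc f')))
        + 2 * mon6 a' (Suc b') c (Suc d) e (Suc (Suc f'))
        + mon6 a' (Suc (Suc (Suc b'))) c (Suc d) e f'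
        - 2 * mon6 (Suc a') b' c d (Suc e) (Suc (Suc f')) \<in> std_reducible \<alpha> n" (is "?h \<in> _")
      using deg unfolding aabf
      by (intro std_reducible_add std_reducible_diff std_reducible_scale std_reducible_numeral IH
          std_reducible_line[where h = "mon6 a' b' c d e f' * _"]) (simp_all add: aabf)
    also have "?h = mon6 (Suc (Suc a')) (Suc b') c d e (Suc f')"
      by (simp add: mon6_Suc Pl_def Const_numeral algebra_simps)
    finally show ?thesis
      unfolding aabf .
  next
    case aaac
    let ?g = "M12 * M12 * M12 * M14 + M12 * M14 * M14 * M14 + Const \<alpha> * (M12 * M14 * M23 * M23) + 2 * (M14 *
        M14 * M23 * M23) - Const \<alpha> * (M14 * M14 * M23 * M34) - M13 * M13 * M14 * M14"
    have "mon6 a' b c' d e f * ?g \<in> line_ideal \<alpha>"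
      using deg n unfolding aaac by (intro line_mult rel_aaac \<alpha> mon6_polyring)
    then have "mon6 a' b c' d e f * ?g
        - mon6 (Suc a') b (Suc (Suc (Suc c'))) d e f
        - Const \<alpha> * mon6 (Suc a') b (Suc c') (Suc (Suc d)) e f
        - 2 * mon6 a' b (Suc (Suc c')) (Suc (Suc d)) e f
        + Const \<alpha> * mon6 a' b (Suc (Suc c')) (Suc d) e (Suc f)
        + mon6 a' (Suc (Suc b)) (Suc (Suc c')) d e f \<in> std_reducible \<alpha> n" (is "?h \<in> _")
      using deg unfolding aaac
      by (intro std_reducible_add std_reducible_diff std_reducible_scale std_reducible_numeral IH
          std_reducible_line[where h = "mon6 a' b c' d e f * _"]) (simp_all add: aaac)
    also have "?h = mon6 (Suc (Suc (Suc a'))) b (Suc c') d e f"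
      by (simp add: mon6_Suc Pl_def Const_numeral algebra_simps)
    finally show ?thesis
      unfolding aaac .
  next
    case dfff
    let ?g = "Const \<alpha> * (M23 * M34 * M34 * M34) - M12 * M14 * M23 * M23 + M14 * M14 * M23 * M34 + Const
        \<alpha> * (M23 * M23 * M23 * M34) - 2 * (M23 * M23 * M34 * M34) - M13 * M13 * M23 * M23"
    have "mon6 a b c d' e f' * ?g \<in> line_ideal \<alpha>"
      using deg n unfolding dfff by (intro line_mult rel_dfff \<alpha> mon6_polyring)
    then have "mon6 a b c d' e f' * ?g
        + mon6 (Suc a) b (Suc c) (Suc (Suc d')) e f'
        - mon6 a b (Suc (Suc c)) (Suc d') e (Suc f')
        - Const \<alpha> * mon6 a b c (Suc (Suc (Suc d'))) e (Suc f')
        + 2 * mon6 a b c (Suc (Suc d')) e (Suc (Suc f'))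
        + mon6 a (Suc (Suc b)) c (Suc (Suc d')) e f' \<in> std_reducible \<alpha> n" (is "?h \<in> _")
      using deg unfolding dfff
      by (intro std_reducible_add std_reducible_diff std_reducible_scale std_reducible_numeral IH
          std_reducible_line[where h = "mon6 a b c d' e f' * _"]) (simp_all add: dfff)
    also have "?h = Const \<alpha> * mon6 a b c (Suc d') e (Suc (Suc (Suc f')))"
      by (simp add: mon6_Suc Pl_def Const_numeral algebra_simps)
    finally show ?thesis
      unfolding dfff by (rule std_reducible_cancel[rotated]) (use \<alpha> in simp_all)
  next
    case aacd
    let ?g = "M12 * M12 * M14 * M23 + M14 * M14 * M14 * M23 + Const \<alpha> * (M14 * M23 * M23 * M23) + Const
        \<alpha> * (M14 * M23 * M34 * M34) - 2 * (M14 * M23 * M23 * M34)"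
    have "mon6 a' b c' d' e f * ?g \<in> line_ideal \<alpha>"
      using deg n unfolding aacd by (intro line_mult rel_aacd \<alpha> mon6_polyring)
    then have "mon6 a' b c' d' e f * ?g
        - mon6 a' b (Suc (Suc (Suc c'))) (Suc d') e f
        - Const \<alpha> * mon6 a' b (Suc c') (Suc (Suc (Suc d'))) e f
        - Const \<alpha> * mon6 a' b (Suc c') (Suc d') e (Suc (Suc f))
        + 2 * mon6 a' b (Suc c') (Suc (Suc d')) e (Suc f) \<in> std_reducible \<alpha> n" (is "?h \<in> _")
      using deg unfolding aacd
      by (intro std_reducible_add std_reducible_diff std_reducible_scale std_reducible_numeral IH
          std_reducible_line[where h = "mon6 a' b c' d' e f * _"]) (simp_all add: aacd)
    also have "?h = mon6 (Suc (Suc a')) b (Suc c') (Suc d') e f"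
      by (simp add: mon6_Suc Pl_def Const_numeral algebra_simps)
    finally show ?thesis
      unfolding aacd .
  qed
qed

section \<open>Independence on double covers of the line\<close>

lemma sum_parity_split:
  fixes f :: "nat \<Rightarrow> 'b::comm_monoid_add"
  shows "(\<Sum>i<2 * K. f i) = (\<Sum>k<K. f (2 * k)) + (\<Sum>k<K. f (Suc (2 * k)))"
  by (induction K) (simp_all add: algebra_simps)

text \<open>Uniqueness of expansions in base \<open>N/D\<close>, with denominators cleared. Modulo
  \<open>N\<close> only the digit \<open>A 0\<close> times a power of \<open>D\<close> survives;
  \<open>D\<close> is invertible there, so \<open>N\<close> divides \<open>A 0\<close>, which is
  zero by degree. Cancelling one factor \<open>N\<close> gives the same situation with one digit
  less. The remainder \<open>R\<close> may have any degree.\<close>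

lemma base_expansion_unique:
  fixes N D :: "'k::field poly"
  assumes bezout: "u * N + v * D = 1" and "N \<noteq> 0"
    and "\<And>k. k < K \<Longrightarrow> degree (A k) < degree N"
    and "(\<Sum>k<K. N ^ k * D ^ (K - k) * A k) + N ^ K * R = 0"
  shows "(\<forall>k<K. A k = 0) \<and> R = 0"
  using assms(3,4)
proof (induction K arbitrary: A)
  case (Suc K)
  let ?S = "(\<Sum>k<K. N ^ k * D ^ (K - k) * A (Suc k)) + N ^ K * R"
  have eq: "D ^ Suc K * A 0 + N * ?S = 0"
    using Suc.prems(2)
    by (simp add: sum.lessThan_Suc_shift sum_distrib_left distrib_left mult_ac add.assoc del: sum.lessThan_Suc)
  \<comment> \<open>Modulo \<open>N\<close> the polynomial \<open>v\<close> inverts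
    \<open>D\<close>, hence its power inverts the power of \<open>D\<close>.\<close>
  have "N dvd 1 ^ Suc K - v ^ Suc K * D ^ Suc K"
  proof -
    have "N dvd 1 - v * D" using bezout by (intro dvdI[of _ _ u]) (simp add: algebra_simps)
    then have "N dvd (1 - v * D) * (\<Sum>i<Suc K. (v * D) ^ i)" by (rule dvd_mult2)
    then have "N dvd 1 - (v * D) ^ Suc K" by (simp only: one_diff_power_eq)
    then show ?thesis by (simp only: power_mult_distrib power_one)
  qed
  then have 1: "N dvd (1 - v ^ Suc K * D ^ Suc K) * A 0" by simp
  have "D ^ Suc K * A 0 = - (N * ?S)" using eq by (simp add: eq_neg_iff_add_eq_0)
  then have 2: "N dvd v ^ Suc K * (D ^ Suc K * A 0)" by simp
  have "N dvd A 0" using dvd_add[OF 1 2] by (simp add: algebra_simps)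
  moreover have "degree (A 0) < degree N" by (rule Suc.prems(1)) simp
  ultimately have A0: "A 0 = 0" using dvd_imp_degree_le[of N "A 0"] by fastforce
  with eq \<open>N \<noteq> 0\<close> have "?S = 0" by simp
  then have "(\<forall>k<K. A (Suc k) = 0) \<and> R = 0"
    by (intro Suc.IH Suc.prems(1)) auto
  then show ?case using A0 by (auto simp: less_Suc_eq_0_disj)
qed simp

lemma alg_closed_sqrt:
  fixes q :: "'k::field"
  assumes "alg_closed TYPE('k)" shows "\<exists>y. y ^ 2 = q"
proof -
  have "degree [:- q, 0, 1:] > 0" by simp
  then obtain y where "poly [:- q, 0, 1:] y = 0" using assms unfolding alg_closed_def by blast
  then show ?thesis by (intro exI[of _ y]) (simp add: power2_eq_square algebra_simps)
qed

lemma poly_eq_0_cofinite: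
  fixes p :: "'k::field_char_0 poly"
  assumes "finite T" "\<And>t. t \<notin> T \<Longrightarrow> poly p t = 0" shows "p = 0"
proof (rule ccontr)
  assume "p \<noteq> 0"
  then have "finite {t. poly p t = 0}" by (rule poly_roots_finite)
  moreover have "UNIV \<subseteq> T \<union> {t. poly p t = 0}" using assms(2) by auto
  ultimately have "finite (UNIV :: 'k set)" using assms(1) finite_subset by blast
  then show False using infinite_UNIV_char_0 by blast
qed

text \<open>A function on the double cover $y^2 = N(t)/D(t)$ of the line splits into its even and odd part under
  $y \mapsto -y$; each part is an expansion in powers of $N/D$ with digits of degree below that of $N$.\<close>
lemma double_cover_independent:
  fixes N D :: "'k::field_char_0 poly"
  assumes closed: "alg_closed TYPE('k)" and T: "finite T"
    and bezout: "u * N + v * D = 1" and N: "N \<noteq> 0" and D: "D \<noteq> 0"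
    and deg: "\<And>i. i < 2 * K \<Longrightarrow> degree (A i) < degree N"
    and vanish: "\<And>t y. t \<notin> T \<Longrightarrow> y ^ 2 * poly D t = poly N t \<Longrightarrow> y \<noteq> 0 \<Longrightarrow> poly D t \<noteq> 0 \<Longrightarrow>
       (\<Sum>i<2 * K. y ^ i * poly (A i) t) + y ^ (2 * K) * (poly R t + y * poly R' t) = 0"
  shows "i < 2 * K \<Longrightarrow> A i = 0" "R = 0" "R' = 0"
proof -
  \<comment> \<open>\<open>E\<close> and \<open>F\<close> are the even and the odd part in
    \<open>y\<close>, multiplied by \<open>D ^ K\<close> so that they become polynomials in
    \<open>t\<close>.\<close>
  define E where "E = (\<Sum>k<K. N ^ k * D ^ (K - k) * A (2 * k)) + N ^ K * R"
  define F where "F = (\<Sum>k<K. N ^ k * D ^ (K - k) * A (Suc (2 * k))) + N ^ K * R'"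
  \<comment> \<open>Away from the zeros of \<open>N\<close> and \<open>D\<close> the quotient is
    finite and nonzero, so it has a nonzero square root \<open>y\<close>.\<close>
  let ?T = "T \<union> {t. poly N t = 0} \<union> {t. poly D t = 0}"
  have fin: "finite ?T" using T N D by (simp add: poly_roots_finite)
  have EF: "poly E t = 0 \<and> poly F t = 0" if t: "t \<notin> ?T" for t
  proof -
    define q where "q = poly N t / poly D t"
    have q: "q * poly D t = poly N t" "q \<noteq> 0" and Dt: "poly D t \<noteq> 0"
      using t by (auto simp: q_def)
    obtain y where y: "y ^ 2 = q" using alg_closed_sqrt[OF closed] by blast
    then have "y \<noteq> 0" using q by auto
    define e where "e = (\<Sum>k<K. q ^ k * poly (A (2 * k)) t) + q ^ K * poly R t"
    define f where "f = (\<Sum>k<K. q ^ k * poly (A (Suc (2 * k))) t) + q ^ K * poly R' t"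
    have *: "(\<Sum>i<2 * K. z ^ i * poly (A i) t) + z ^ (2 * K) * (poly R t + z * poly R' t) = e + z * f"
      if "z ^ 2 = q" for z
      by (simp only: sum_parity_split power_Suc power_mult that e_def f_def)
        (simp add: sum_distrib_left distrib_left mult.assoc add_ac mult.left_commute)
    \<comment> \<open>Both square roots of \<open>q\<close> give points of the curve. Sum and
      difference of the two equations isolate \<open>e\<close> and \<open>f\<close>, as 2 is
      invertible.\<close>
    have "e + y * f = 0"
      using vanish[of t y] * [of y] t y q \<open>y \<noteq> 0\<close> by auto
    moreover have "e + (- y) * f = 0"
      using vanish[of t "- y"] * [of "- y"] t y q \<open>y \<noteq> 0\<close> by auto
    ultimately have "2 * e = 0" "2 * (y * f) = 0" by (simp_all add: algebra_simps)
    then have ef: "e = 0" "f = 0" using \<open>y \<noteq> 0\<close> by auto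
    have pow: "poly N t ^ k * poly D t ^ (K - k) = poly D t ^ K * q ^ k" if "k \<le> K" for k
    proof -
      have "poly N t ^ k * poly D t ^ (K - k) = q ^ k * (poly D t ^ k * poly D t ^ (K - k))"
        by (simp add: q(1)[symmetric] power_mult_distrib mult_ac)
      also have "poly D t ^ k * poly D t ^ (K - k) = poly D t ^ K"
        using that by (simp add: power_add[symmetric])
      finally show ?thesis by simp
    qed
    have "poly E t = poly D t ^ K * e" "poly F t = poly D t ^ K * f"
      using pow[of K] unfolding E_def F_def e_def f_def
      by (simp_all add: poly_sum poly_power distrib_left sum_distrib_left mult.assoc[symmetric] pow
          cong: sum.cong_simp)
    with ef show ?thesis by simp
  qed
  have "E = 0" by (rule poly_eq_0_cofinite[OF fin]) (use EF in blast)
  then have even: "(\<forall>k<K. A (2 * k) = 0) \<and> R = 0"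
    unfolding E_def by (intro base_expansion_unique[OF bezout N] deg) auto
  have "F = 0" by (rule poly_eq_0_cofinite[OF fin]) (use EF in blast)
  then have odd: "(\<forall>k<K. A (Suc (2 * k)) = 0) \<and> R' = 0"
    unfolding F_def by (intro base_expansion_unique[OF bezout N] deg) auto
  show "A i = 0" if "i < 2 * K" for i
  proof (cases "even i")
    case True then show ?thesis using even that by (auto elim!: evenE)
  next
    case False then show ?thesis using odd that by (auto elim!: oddE)
  qed
  show "R = 0" "R' = 0" using even odd by auto
qed

section \<open>Points on the components\<close>

text \<open>Indices beyond 5 get the value 0, as under \<open>theta\<close>, so that the two can be
  compared as functions.\<close>

definition pt :: "'k::comm_ring_1 \<Rightarrow> 'k \<Rightarrow> 'k \<Rightarrow> 'k \<Rightarrow> 'k \<Rightarrow> 'k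
    \<Rightarrow> nat \<Rightarrow> 'k" where
  "pt a b c d e f i = (if i < 6 then [a, b, c, d, e, f] ! i else 0)"

lemma pt_simps [simp]:
  "pt a b c d e f 0 = a" "pt a b c d e f (Suc 0) = b" "pt a b c d e f 2 = c"
  "pt a b c d e f 3 = d" "pt a b c d e f 4 = e" "pt a b c d e f 5 = f"
  by (simp_all add: pt_def)

definition line_zeros :: "'k::comm_ring_1 \<Rightarrow> (nat \<Rightarrow> 'k) set" where
  "line_zeros \<alpha> = {p. \<forall>F\<in>line_ideal \<alpha>. peval p F = 0}"

text \<open>The polynomials vanishing at a given point form an ideal, so generators suffice.\<close>

lemma line_zeros_iff:
  "p \<in> line_zeros \<alpha> \<longleftrightarrow> peval p Pl = 0 \<and> (\<forall>F\<in>minor_quartics \<alpha>. peval p F = 0)"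
proof
  assume "p \<in> line_zeros \<alpha>"
  then show "peval p Pl = 0 \<and> (\<forall>F\<in>minor_quartics \<alpha>. peval p F = 0)"
    using ideal_gen_superset unfolding line_zeros_def line_ideal_def by blast
next
  assume "peval p Pl = 0 \<and> (\<forall>F\<in>minor_quartics \<alpha>. peval p F = 0)"
  then have "insert Pl (minor_quartics \<alpha>) \<subseteq> {F \<in> polyring 6. peval p F = 0}"
    by (auto simp: minor_quartics_def)
  moreover have "is_ideal (polyring 6) {F \<in> polyring 6. peval p F = 0}"
    by (auto simp: is_ideal_def)
  ultimately have "line_ideal \<alpha> \<subseteq> {F \<in> polyring 6. peval p F = 0}"
    unfolding line_ideal_def by (intro ideal_gen_least)
  then show "p \<in> line_zeros \<alpha>" by (auto simp: line_zeros_def)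
qed

lemma peval_det8: "peval q (det8 A) = det8 (\<lambda>i j. peval q (A i j))"
  by (simp add: det8_def peval.subst_sum peval.subst_prod)

text \<open>The vector $(w, z)$ lies in the kernel of the $10 \times 8$ matrix at $(u, v)$, so all its $8 \times 8$
  minors vanish there.\<close>
lemma line_zerosI:
  fixes \<alpha> :: "'k::field" and u v w z :: "nat \<Rightarrow> 'k"
  defines "N \<equiv> \<lambda>i j. u i * v j - u j * v i"
  assumes rows:
    "\<alpha> * u 1 * w 1 + u 4 * w 2 + u 3 * w 3 + \<alpha> * v 1 * z 1 + v 4 * z 2 + v 3 * z 3 = 0"
    "u 1 * w 2 + v 1 * z 2 = 0"
    "- u 3 * w 1 + u 1 * w 3 - v 3 * z 1 + v 1 * z 3 = 0"
    "- u 4 * w 1 + u 1 * w 4 - v 4 * z 1 + v 1 * z 4 = 0"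
    "u 2 * w 1 + v 2 * z 1 = 0"
    "(\<alpha> * u 2 - 2 * u 4) * w 2 - 2 * u 3 * w 3 + \<alpha> * u 4 * w 4
       + (\<alpha> * v 2 - 2 * v 4) * z 2 - 2 * v 3 * z 3 + \<alpha> * v 4 * z 4 = 0"
    "u 3 * w 2 + u 2 * w 3 + v 3 * z 2 + v 2 * z 3 = 0"
    "- u 4 * w 2 + u 2 * w 4 - v 4 * z 2 + v 2 * z 4 = 0"
    "u 3 * w 4 + v 3 * z 4 = 0"
    "u 4 * w 3 + v 4 * z 3 = 0"
    and nonzero: "w 1 \<noteq> 0 \<or> w 2 \<noteq> 0 \<or> w 3 \<noteq> 0 \<or> w 4 \<noteq> 0 \<or> z 1 \<noteq> 0 \<or>
        z 2 \<noteq> 0 \<or> z 3 \<noteq> 0 \<or> z 4 \<noteq> 0"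
  shows "pt (N 3 4) (- N 2 4) (N 2 3) (N 1 4) (- N 1 3) (N 1 2) \<in> line_zeros \<alpha>"
proof -
  \<comment> \<open>The vectors \<open>u, v\<close> and \<open>w, z\<close> are indexed from 1,
    matrix variables and columns from 0: \<open>q\<close> and \<open>x\<close> translate,
    concatenating each pair.\<close>
  define q where "q i = (if i < 4 then u (i + 1) else v (i - 3))" for i
  define x where "x j = (if j < 4 then w (j + 1) else z (j - 3))" for j
  let ?p = "pt (N 3 4) (- N 2 4) (N 2 3) (N 1 4) (- N 1 3) (N 1 2)"
  have q: "q 0 = u 1" "q (Suc 0) = u 2" "q 2 = u 3" "q 3 = u 4" "q 4 = v 1" "q 5 = v 2" "q 6 = v 3" "q 7 = v 4"
    by (simp_all add: q_def numeral_2_eq_2[symmetric])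
  have x: "x 0 = w 1" "x (Suc 0) = w 2" "x 2 = w 3" "x 3 = w 4" "x 4 = z 1" "x 5 = z 2" "x 6 = z 3" "x 7 = z 4"
    by (simp_all add: x_def numeral_2_eq_2[symmetric])
  have sum8: "(\<Sum>j<8. g j) = g 0 + g (Suc 0) + g 2 + g 3 + g 4 + g 5 + g 6 + g 7" for g :: "nat \<Rightarrow> 'k"
    by (simp add: eval_nat_numeral)
  have row: "(\<Sum>j<8. peval q (Mat \<alpha> r j) * x j) = 0" if "r < 10" for r
  proof -
    have "r = 0 \<or> r = 1 \<or> r = 2 \<or> r = 3 \<or> r = 4 \<or> r = 5 \<or> r = 6 \<or> r = 7 \<or> r = 8 \<or> r = 9"
      using \<open>r < 10\<close> by presburger
    then show ?thesis
      unfolding sum8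
      by (elim disjE) (use rows in \<open>simp_all add: Mat_def uu_def vv_def q x mult.assoc\<close>)
  qed
  have "\<exists>k<8. x k \<noteq> 0"
  proof (rule ccontr)
    assume "\<not> (\<exists>k<8. x k \<noteq> 0)"
    then have "x k = 0" if "k < 8" for k using that by blast
    from this[of 0] this[of "Suc 0"] this[of 2] this[of 3] this[of 4] this[of 5] this[of 6] this[of 7]
    show False using nonzero by (simp add: x)
  qed
  then obtain k where k: "k < 8" "x k \<noteq> 0" by blast
  \<comment> \<open>The coordinates of \<open>?p\<close> are the Pluecker coordinates of
    \<open>u, v\<close> in the dual labelling of \<open>theta\<close>.\<close>
  have theta: "(\<lambda>i. peval q (theta i)) = ?p"
  proof
    fix i
    show "peval q (theta i) = ?p i"
    proof (cases "i < 6")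
      case True
      then have "i = 0 \<or> i = 1 \<or> i = 2 \<or> i = 3 \<or> i = 4 \<or> i = 5" by presburger
      then show ?thesis
        by (elim disjE) (simp_all add: theta_def NN_def uu_def vv_def q N_def)
    next
      case False
      then show ?thesis by (simp add: theta_def pt_def)
    qed
  qed
  have minor: "peval q (minor8 \<alpha> S) = 0" if S: "S \<subseteq> {..<10}" "card S = 8" for S
  proof -
    have "sorted_list_of_set S ! i < 10" if "i < 8" for i
    proof -
      have "finite S" using S finite_subset by blast
      then have "sorted_list_of_set S ! i \<in> S"
        using that S nth_mem[of i "sorted_list_of_set S"] by simp
      then show ?thesis using S by auto
    qed
    then show ?thesis
      unfolding minor8_def peval_det8 by (intro det8_eq_0[where w = x and k = k] row k)
  qed
  \<comment> \<open>Whatever lift \<open>F\<close> of a minor is taken, its value at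
    \<open>?p\<close> is the value of the minor at \<open>q\<close>.\<close>
  have quartic: "peval ?p F = 0" if "F \<in> minor_quartics \<alpha>" for F
  proof -
    from that obtain S where "S \<subseteq> {..<10}" "card S = 8" "msubst theta F = minor8 \<alpha> S"
      by (auto simp: minor_quartics_def)
    then have "peval q (msubst theta F) = 0" by (simp add: minor)
    then show ?thesis by (simp add: peval_msubst theta)
  qed
  have "peval ?p Pl = 0"
    by (simp add: Pl_def N_def algebra_simps)
  with quartic show ?thesis by (simp add: line_zeros_iff)
qed

definition vec4 :: "'k \<Rightarrow> 'k \<Rightarrow> 'k \<Rightarrow> 'k \<Rightarrow> nat \<Rightarrow> 'k" where
  "vec4 a b c d i = [a, b, c, d] ! (i - 1)"

lemma vec4_simps [simp]:
  "vec4 a b c d (Suc 0) = a" "vec4 a b c d 2 = b" "vec4 a b c d 3 = c" "vec4 a b c d 4 = d"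
  by (simp_all add: vec4_def)

section \<open>Parametrized points of the eight curves, each with a kernel vector\<close>

context
  fixes \<alpha> :: "'k::field_char_0"
begin

text \<open>In all eight lemmas \<open>u, v\<close> are chosen to have the wanted Pluecker
  coordinates, and \<open>w, z\<close> solve the ten linear equations.\<close>

lemma zeros_line_ce: "pt 0 0 c 0 e 0 \<in> line_zeros \<alpha>"
  using line_zerosI[where \<alpha> = \<alpha> and u = "vec4 (- e) c 0 0" and v = "vec4 0 0 1 0"
      and w = "vec4 0 0 1 0" and z = "vec4 (- e) (- c) 0 0"]
  by simp

lemma zeros_line_de: "pt 0 0 0 d e 0 \<in> line_zeros \<alpha>"
  using line_zerosI[where \<alpha> = \<alpha> and u = "vec4 1 0 0 0" and v = "vec4 0 0 (- e) d"
      and w = "vec4 0 0 (- e) d" and z = "vec4 1 0 0 0"]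
  by simp

lemma zeros_conic_cef:
  assumes "c^2 + 2 * e^2 + \<alpha> = 0" shows "pt 0 0 c 0 e 1 \<in> line_zeros \<alpha>"
proof -
  \<comment> \<open>Solving the equation of the conic for \<alpha> turns the rows into polynomial
    identities in \<open>c\<close> and \<open>e\<close>.\<close>
  have "\<alpha> = (c^2 + 2 * e^2 + \<alpha>) - c^2 - 2 * e^2" by simp
  then have eq: "\<alpha> = - (c^2) - 2 * e^2" unfolding assms by simp
  show ?thesis
    using line_zerosI[where \<alpha> = \<alpha> and u = "vec4 1 0 (- c) 0" and v = "vec4 0 1 (- e) 0"
      and w = "vec4 1 0 (- c) 0" and z = "vec4 0 (- 2) (- 2 * e) 0"]
    unfolding eq by (simp add: power2_eq_square algebra_simps)
qed

lemma zeros_conic_ade: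
  assumes "1 + \<alpha> * d^2 + 2 * e^2 = 0" shows "pt 1 0 0 d e 0 \<in> line_zeros \<alpha>"
proof -
  have 1: "\<alpha> * d^2 + 2 * e^2 = - 1"
    using assms by (simp add: eq_neg_iff_add_eq_0 add_ac)
  \<comment> \<open>The equation of the conic is prepared in the two normal forms in which the rows
    contain it.\<close>
  have "\<alpha> * (\<alpha> * (d * (d * 2))) + \<alpha> * (e * (e * 4)) = 2 * (\<alpha> * (\<alpha> * d^2 + 2 * e^2))"
    "\<alpha> * (\<alpha> * (d * d)) + \<alpha> * (e * (e * 2)) = \<alpha> * (\<alpha> * d^2 + 2 * e^2)"
    by (simp_all add: power2_eq_square algebra_simps)
  then have *: "\<alpha> * (\<alpha> * (d * d)) + \<alpha> * (e * (e * 2)) = - \<alpha>"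
    "\<alpha> * (\<alpha> * (d * (d * 2))) + \<alpha> * (e * (e * 4)) = - (\<alpha> * 2)"
    unfolding 1 by simp_all
  show ?thesis
    using * line_zerosI[where \<alpha> = \<alpha> and u = "vec4 d 0 1 0" and v = "vec4 e 0 0 1"
      and w = "vec4 (- \<alpha> * d) 0 (- \<alpha>) 0" and z = "vec4 (- 2 * e) 0 0 (- 2)"]
    by (simp add: power2_eq_square algebra_simps)
qed

text \<open>The chart \<open>c = 1\<close>. The kernel vector is zero at \<open>a = b = 0\<close>,
  which is why this point is excluded.\<close>

lemma zeros_cubic_abc:
  assumes "b^2 = a^3 + a" "a \<noteq> 0" shows "pt a b 1 0 0 0 \<in> line_zeros \<alpha>"
proof -
  have "b * (b * 2) = a * 2 + a * (a * (a * 2))"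
    using arg_cong[OF assms(1), of "\<lambda>x. x * 2"]
    by (simp only: power2_eq_square power3_eq_cube distrib_right mult.assoc add.commute)
  then show ?thesis using line_zerosI[where \<alpha> = \<alpha> and u = "vec4 0 1 0 (- a)" and v = "vec4 0 0 1 (- b)"
      and w = "vec4 0 (a^2) b a" and z = "vec4 0 (- b) (- a) 0"] assms
  by (simp add: power2_eq_square power3_eq_cube algebra_simps)
qed

text \<open>The chart \<open>d = 1\<close> of \<open>fQ = b^2d\<close>; the condition on
  \<open>f\<close> keeps the kernel vector nonzero.\<close>

lemma zeros_cubic_bdf:
  assumes "b^2 = \<alpha> * f - 2 * f^2 + \<alpha> * f^3" "f \<noteq> 0" shows "pt 0 b 0 1 0 f \<in> line_zeros \<alpha>"
  using line_zerosI[where \<alpha> = \<alpha> and u = "vec4 1 (- b) 0 0" and v = "vec4 0 f 0 1"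
      and w = "vec4 f 0 0 b" and z = "vec4 b (- \<alpha> * f) 0 (- 2 * f + \<alpha> * f^2)"] assms
  by (simp add: power2_eq_square power3_eq_cube algebra_simps)

text \<open>The chart \<open>f = 1\<close>, where the quadric \<open>af = be\<close> reads
  \<open>a = be\<close>. The entry \<open>z 2 = \<alpha>\<close> makes the kernel vector
  nonzero.\<close>

lemma zeros_quartic_abef:
  assumes "a^2 + 2 * e^2 + \<alpha> = 0" "a = b * e" "\<alpha> \<noteq> 0" shows "pt a b 0 0 e 1 \<in> line_zeros \<alpha>"
proof -
  have "\<alpha> = (a^2 + 2 * e^2 + \<alpha>) - (b * e)^2 - 2 * e^2" by (simp add: assms(2))
  then have eq: "\<alpha> = - ((b * e)^2) - 2 * e^2" unfolding assms(1) by simp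
  show ?thesis
    using line_zerosI[where \<alpha> = \<alpha> and u = "vec4 1 0 0 b" and v = "vec4 0 1 (- e) 0"
      and w = "vec4 (e^2) 0 0 (b * e^2)" and z = "vec4 0 \<alpha> (e * \<alpha>) 0"] assms(3)
    unfolding eq assms(2) by (simp add: power2_eq_square algebra_simps)
qed

text \<open>The chart \<open>d = 1\<close>: the quadric gives \<open>c = -af\<close>, and inserting
  this into \<open>Q = 0\<close> produces the first assumption.\<close>

lemma zeros_quartic_acdf:
  assumes "a^2 * (1 + f^2) + \<alpha> * (1 + f^2) = 2 * f" "c = - a * f"
  shows "pt a 0 c 1 0 f \<in> line_zeros \<alpha>"
  using line_zerosI[where \<alpha> = \<alpha> and u = "vec4 1 0 a 0" and v = "vec4 0 f 0 1"
      and w = "vec4 (- 1 - f^2) 0 (- a * (1 + f^2)) 0" and z = "vec4 0 (2 * f) 0 2"] assms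
  by (simp add: power2_eq_square algebra_simps)

end

section \<open>Independence of the monomials on a single curve\<close>

definition coeff_poly :: "(nat \<Rightarrow> 'k::comm_ring_1) \<Rightarrow> nat \<Rightarrow> 'k poly" where
  "coeff_poly x m = (\<Sum>i<m. Polynomial.monom (x i) i)"

lemma poly_coeff_poly [simp]: "poly (coeff_poly x m) t = (\<Sum>i<m. x i * t ^ i)"
  by (simp add: coeff_poly_def poly_sum poly_monom)

lemma coeff_poly_eq_0D: "coeff_poly x m = 0 \<Longrightarrow> i < m \<Longrightarrow> x i = 0"
proof -
  assume *: "coeff_poly x m = 0" "i < m"
  have "Polynomial.coeff (coeff_poly x m) i = x i"
    using *(2) by (simp add: coeff_poly_def coeff_sum)
  with *(1) show "x i = 0" by simp
qed

text \<open>Sums of different lengths are brought to one range, so that they can be read as digits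
  of one expansion.\<close>

lemma sum_pad:
  fixes g :: "nat \<Rightarrow> 'k::comm_ring_1"
  assumes "m \<le> M" shows "(\<Sum>i<m. g i * y ^ i) = (\<Sum>i<M. y ^ i * (if i < m then g i else 0))"
proof -
  have "(\<Sum>i<m. g i * y ^ i) = (\<Sum>i<m. y ^ i * (if i < m then g i else 0))"
    by (simp add: mult.commute cong: sum.cong_simp)
  also have "\<dots> = (\<Sum>i<M. y ^ i * (if i < m then g i else 0))"
    using assms by (intro sum.mono_neutral_left) auto
  finally show ?thesis .
qed

lemma sum_pad_Suc:
  fixes g :: "nat \<Rightarrow> 'k::comm_ring_1"
  assumes "m < M"
  shows "(\<Sum>i<m. g i * y ^ Suc i) = (\<Sum>i<M. y ^ i * (if 1 \<le> i \<and> i \<le> m then g (i - 1) else 0))"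
proof -
  obtain M' where M: "M = Suc M'" using assms by (cases M) auto
  have "(\<Sum>i<m. g i * y ^ Suc i) = y * (\<Sum>i<m. g i * y ^ i)"
    by (simp add: sum_distrib_left mult_ac)
  also have "(\<Sum>i<m. g i * y ^ i) = (\<Sum>i<M'. y ^ i * (if i < m then g i else 0))"
    using assms M by (intro sum_pad) simp
  also have "y * (\<Sum>i<M'. y ^ i * (if i < m then g i else 0))
      = (\<Sum>i<M. y ^ i * (if 1 \<le> i \<and> i \<le> m then g (i - 1) else 0))"
    unfolding M by (simp add: sum.lessThan_Suc_shift sum_distrib_left Suc_le_eq mult_ac del: sum.lessThan_Suc
        cong: if_cong)
  finally show ?thesis .
qed

text \<open>The expansion with \<open>K = 0\<close>: there are no digits, \<open>D\<close> is the
  constant \<open>k\<close>, and the two sums are the remainders \<open>R\<close> and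
  \<open>R'\<close>.\<close>

lemma conic_cover_independent:
  fixes x x' :: "nat \<Rightarrow> 'k::field_char_0"
  assumes closed: "alg_closed TYPE('k)" and N: "N \<noteq> 0" and k: "k \<noteq> 0"
    and vanish: "\<And>t y. y ^ 2 * k = poly N t \<Longrightarrow> (\<Sum>i<m. x i * t ^ i) + y * (\<Sum>i<m'. x' i * t ^ i) = 0"
  shows "i < m \<Longrightarrow> x i = 0" "i < m' \<Longrightarrow> x' i = 0"
proof -
  have bezout: "0 * N + [:inverse k:] * [:k:] = 1" using k by (simp add: one_pCons)
  note * = double_cover_independent[OF closed finite.emptyI bezout N, of 0 "\<lambda>_. 0"
      "coeff_poly x m" "coeff_poly x' m'"]
  have "coeff_poly x m = 0" by (rule *(2)) (use k vanish in simp_all)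
  moreover have "coeff_poly x' m' = 0" by (rule *(3)) (use k vanish in simp_all)
  ultimately show "i < m \<Longrightarrow> x i = 0" "i < m' \<Longrightarrow> x' i = 0"
    by (auto dest: coeff_poly_eq_0D)
qed

text \<open>On \<open>y^2 = N(t)\<close> with \<open>N\<close> cubic, \<open>1, t, t^2\<close> are a
  basis of the coordinate ring over the polynomials in \<open>y\<close>. Coefficients of
  \<open>y^i\<close> are therefore digits of degree at most 2, with no remainder.\<close>

lemma cubic_cover_independent:
  fixes x x' x'' :: "nat \<Rightarrow> 'k::field_char_0"
  assumes closed: "alg_closed TYPE('k)" and N: "degree N = 3"
    and vanish: "\<And>t y. t \<noteq> 0 \<Longrightarrow> y ^ 2 = poly N t \<Longrightarrow>
       (\<Sum>i<m. x i * y ^ Suc i) + t * (\<Sum>i<m'. x' i * y ^ i) + t ^ 2 * (\<Sum>i<m''. x'' i * y ^ i) = 0"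
  shows "i < m \<Longrightarrow> x i = 0" "i < m' \<Longrightarrow> x' i = 0" "i < m'' \<Longrightarrow> x'' i = 0"
proof -
  define K where "K = m + m' + m'' + 1"
  have K: "m < 2 * K" "m' \<le> 2 * K" "m'' \<le> 2 * K" by (auto simp: K_def)
  \<comment> \<open>The digit at \<open>y^i\<close> has one coefficient from each family; the first
    family starts with \<open>y^1\<close>, hence the shift.\<close>
  define A where "A i = [:if 1 \<le> i \<and> i \<le> m then x (i - 1) else 0, if i < m' then x' i else 0,
      if i < m'' then x'' i else 0:]" for i
  have bezout: "0 * N + 1 * 1 = (1 :: 'k poly)" by simp
  have sum: "(\<Sum>i<2 * K. y ^ i * poly (A i) t) =
      (\<Sum>i<m. x i * y ^ Suc i) + t * (\<Sum>i<m'. x' i * y ^ i) + t ^ 2 * (\<Sum>i<m''. x'' i * y ^ i)" for y t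
    unfolding sum_pad_Suc[OF K(1)] sum_pad[OF K(2)] sum_pad[OF K(3)]
    by (simp add: A_def sum_distrib_left sum.distrib[symmetric] power2_eq_square algebra_simps)
  have A: "A i = 0" if "i < 2 * K" for i
  proof (rule double_cover_independent(1)[OF closed _ bezout, where T = "{0}" and K = K and R = 0 and R' = 0])
    show "degree (A i) < degree N" for i
    proof -
      have "degree (A i) \<le> 2" unfolding A_def by (intro degree_pCons_le[THEN order_trans]) simp
      then show ?thesis using N by simp
    qed
    show "(\<Sum>i<2 * K. y ^ i * poly (A i) t) + y ^ (2 * K) * (poly 0 t + y * poly 0 t) = 0"
      if "t \<notin> {0}" "y ^ 2 * poly 1 t = poly N t" for t y
      using vanish[of t y] that unfolding sum by simp
  qed (use N that in auto)
  show "x i = 0" if "i < m" for i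
    using A[of "Suc i"] that K by (simp add: A_def)
  show "x' i = 0" if "i < m'" for i
    using A[of i] that K by (simp add: A_def)
  show "x'' i = 0" if "i < m''" for i
    using A[of i] that K by (simp add: A_def)
qed

text \<open>The function \<open>b = a/e\<close> has poles at \<open>e = 0\<close>, where
  \<open>a\<close> and \<open>e\<close> are regular. An expansion with \<open>N = e^2\<close> splits
  off the monomials in \<open>b\<close>; those in \<open>a\<close> are left for a second expansion,
  on the cover \<open>a^2 = D(e)\<close>.\<close>

lemma abef_independent:
  fixes \<alpha> :: "'k::field_char_0" and x1 x2 x3 x4 :: "nat \<Rightarrow> 'k"
  assumes closed: "alg_closed TYPE('k)" and \<alpha>: "\<alpha> \<noteq> 0" and m: "0 < m"
    and vanish: "\<And>a b e. a ^ 2 + 2 * e ^ 2 + \<alpha> = 0 \<Longrightarrow> a = b * e \<Longrightarrow>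
       (\<Sum>i<m. x1 i * a ^ Suc i) + e * (\<Sum>i<m - 1. x2 i * a ^ Suc i)
       + (\<Sum>i<m. x3 i * b ^ Suc i) + a * (\<Sum>i<m - 1. x4 i * b ^ Suc i) = 0"
  shows "i < m \<Longrightarrow> x1 i = 0" "i < m - 1 \<Longrightarrow> x2 i = 0" "i < m \<Longrightarrow> x3 i = 0" "i < m - 1 \<Longrightarrow> x4 i = 0"
proof -
  define D where "D = [:- \<alpha>, 0, - 2:]"
  define K where "K = m + 1"
  \<comment> \<open>By \<open>a^2 = D(e)\<close> the term \<open>x * a ^ Suc i\<close> equals
    \<open>Q i x + a * P i x\<close> with \<open>P\<close> and \<open>Q\<close> polynomials in
    \<open>e\<close>.\<close>
  define P where "P i x = (if even i then D ^ (i div 2) * [:x:] else 0)" for i and x :: 'k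
  define Q where "Q i x = (if even i then 0 else D ^ (Suc i div 2) * [:x:])" for i and x :: 'k
  define G where "G = (\<Sum>i<m. Q i (x1 i)) + [:0, 1:] * (\<Sum>i<m - 1. Q i (x2 i))"
  define H where "H = (\<Sum>i<m. P i (x1 i)) + [:0, 1:] * (\<Sum>i<m - 1. P i (x2 i))"
  have GH: "(\<Sum>i<m. x1 i * a ^ Suc i) + e * (\<Sum>i<m - 1. x2 i * a ^ Suc i) = poly G e + a * poly H e"
    if "a ^ 2 = poly D e" for a e
  proof -
    have p: "a ^ (2 * k) = poly D e ^ k" and q: "a * (a * z) = poly D e * z" for k z
      by (simp_all add: power_mult that mult.assoc[symmetric] that[unfolded power2_eq_square])
    have *: "x * a ^ Suc i = poly (Q i x) e + a * poly (P i x) e" for i x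
    proof (cases "even i")
      case True
      then obtain k where "i = 2 * k" by (rule evenE)
      then show ?thesis by (simp add: P_def Q_def p)
    next
      case False
      then obtain k where "i = 2 * k + 1" by (rule oddE)
      then show ?thesis by (simp add: P_def Q_def p q mult.left_commute mult.commute[of x])
    qed
    show ?thesis
      unfolding * G_def H_def
      by (simp add: poly_sum sum.distrib sum_distrib_left algebra_simps)
  qed
  \<comment> \<open>With \<open>y = 1/b\<close> the order of powers is reversed:
    \<open>b^(i+2)\<close> and \<open>a b^(i+1)\<close> both contribute to the digit at position
    \<open>2K-1-i\<close>, the second with a factor \<open>e\<close>.\<close>
  define A where "A j = (let i = 2 * K - 1 - j in if i < m - 1 then [:x3 (Suc i), x4 i:] else 0)" for j
  have bezout: "[:- 2 / \<alpha>:] * [:0, 0, 1:] + [:- 1 / \<alpha>:] * D = 1"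
    using \<alpha> by (simp add: D_def one_pCons)
  \<comment> \<open>With $y = e/a = 1/b$ the monomials in $b$ become the digits of the expansion and those in $a$ the
    remainder, after multiplication by $y^{2K+1}$.\<close>
  have vanish': "(\<Sum>j<2 * K. y ^ j * poly (A j) e) + y ^ (2 * K) * (poly ([:x3 0:] + [:0, 1:] * H) e + y * poly G e) = 0"
    if "e \<noteq> 0" "y \<noteq> 0" "y ^ 2 * poly D e = poly [:0, 0, 1:] e" for e y
  proof -
    define a b where "a = e / y" and "b = 1 / y"
    have aD: "a ^ 2 = poly D e"
      using that by (simp add: a_def power_divide power2_eq_square field_simps)
    have ab: "a = b * e" by (simp add: a_def b_def)
    have "a ^ 2 + 2 * e ^ 2 + \<alpha> = 0"
      unfolding aD by (simp add: D_def power2_eq_square algebra_simps)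
    from vanish[OF this ab] have
      "poly G e + a * poly H e + (\<Sum>i<m. x3 i * b ^ Suc i) + a * (\<Sum>i<m - 1. x4 i * b ^ Suc i) = 0"
      by (simp only: GH[OF aD])
    then have 0: "y ^ Suc (2 * K) * (poly G e + a * poly H e + (\<Sum>i<m. x3 i * b ^ Suc i)
        + a * (\<Sum>i<m - 1. x4 i * b ^ Suc i)) = 0" by simp
    have yb: "y ^ Suc (2 * K) * b ^ Suc i = y ^ (2 * K - i)" if "i \<le> 2 * K" for i
      using \<open>y \<noteq> 0\<close> that by (simp add: b_def power_one_over power_diff field_simps)
    have sumA: "(\<Sum>j<2 * K. y ^ j * poly (A j) e) = (\<Sum>i<m - 1. y ^ (2 * K - Suc i) * (x3 (Suc i) + e * x4 i))"
    proof -
      have "(\<Sum>j<2 * K. y ^ j * poly (A j) e) = (\<Sum>i<2 * K. y ^ (2 * K - Suc i) * poly (A (2 * K - Suc i)) e)"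
        by (rule sum.nat_diff_reindex[symmetric])
      also have "\<dots> = (\<Sum>i<2 * K. if i < m - 1 then y ^ (2 * K - Suc i) * (x3 (Suc i) + e * x4 i) else 0)"
        by (intro sum.cong refl) (auto simp: A_def Let_def)
      also have "\<dots> = (\<Sum>i<m - 1. y ^ (2 * K - Suc i) * (x3 (Suc i) + e * x4 i))"
        by (rule sum.mono_neutral_cong_right) (auto simp: K_def)
      finally show ?thesis .
    qed
    have s3: "y ^ Suc (2 * K) * (\<Sum>i<m. x3 i * b ^ Suc i)
        = y ^ (2 * K) * x3 0 + (\<Sum>i<m - 1. y ^ (2 * K - Suc i) * x3 (Suc i))"
    proof -
      have "y ^ Suc (2 * K) * (\<Sum>i<m. x3 i * b ^ Suc i) = (\<Sum>i<m. y ^ (2 * K - i) * x3 i)"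
        unfolding sum_distrib_left
      proof (rule sum.cong[OF refl])
        fix i assume "i \<in> {..<m}"
        then have "y ^ Suc (2 * K) * b ^ Suc i = y ^ (2 * K - i)" by (intro yb) (simp add: K_def)
        then show "y ^ Suc (2 * K) * (x3 i * b ^ Suc i) = y ^ (2 * K - i) * x3 i"
          by (metis mult.assoc mult.commute)
      qed
      also have "\<dots> = y ^ (2 * K) * x3 0 + (\<Sum>i<m - 1. y ^ (2 * K - Suc i) * x3 (Suc i))"
        using m by (cases m) (simp_all add: sum.lessThan_Suc_shift del: sum.lessThan_Suc)
      finally show ?thesis .
    qed
    have s4: "y ^ Suc (2 * K) * (a * (\<Sum>i<m - 1. x4 i * b ^ Suc i))
        = (\<Sum>i<m - 1. y ^ (2 * K - Suc i) * (e * x4 i))"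
      unfolding sum_distrib_left
    proof (rule sum.cong[OF refl])
      fix i assume "i \<in> {..<m - 1}"
      then have "y ^ Suc (2 * K) * b ^ Suc (Suc i) = y ^ (2 * K - Suc i)" by (intro yb) (simp add: K_def)
      moreover have "y ^ Suc (2 * K) * (a * (x4 i * b ^ Suc i)) = (y ^ Suc (2 * K) * b ^ Suc (Suc i)) * (e * x4 i)"
        by (simp add: ab mult_ac)
      ultimately show "y ^ Suc (2 * K) * (a * (x4 i * b ^ Suc i)) = y ^ (2 * K - Suc i) * (e * x4 i)" by simp
    qed
    have s2: "y ^ Suc (2 * K) * (a * poly H e) = y ^ (2 * K) * (e * poly H e)"
      using \<open>y \<noteq> 0\<close> by (simp add: a_def)
    show ?thesis
      using 0 unfolding distrib_left s2 s3 s4 sumA by (simp add: sum.distrib algebra_simps)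
  qed
  have A: "j < 2 * K \<Longrightarrow> A j = 0" and R: "[:x3 0:] + [:0, 1:] * H = 0" for j
  proof -
    have "degree (A j) < degree [:0, 0, 1 :: 'k:]" for j
      by (auto simp: A_def Let_def)
    note * = double_cover_independent[OF closed _ bezout _ _ this, where T = "{0}" and K = K
        and R = "[:x3 0:] + [:0, 1:] * H" and R' = G]
    show "j < 2 * K \<Longrightarrow> A j = 0" by (rule *(1)) (use vanish' in \<open>auto simp: D_def\<close>)
    show "[:x3 0:] + [:0, 1:] * H = 0" by (rule *(2)) (use vanish' in \<open>auto simp: D_def\<close>)
  qed
  have x34: "x3 (Suc i) = 0 \<and> x4 i = 0" if "i < m - 1" for i
    using A[of "2 * K - 1 - i"] that by (auto simp: A_def Let_def K_def)
  \<comment> \<open>The term \<open>x3 0 * b\<close> ended up at \<open>y ^ (2 * K)\<close>, in the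
    remainder; setting \<open>e = 0\<close> reads it off.\<close>
  have "x3 0 = poly ([:x3 0:] + [:0, 1:] * H) 0" by simp
  then have x30: "x3 0 = 0" by (simp only: R poly_0)
  show x3: "x3 i = 0" if "i < m" for i
    using x34[of "i - 1"] x30 that by (cases i) auto
  show x4: "x4 i = 0" if "i < m - 1" for i
    using x34 that by blast
  \<comment> \<open>The second expansion: the base is now \<open>D\<close>, of degree 2, and
    \<open>a\<close> is the square root.\<close>
  define B where "B i = [:if 1 \<le> i \<and> i \<le> m then x1 (i - 1) else 0, if 1 \<le> i \<and> i \<le> m - 1 then x2 (i - 1) else 0:]" for i
  have m2: "m < 2 * m" "m - 1 < 2 * m" using m by auto
  have B: "B i = 0" if "i < 2 * m" for i
  proof (rule double_cover_independent(1)[OF closed, where T = "{0}" and K = m and R = 0 and R' = 0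
        and N = D and D = 1 and u = 0 and v = 1])
    fix e a assume e: "e \<notin> {0}" and a: "a ^ 2 * poly 1 e = poly D e"
    have ab: "a = a / e * e" using e by simp
    have "a ^ 2 + 2 * e ^ 2 + \<alpha> = 0" using a by (simp add: D_def power2_eq_square algebra_simps)
    from vanish[OF this ab] x3 x4
    have "(\<Sum>i<m. x1 i * a ^ Suc i) + e * (\<Sum>i<m - 1. x2 i * a ^ Suc i) = 0"
      by (simp cong: sum.cong_simp)
    then show "(\<Sum>i<2 * m. a ^ i * poly (B i) e) + a ^ (2 * m) * (poly 0 e + a * poly 0 e) = 0"
      unfolding sum_pad_Suc[OF m2(1)] sum_pad_Suc[OF m2(2)]
      by (simp add: B_def sum_distrib_left sum.distrib[symmetric] algebra_simps)
  qed (use that in \<open>auto simp: D_def B_def\<close>)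
  show "x1 i = 0" if "i < m" for i
    using B[of "Suc i"] that m by (simp add: B_def)
  show "x2 i = 0" if "i < m - 1" for i
    using B[of "Suc i"] that m by (simp add: B_def)
qed

text \<open>With \<open>y = c\<close> and \<open>t = f\<close> the curve is
  \<open>y^2(1 + t^2) = N(t)\<close> and \<open>a = -y/t\<close>. Multiplying the relation by
  \<open>t\<close> removes the denominator; the four families then occupy the coefficients of
  \<open>1, t, t^2, t^3\<close> in the digits, below the degree 4 of \<open>N\<close>.\<close>

lemma acdf_independent:
  fixes \<alpha> :: "'k::field_char_0" and x1 x2 x3 x4 :: "nat \<Rightarrow> 'k"
  assumes closed: "alg_closed TYPE('k)" and \<alpha>: "\<alpha> \<noteq> 0"
    and vanish: "\<And>a c f. a ^ 2 * (1 + f ^ 2) + \<alpha> * (1 + f ^ 2) = 2 * f \<Longrightarrow> c = - a * f \<Longrightarrow>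
       (\<Sum>i<m1. x1 i * c ^ Suc i) + a * (\<Sum>i<m2. x2 i * c ^ Suc i)
       + f * (\<Sum>i<m3. x3 i * c ^ Suc i) + f ^ 2 * (\<Sum>i<m4. x4 i * c ^ Suc i) = 0"
  shows "i < m1 \<Longrightarrow> x1 i = 0" "i < m2 \<Longrightarrow> x2 i = 0" "i < m3 \<Longrightarrow> x3 i = 0" "i < m4 \<Longrightarrow> x4 i = 0"
proof -
  define N where "N = [:0, 0, - \<alpha>, 2, - \<alpha>:]"
  define D where "D = [:1, 0, 1 :: 'k:]"
  define K where "K = m1 + m2 + m3 + m4 + 2"
  \<comment> \<open>Since \<open>ta = -y\<close>, the product \<open>t a y^(i+1)\<close> is
    \<open>-y^(i+2)\<close>: a change of sign and a shift by one.\<close>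
  define x2' where "x2' i = (if i = 0 then 0 else - x2 (i - 1))" for i
  have K: "m1 < 2 * K" "Suc m2 < 2 * K" "m3 < 2 * K" "m4 < 2 * K" by (auto simp: K_def)
  define A where "A i = [:if 1 \<le> i \<and> i \<le> Suc m2 then x2' (i - 1) else 0,
     if 1 \<le> i \<and> i \<le> m1 then x1 (i - 1) else 0, if 1 \<le> i \<and> i \<le> m3 then x3 (i - 1) else 0,
     if 1 \<le> i \<and> i \<le> m4 then x4 (i - 1) else 0:]" for i
  \<comment> \<open>Modulo \<open>1 + t^2\<close> the polynomial \<open>N\<close> is
    \<open>-2t\<close>, whose inverse is \<open>t/2\<close>.\<close>
  have bezout: "[:0, 1 / 2:] * N + [:1, 0, - 1, \<alpha> / 2:] * D = 1"
    by (simp add: N_def D_def one_pCons)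
  have degN: "degree N = 4" using \<alpha> by (simp add: N_def)
  have A: "A i = 0" if "i < 2 * K" for i
  proof (rule double_cover_independent(1)[OF closed _ bezout, where T = "{0}" and K = K and R = 0 and R' = 0])
    show "degree (A i) < degree N" for i
    proof -
      have "degree (A i) \<le> 3" unfolding A_def by (intro degree_pCons_le[THEN order_trans]) simp
      then show ?thesis using degN by simp
    qed
    fix t y assume t: "t \<notin> {0}" and y: "y ^ 2 * poly D t = poly N t"
    define a where "a = - y / t"
    have ya: "y = - a * t" using t by (simp add: a_def)
    have "t ^ 2 * (a ^ 2 * (1 + t ^ 2) + \<alpha> * (1 + t ^ 2) - 2 * t) = 0"
      using y unfolding ya by (simp add: N_def D_def power2_eq_square algebra_simps)
    then have "a ^ 2 * (1 + t ^ 2) + \<alpha> * (1 + t ^ 2) = 2 * t" using t by simp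
    from vanish[OF this ya]
    have "t * ((\<Sum>i<m1. x1 i * y ^ Suc i) + a * (\<Sum>i<m2. x2 i * y ^ Suc i)
       + t * (\<Sum>i<m3. x3 i * y ^ Suc i) + t ^ 2 * (\<Sum>i<m4. x4 i * y ^ Suc i)) = 0" by simp
    moreover have "t * (a * (\<Sum>i<m2. x2 i * y ^ Suc i)) = (\<Sum>i<Suc m2. x2' i * y ^ Suc i)"
    proof -
      have "t * (a * (\<Sum>i<m2. x2 i * y ^ Suc i)) = (t * a) * (\<Sum>i<m2. x2 i * y ^ Suc i)"
        by (simp only: mult.assoc)
      also have "t * a = - y" by (simp add: ya mult.commute)
      also have "- y * (\<Sum>i<m2. x2 i * y ^ Suc i) = (\<Sum>i<Suc m2. x2' i * y ^ Suc i)"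
        by (simp add: sum.lessThan_Suc_shift x2'_def sum_distrib_left sum_negf mult_ac del: sum.lessThan_Suc)
      finally show ?thesis .
    qed
    ultimately have "t * (\<Sum>i<m1. x1 i * y ^ Suc i) + (\<Sum>i<Suc m2. x2' i * y ^ Suc i)
       + t * (t * (\<Sum>i<m3. x3 i * y ^ Suc i)) + t * (t ^ 2 * (\<Sum>i<m4. x4 i * y ^ Suc i)) = 0"
      by (simp only: distrib_left)
    then show "(\<Sum>i<2 * K. y ^ i * poly (A i) t) + y ^ (2 * K) * (poly 0 t + y * poly 0 t) = 0"
      unfolding sum_pad_Suc[OF K(1)] sum_pad_Suc[OF K(2)] sum_pad_Suc[OF K(3)] sum_pad_Suc[OF K(4)]
      by (simp add: A_def sum_distrib_left sum.distrib[symmetric] power2_eq_square algebra_simps)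
  qed (use that degN in \<open>auto simp: D_def\<close>)
  show "x1 i = 0" if "i < m1" for i
    using A[of "Suc i"] that K by (simp add: A_def)
  show "x2 i = 0" if "i < m2" for i
    using A[of "Suc (Suc i)"] that K by (simp add: A_def x2'_def)
  show "x3 i = 0" if "i < m3" for i
    using A[of "Suc i"] that K by (simp add: A_def)
  show "x4 i = 0" if "i < m4" for i
    using A[of "Suc i"] that K by (simp add: A_def)
qed

section \<open>Independence of all standard monomials\<close>

lemma peval_mon6: "peval (pt A B C D E F) (mon6 a b c d e f) = A ^ a * B ^ b * C ^ c * D ^ d * E ^ e * F ^ f"
  by (simp add: mon6_def)

lemma distinct_std: "4 \<le> n \<Longrightarrow> distinct (std n)"
  unfolding std_def by (auto simp: distinct_map inj_on_def)

lemma sum_std: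
  assumes "4 \<le> n"
  shows "(\<Sum>t\<in>set (std n). g t) =
     (\<Sum>i<n + 1. g (0, 0, i, 0, n - i, 0)) +
     (\<Sum>i<n. g (0, 0, 0, Suc i, n - 1 - i, 0)) +
     (\<Sum>i<n. g (0, 0, i, 0, 0, Suc (n - 1 - i))) +
     (\<Sum>i<n - 1. g (0, 0, i, 0, 1, Suc (n - 2 - i))) +
     (\<Sum>i<n. g (Suc (n - 1 - i), 0, 0, i, 0, 0)) +
     (\<Sum>i<n - 1. g (Suc (n - 2 - i), 0, 0, i, 1, 0)) +
     (\<Sum>i<n. g (0, Suc i, n - 1 - i, 0, 0, 0)) +
     (\<Sum>i<n. g (1, i, n - 1 - i, 0, 0, 0)) +
     (\<Sum>i<n - 1. g (2, i, n - 2 - i, 0, 0, 0)) +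
     (\<Sum>i<n - 1. g (Suc i, 0, 0, 0, 0, Suc (n - 2 - i))) +
     (\<Sum>i<n - 2. g (Suc i, 0, 0, 0, 1, Suc (n - 3 - i))) +
     (\<Sum>i<n - 1. g (0, Suc i, 0, 0, 0, Suc (n - 2 - i))) +
     (\<Sum>i<n - 2. g (1, Suc i, 0, 0, 0, Suc (n - 3 - i))) +
     (\<Sum>i<n - 1. g (0, Suc i, 0, Suc (n - 2 - i), 0, 0)) +
     (\<Sum>i<n - 1. g (0, i, 0, Suc (n - 2 - i), 0, 1)) +
     (\<Sum>i<n - 2. g (0, i, 0, Suc (n - 3 - i), 0, 2)) +
     (\<Sum>i<n - 1. g (0, 0, Suc i, Suc (n - 2 - i), 0, 0)) +
     (\<Sum>i<n - 2. g (1, 0, Suc i, Suc (n - 3 - i), 0, 0)) +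
     (\<Sum>i<n - 2. g (0, 0, Suc i, Suc (n - 3 - i), 0, 1)) +
     (\<Sum>i<n - 3. g (0, 0, Suc i, Suc (n - 4 - i), 0, 2))"
proof -
  have "(\<Sum>t\<in>set (std n). g t) = sum_list (map g (std n))"
    by (rule sum.distinct_set_conv_list[OF distinct_std[OF assms]])
  then show ?thesis
    by (simp only: std_def map_append sum_list_append list.map_comp comp_def
        interv_sum_list_conv_sum_set_nat set_upt lessThan_atLeast0 add.assoc)
qed

lemma card_std: "4 \<le> n \<Longrightarrow> card (set (std n)) = 20 * n - 20"
proof -
  assume n: "4 \<le> n"
  have "card (set (std n)) = length (std n)" by (rule distinct_card[OF distinct_std[OF n]])
  \<comment> \<open>Writing \<open>n = m + 4\<close> removes the truncated subtractions from the
    twenty lengths.\<close>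
  also obtain m where "n = m + 4" using n by (metis add.commute le_Suc_ex)
  then have "length (std n) = 20 * n - 20" by (simp add: std_def)
  finally show ?thesis .
qed

text \<open>The system is triangular: the curves are visited in an order such that, on each of them,
  only its own family and families already eliminated have nonzero values. Each family is settled by
  the independence on its curve.\<close>

lemma std_independent:
  fixes \<alpha> :: "'k::field_char_0" and c :: "nat \<times> nat \<times> nat \<times> nat \<times> nat \<times> nat \<Rightarrow> 'k"
  assumes closed: "alg_closed TYPE('k)" and \<alpha>: "\<alpha> \<noteq> 0" and n: "4 \<le> n"
    and vanish: "\<And>p. p \<in> line_zeros \<alpha> \<Longrightarrow> peval p (\<Sum>t\<in>set (std n). Const (c t) * mon6_of t) = 0"
  shows "\<forall>t\<in>set (std n). c t = 0"
proof -
  define x1 where "x1 i = c (0, 0, i, 0, n - i, 0)" for i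
  define x2 where "x2 i = c (0, 0, 0, Suc i, n - 1 - i, 0)" for i
  define x3a where "x3a i = c (0, 0, i, 0, 0, Suc (n - 1 - i))" for i
  define x3b where "x3b i = c (0, 0, i, 0, 1, Suc (n - 2 - i))" for i
  define x4a where "x4a i = c (Suc (n - 1 - i), 0, 0, i, 0, 0)" for i
  define x4b where "x4b i = c (Suc (n - 2 - i), 0, 0, i, 1, 0)" for i
  define x5a where "x5a i = c (0, Suc i, n - 1 - i, 0, 0, 0)" for i
  define x5b where "x5b i = c (1, i, n - 1 - i, 0, 0, 0)" for i
  define x5c where "x5c i = c (2, i, n - 2 - i, 0, 0, 0)" for i
  define x6a where "x6a i = c (Suc i, 0, 0, 0, 0, Suc (n - 2 - i))" for i
  define x6b where "x6b i = c (Suc i, 0, 0, 0, 1, Suc (n - 3 - i))" for i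
  define x6c where "x6c i = c (0, Suc i, 0, 0, 0, Suc (n - 2 - i))" for i
  define x6d where "x6d i = c (1, Suc i, 0, 0, 0, Suc (n - 3 - i))" for i
  define x7a where "x7a i = c (0, Suc i, 0, Suc (n - 2 - i), 0, 0)" for i
  define x7b where "x7b i = c (0, i, 0, Suc (n - 2 - i), 0, 1)" for i
  define x7c where "x7c i = c (0, i, 0, Suc (n - 3 - i), 0, 2)" for i
  define x8a where "x8a i = c (0, 0, Suc i, Suc (n - 2 - i), 0, 0)" for i
  define x8b where "x8b i = c (1, 0, Suc i, Suc (n - 3 - i), 0, 0)" for i
  define x8c where "x8c i = c (0, 0, Suc i, Suc (n - 3 - i), 0, 1)" for i
  define x8d where "x8d i = c (0, 0, Suc i, Suc (n - 4 - i), 0, 2)" for i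
  \<comment> \<open>The combination at a point of the scheme, written as one sum per family;
    \<open>u\<close> is the third coordinate, as \<open>c\<close> names the coefficients.\<close>
  have E: "(\<Sum>i<n + 1. x1 i * (a ^ 0 * b ^ 0 * u ^ i * d ^ 0 * e ^ (n - i) * f ^ 0)) +
     (\<Sum>i<n. x2 i * (a ^ 0 * b ^ 0 * u ^ 0 * d ^ (Suc i) * e ^ (n - 1 - i) * f ^ 0)) +
     (\<Sum>i<n. x3a i * (a ^ 0 * b ^ 0 * u ^ i * d ^ 0 * e ^ 0 * f ^ (Suc (n - 1 - i)))) +
     (\<Sum>i<n - 1. x3b i * (a ^ 0 * b ^ 0 * u ^ i * d ^ 0 * e ^ 1 * f ^ (Suc (n - 2 - i)))) +
     (\<Sum>i<n. x4a i * (a ^ (Suc (n - 1 - i)) * b ^ 0 * u ^ 0 * d ^ i * e ^ 0 * f ^ 0)) +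
     (\<Sum>i<n - 1. x4b i * (a ^ (Suc (n - 2 - i)) * b ^ 0 * u ^ 0 * d ^ i * e ^ 1 * f ^ 0)) +
     (\<Sum>i<n. x5a i * (a ^ 0 * b ^ (Suc i) * u ^ (n - 1 - i) * d ^ 0 * e ^ 0 * f ^ 0)) +
     (\<Sum>i<n. x5b i * (a ^ 1 * b ^ i * u ^ (n - 1 - i) * d ^ 0 * e ^ 0 * f ^ 0)) +
     (\<Sum>i<n - 1. x5c i * (a ^ 2 * b ^ i * u ^ (n - 2 - i) * d ^ 0 * e ^ 0 * f ^ 0)) +
     (\<Sum>i<n - 1. x6a i * (a ^ (Suc i) * b ^ 0 * u ^ 0 * d ^ 0 * e ^ 0 * f ^ (Suc (n - 2 - i)))) +
     (\<Sum>i<n - 2. x6b i * (a ^ (Suc i) * b ^ 0 * u ^ 0 * d ^ 0 * e ^ 1 * f ^ (Suc (n - 3 - i)))) +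
     (\<Sum>i<n - 1. x6c i * (a ^ 0 * b ^ (Suc i) * u ^ 0 * d ^ 0 * e ^ 0 * f ^ (Suc (n - 2 - i)))) +
     (\<Sum>i<n - 2. x6d i * (a ^ 1 * b ^ (Suc i) * u ^ 0 * d ^ 0 * e ^ 0 * f ^ (Suc (n - 3 - i)))) +
     (\<Sum>i<n - 1. x7a i * (a ^ 0 * b ^ (Suc i) * u ^ 0 * d ^ (Suc (n - 2 - i)) * e ^ 0 * f ^ 0)) +
     (\<Sum>i<n - 1. x7b i * (a ^ 0 * b ^ i * u ^ 0 * d ^ (Suc (n - 2 - i)) * e ^ 0 * f ^ 1)) +
     (\<Sum>i<n - 2. x7c i * (a ^ 0 * b ^ i * u ^ 0 * d ^ (Suc (n - 3 - i)) * e ^ 0 * f ^ 2)) +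
     (\<Sum>i<n - 1. x8a i * (a ^ 0 * b ^ 0 * u ^ (Suc i) * d ^ (Suc (n - 2 - i)) * e ^ 0 * f ^ 0)) +
     (\<Sum>i<n - 2. x8b i * (a ^ 1 * b ^ 0 * u ^ (Suc i) * d ^ (Suc (n - 3 - i)) * e ^ 0 * f ^ 0)) +
     (\<Sum>i<n - 2. x8c i * (a ^ 0 * b ^ 0 * u ^ (Suc i) * d ^ (Suc (n - 3 - i)) * e ^ 0 * f ^ 1)) +
     (\<Sum>i<n - 3. x8d i * (a ^ 0 * b ^ 0 * u ^ (Suc i) * d ^ (Suc (n - 4 - i)) * e ^ 0 * f ^ 2)) = 0"
    if "pt a b u d e f \<in> line_zeros \<alpha>" for a b u d e f
    using vanish[OF that]
    by (simp add: peval.subst_sum sum_std[OF n] peval_mon6 x1_def x2_def x3a_def x3b_def x4a_def x4b_def x5a_def x5b_def x5c_def x6a_def x6b_def x6c_def x6d_def x7a_def x7b_def x7c_def x8a_def x8b_def x8c_def x8d_def del: power_Suc)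

  have z1: "x1 i = 0" if "i < n + 1" for i
  proof -
    have "coeff_poly x1 (n + 1) = 0"
      by (rule poly_eq_0_cofinite[OF finite.emptyI]) (use E[OF zeros_line_ce[of _ 1]] in simp)
    then show ?thesis using that by (rule coeff_poly_eq_0D)
  qed
  have z2: "x2 i = 0" if "i < n" for i
  proof -
    have "coeff_poly x2 n = 0"
    proof (rule poly_eq_0_cofinite[of "{0}"])
      fix t :: 'k assume t: "t \<notin> {0}"
      have "(\<Sum>i<n. x2 i * (t * t ^ i)) = 0"
        using E[OF zeros_line_de[of t 1]] z1 by (simp cong: sum.cong_simp)
      then have "t * (\<Sum>i<n. x2 i * t ^ i) = 0" by (simp add: sum_distrib_left mult_ac)
      then show "poly (coeff_poly x2 n) t = 0" using t by simp
    qed simp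
    then show ?thesis using that by (rule coeff_poly_eq_0D)
  qed
  have 3: "(\<Sum>i<n. x3a i * t ^ i) + y * (\<Sum>i<n - 1. x3b i * t ^ i) = 0"
    if "y ^ 2 * 2 = poly [:- \<alpha>, 0, - 1:] t" for t y
  proof -
    have "t ^ 2 + 2 * y ^ 2 + \<alpha> = 0"
      using that by (simp add: power2_eq_square algebra_simps)
    from E[OF zeros_conic_cef[OF this]] show ?thesis
      using z1 by (simp add: sum_distrib_left mult_ac cong: sum.cong_simp)
  qed
  have z3: "i < n \<Longrightarrow> x3a i = 0" "i < n - 1 \<Longrightarrow> x3b i = 0" for i
    using conic_cover_independent[where N = "[:- \<alpha>, 0, - 1:]" and k = 2 and x = x3a and x' = x3b and m = n and m' = "n - 1",
        OF closed _ _ 3] by simp_all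
  have 4: "(\<Sum>i<n. x4a i * t ^ i) + y * (\<Sum>i<n - 1. x4b i * t ^ i) = 0"
    if "y ^ 2 * 2 = poly [:- 1, 0, - \<alpha>:] t" for t y
  proof -
    have "1 + \<alpha> * t ^ 2 + 2 * y ^ 2 = 0"
      using that by (simp add: power2_eq_square algebra_simps)
    note * = E[OF zeros_conic_ade[OF this]]
    \<comment> \<open>Monomials in \<open>b\<close> and \<open>c\<close> vanish on this conic,
      because their two exponents are not both zero.\<close>
    have 0: "(\<Sum>i<n. x5b i * (0 ^ i * 0 ^ (n - Suc i))) = 0"
      "(\<Sum>i<n - Suc 0. x5c i * (0 ^ i * 0 ^ (n - Suc (Suc i)))) = 0"
      using n by (auto intro!: sum.neutral simp: power_0_left)
    from * show ?thesis
      using z1 z2 0 by (simp add: sum_distrib_left mult_ac cong: sum.cong_simp)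
  qed
  have z4: "i < n \<Longrightarrow> x4a i = 0" "i < n - 1 \<Longrightarrow> x4b i = 0" for i
    using conic_cover_independent[where N = "[:- 1, 0, - \<alpha>:]" and k = 2 and x = x4a and x' = x4b and m = n and m' = "n - 1",
        OF closed _ _ 4] by simp_all
  have 5: "(\<Sum>i<n. x5a i * y ^ Suc i) + t * (\<Sum>i<n. x5b i * y ^ i) + t ^ 2 * (\<Sum>i<n - 1. x5c i * y ^ i) = 0"
    if "t \<noteq> 0" "y ^ 2 = poly [:0, 1, 0, 1:] t" for t y
  proof -
    have "y ^ 2 = t ^ 3 + t"
      using that(2) by (simp add: power2_eq_square power3_eq_cube algebra_simps)
    from E[OF zeros_cubic_abc[OF this that(1)]] show ?thesis
      using z1 z4 by (simp add: sum_distrib_left mult_ac cong: sum.cong_simp)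
  qed
  have z5: "i < n \<Longrightarrow> x5a i = 0" "i < n \<Longrightarrow> x5b i = 0" "i < n - 1 \<Longrightarrow> x5c i = 0" for i
    using cubic_cover_independent[where N = "[:0, 1, 0, 1:]" and x = x5a and x' = x5b and x'' = x5c
        and m = "n" and m' = "n" and m'' = "n - 1", OF closed _ 5] by simp_all
  have 6: "(\<Sum>i<n - 1. x6a i * a ^ Suc i) + e * (\<Sum>i<n - 1 - 1. x6b i * a ^ Suc i)
       + (\<Sum>i<n - 1. x6c i * b ^ Suc i) + a * (\<Sum>i<n - 1 - 1. x6d i * b ^ Suc i) = 0"
    if "a ^ 2 + 2 * e ^ 2 + \<alpha> = 0" "a = b * e" for a b e
    using E[OF zeros_quartic_abef[OF that \<alpha>]] z1 z3 z4 z5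
    by (simp add: numeral_2_eq_2 sum_distrib_left mult_ac cong: sum.cong_simp)
  have z6: "i < n - 1 \<Longrightarrow> x6a i = 0" "i < n - 2 \<Longrightarrow> x6b i = 0"
    "i < n - 1 \<Longrightarrow> x6c i = 0" "i < n - 2 \<Longrightarrow> x6d i = 0" for i
    using abef_independent[where m = "n - 1" and ?x1.0 = x6a and ?x2.0 = x6b and ?x3.0 = x6c and ?x4.0 = x6d,
        OF closed \<alpha> _ 6] n by simp_all
  have 7: "(\<Sum>i<n - 1. x7a i * y ^ Suc i) + t * (\<Sum>i<n - 1. x7b i * y ^ i) + t ^ 2 * (\<Sum>i<n - 2. x7c i * y ^ i) = 0"
    if "t \<noteq> 0" "y ^ 2 = poly [:0, \<alpha>, - 2, \<alpha>:] t" for t y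
  proof -
    have "y ^ 2 = \<alpha> * t - 2 * t ^ 2 + \<alpha> * t ^ 3"
      using that(2) by (simp add: power2_eq_square power3_eq_cube algebra_simps)
    from E[OF zeros_cubic_bdf[OF this that(1)]] show ?thesis
      using z1 z2 z3 z4 z5 z6 by (simp add: sum_distrib_left mult_ac cong: sum.cong_simp)
  qed
  have z7: "i < n - 1 \<Longrightarrow> x7a i = 0" "i < n - 1 \<Longrightarrow> x7b i = 0" "i < n - 2 \<Longrightarrow> x7c i = 0" for i
    using cubic_cover_independent[where N = "[:0, \<alpha>, - 2, \<alpha>:]" and x = x7a and x' = x7b and x'' = x7c
        and m = "n - 1" and m' = "n - 1" and m'' = "n - 2", OF closed _ 7] \<alpha> by simp_all
  have 8: "(\<Sum>i<n - 1. x8a i * u ^ Suc i) + a * (\<Sum>i<n - 2. x8b i * u ^ Suc i)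
       + f * (\<Sum>i<n - 2. x8c i * u ^ Suc i) + f ^ 2 * (\<Sum>i<n - 3. x8d i * u ^ Suc i) = 0"
    if "a ^ 2 * (1 + f ^ 2) + \<alpha> * (1 + f ^ 2) = 2 * f" "u = - a * f" for a u f
    using E[OF zeros_quartic_acdf[OF that]] z1 z2 z3 z4 z5 z6 z7
    by (simp add: sum_distrib_left mult_ac cong: sum.cong_simp)
  have z8: "i < n - 1 \<Longrightarrow> x8a i = 0" "i < n - 2 \<Longrightarrow> x8b i = 0"
    "i < n - 2 \<Longrightarrow> x8c i = 0" "i < n - 3 \<Longrightarrow> x8d i = 0" for i
    using acdf_independent[where ?m1.0 = "n - 1" and ?m2.0 = "n - 2" and ?m3.0 = "n - 2" and ?m4.0 = "n - 3"
        and ?x1.0 = x8a and ?x2.0 = x8b and ?x3.0 = x8c and ?x4.0 = x8d, OF closed \<alpha> 8] by simp_all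
  show ?thesis
    unfolding std_def set_append ball_Un set_map ball_simps set_upt
    using z1 z2 z3 z4 z5 z6 z7 z8
    unfolding x1_def x2_def x3a_def x3b_def x4a_def x4b_def x5a_def x5b_def x5c_def x6a_def x6b_def x6c_def x6d_def x7a_def x7b_def x7c_def x8a_def x8b_def x8c_def x8d_def
    by (intro conjI ballI) simp_all
qed

section \<open>Hilbert function and reducedness\<close>

lemma Const_diff: "Const (x - y) = Const x - Const y"
  using Const_add[of x "- y"] by (simp add: Const_uminus)

lemma std_sum_single:
  assumes "s \<in> set (std n)"
  shows "(\<Sum>x\<in>set (std n). Const (if x = s then 1 else 0) * mon6_of x) = (mon6_of s :: 'k::comm_ring_1 mpoly)"
  using assms by (simp add: if_distrib[of Const] if_distrib[of "\<lambda>x. x * _"] sum.delta cong: if_cong)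

lemma Var_power: "Var i ^ k = (Poly_Mapping.single (Poly_Mapping.single i k) 1 :: 'k::comm_ring_1 mpoly)"
  by (induction k) (simp_all add: Var_def mult_single single_add[symmetric])

lemma single_eq_monom_value:
  "Poly_Mapping.single m c = (Const c * monom_value Var m :: 'k::comm_ring_1 mpoly)"
proof -
  have "(\<Prod>i\<in>I. Var i ^ Poly_Mapping.lookup m i :: 'k mpoly)
      = Poly_Mapping.single (\<Sum>i\<in>I. Poly_Mapping.single i (Poly_Mapping.lookup m i)) 1" for I
    by (induction I rule: infinite_finite_induct) (simp_all add: Var_power mult_single)
  then have "monom_value Var m = (Poly_Mapping.single m 1 :: 'k mpoly)"
    \<comment> \<open>The decomposition into terms is applied to the exponent vector
      \<open>m\<close>, which is itself a finitely supported function.\<close>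
    unfolding monom_value_def using mpoly_eq_sum_single[of m] by metis
  then show ?thesis by (simp add: Const_def mult_single)
qed

definition mon6_exp :: "(nat \<Rightarrow>\<^sub>0 nat) \<Rightarrow> nat \<times> nat \<times> nat \<times> nat \<times> nat \<times> nat" where
  "mon6_exp m = (Poly_Mapping.lookup m 0, Poly_Mapping.lookup m 1, Poly_Mapping.lookup m 2,
     Poly_Mapping.lookup m 3, Poly_Mapping.lookup m 4, Poly_Mapping.lookup m 5)"

lemma lessThan_6: "{..<6} = {0, 1, 2, 3, 4, 5 :: nat}"
  by auto

lemma single_eq_mon6:
  assumes "Poly_Mapping.keys m \<subseteq> {..<6}"
  shows "Poly_Mapping.single m c = (Const c * mon6_of (mon6_exp m) :: 'k::comm_ring_1 mpoly)"
  using monom_value_superset[OF _ assms, of "Var :: nat \<Rightarrow> 'k mpoly"]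
  by (simp add: single_eq_monom_value lessThan_6 mon6_exp_def mon6_def mult.assoc)

lemma mon_deg_eq_sum6:
  assumes "Poly_Mapping.keys m \<subseteq> {..<6}" "mon6_exp m = (a, b, c, d, e, f)"
  shows "mon_deg m = a + b + c + d + e + f"
  using mon_deg_superset[OF _ assms(1)] assms(2) by (simp add: lessThan_6 mon6_exp_def)

lemma homog_part_expand:
  fixes h :: "'k::field mpoly"
  assumes "h \<in> homog_part 6 n"
  shows "h = (\<Sum>m\<in>Poly_Mapping.keys h. Const (Poly_Mapping.lookup h m) * mon6_of (mon6_exp m))"
    and "m \<in> Poly_Mapping.keys h \<Longrightarrow> mon6_exp m = (a, b, c, d, e, f) \<Longrightarrow> a + b + c + d + e + f = n"
proof -
  have *: "Poly_Mapping.keys m \<subseteq> {..<6}" "mon_deg m = n" if "m \<in> Poly_Mapping.keys h" for m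
    using assms that by (auto simp: homog_part_def polyring_iff homog_def)
  show "h = (\<Sum>m\<in>Poly_Mapping.keys h. Const (Poly_Mapping.lookup h m) * mon6_of (mon6_exp m))"
    using mpoly_eq_sum_single[of h] by (simp add: single_eq_mon6 * cong: sum.cong_simp)
  show "m \<in> Poly_Mapping.keys h \<Longrightarrow> mon6_exp m = (a, b, c, d, e, f) \<Longrightarrow> a + b + c + d + e + f = n"
    using mon_deg_eq_sum6 * by metis
qed

lemma homog_part_std_reducible:
  fixes h :: "'k::field_char_0 mpoly"
  assumes "\<alpha> \<noteq> 0" "4 \<le> n" and h: "h \<in> homog_part 6 n"
  shows "h \<in> std_reducible \<alpha> n"
proof -
  have "mon6_of (mon6_exp m) \<in> std_reducible \<alpha> n" if "m \<in> Poly_Mapping.keys h" for m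
  proof -
    obtain a b c d e f where m: "mon6_exp m = (a, b, c, d, e, f)" by (cases "mon6_exp m")
    show ?thesis
      using mon6_std_reducible[OF assms(1,2) homog_part_expand(2)[OF h that m]] by (simp add: m)
  qed
  then show ?thesis
    by (subst homog_part_expand(1)[OF h]) (intro std_reducible_sum std_reducible_scale)
qed

lemma peval_scale:
  assumes "homog d f" shows "peval (\<lambda>i. s * p i) f = s ^ d * peval p f"
proof -
  have "monom_value (\<lambda>i. s * p i) m = s ^ mon_deg m * monom_value p m" for m
    by (simp add: monom_value_def mon_deg_def power_mult_distrib prod.distrib power_sum)
  then show ?thesis
    using assms by (simp add: peval_def homog_def sum_distrib_left mult_ac cong: sum.cong_simp)
qed

lemma homog_Pl: "homog 2 Pl"
  unfolding Pl_def using homog_mult[OF homog_Var homog_Var]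
  by (intro homog_add homog_diff) (simp_all add: numeral_2_eq_2)

lemma line_zeros_scale:
  assumes "p \<in> line_zeros \<alpha>" shows "(\<lambda>i. s * p i) \<in> line_zeros \<alpha>"
proof -
  have "homog 4 F" if "F \<in> minor_quartics \<alpha>" for F using that by (simp add: minor_quartics_def)
  then show ?thesis
    using assms unfolding line_zeros_iff by (simp add: peval_scale[OF homog_Pl] peval_scale[of 4])
qed

text \<open>Modulo the line ideal \<open>h\<close> is a combination of standard monomials, and this
  combination vanishes at the same points as \<open>h\<close>; by independence it is zero. Only
  points with a nonzero coordinate are assumed, since those are what the saturation can
  test.\<close>

lemma homog_part_vanishing:
  fixes h :: "'k::field_char_0 mpoly"
  assumes closed: "alg_closed TYPE('k)" and \<alpha>: "\<alpha> \<noteq> 0" and n: "4 \<le> n" and h: "h \<in> homog_part 6 n"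
    and vanish: "\<And>p i. p \<in> line_zeros \<alpha> \<Longrightarrow> i < 6 \<Longrightarrow> p i \<noteq> 0 \<Longrightarrow> peval p h = 0"
  shows "h \<in> line_ideal \<alpha>"
proof -
  have zero: "peval p h = 0" if "p \<in> line_zeros \<alpha>" for p
  proof (cases "\<exists>i<6. p i \<noteq> 0")
    case True then show ?thesis using vanish that by blast
  next
    case False
    \<comment> \<open>At the vertex of the cone every form of positive degree vanishes.\<close>
    then have p: "p 0 = 0" "p (Suc 0) = 0" "p 2 = 0" "p 3 = 0" "p 4 = 0" "p 5 = 0" by simp_all
    have "peval p (mon6_of (mon6_exp m)) = 0" if "m \<in> Poly_Mapping.keys h" for m
    proof -
      obtain a b c d e f where m: "mon6_exp m = (a, b, c, d, e, f)" by (cases "mon6_exp m")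
      have "a + b + c + d + e + f = n" by (rule homog_part_expand(2)[OF h that m])
      then show ?thesis using n by (auto simp: m mon6_def p power_0_left)
    qed
    then show ?thesis
      by (subst homog_part_expand(1)[OF h]) (simp add: peval.subst_sum)
  qed
  obtain c where c: "h - (\<Sum>t\<in>set (std n). Const (c t) * mon6_of t) \<in> line_ideal \<alpha>"
    using homog_part_std_reducible[OF \<alpha> n h] by (auto simp: std_reducible_def)
  have "peval p (\<Sum>t\<in>set (std n). Const (c t) * mon6_of t) = 0" if "p \<in> line_zeros \<alpha>" for p
  proof -
    have "peval p (h - (\<Sum>t\<in>set (std n). Const (c t) * mon6_of t)) = 0"
      using c that unfolding line_zeros_def by blast
    then show ?thesis using zero[OF that] by simp
  qed
  then have "\<forall>t\<in>set (std n). c t = 0" by (rule std_independent[OF closed \<alpha> n])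
  with c show ?thesis by simp
qed

lemma sum_in_line_ideal: "(\<And>x. x \<in> A \<Longrightarrow> g x \<in> line_ideal \<alpha>) \<Longrightarrow> sum g A \<in> line_ideal \<alpha>"
  by (induction A rule: infinite_finite_induct) (auto intro: line_add)

lemma homog_part_sum: "(\<And>x. x \<in> A \<Longrightarrow> g x \<in> homog_part k n) \<Longrightarrow> sum g A \<in> homog_part k n"
  by (induction A rule: infinite_finite_induct) (auto simp: homog_part_def intro: homog_add)

lemma homog_part_scale: "h \<in> homog_part k n \<Longrightarrow> Const c * h \<in> homog_part k n"
  by (simp add: homog_part_def homog_Const_mult)

definition degree_part :: "nat \<Rightarrow> 'k::comm_ring_1 mpoly \<Rightarrow> 'k mpoly" where
  "degree_part d f = (\<Sum>m | m \<in> Poly_Mapping.keys f \<and> mon_deg m = d.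
     Poly_Mapping.single m (Poly_Mapping.lookup f m))"

lemma degree_part_homog_part:
  assumes "f \<in> polyring 6" shows "degree_part d f \<in> homog_part 6 d"
proof -
  have "Poly_Mapping.keys (degree_part d f) \<subseteq> {m \<in> Poly_Mapping.keys f. mon_deg m = d}"
    unfolding degree_part_def by (rule order_trans[OF Poly_Mapping.keys_sum]) auto
  then show ?thesis using assms by (auto simp: homog_part_def polyring_iff homog_def)
qed

lemma degree_part_sum:
  "\<exists>m. f = (\<Sum>d<m. degree_part d f)"
proof
  \<comment> \<open>The inserted 0 gives \<open>Max\<close> a nonempty argument for the zero
    polynomial.\<close>
  define M where "M = Suc (Max (insert 0 (mon_deg ` Poly_Mapping.keys f)))"
  have "mon_deg m < M" if "m \<in> Poly_Mapping.keys f" for m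
    using that by (auto simp: M_def less_Suc_eq_le intro!: Max_ge)
  then have "(\<Sum>m\<in>Poly_Mapping.keys f. Poly_Mapping.single m (Poly_Mapping.lookup f m)) =
      (\<Sum>d<M. degree_part d f)"
    unfolding degree_part_def by (intro sum.group[symmetric]) auto
  then show "f = (\<Sum>d<M. degree_part d f)"
    using mpoly_eq_sum_single[of f] by simp
qed

text \<open>A power of \<open>f\<close> in the saturation forces \<open>f\<close> to vanish at all
  points of the cone other than the vertex. As \<open>f\<close> may be inhomogeneous, this is first
  passed to its homogeneous components, which are then treated degree by degree.\<close>

lemma proj_reduced_line_ideal:
  fixes \<alpha> :: "'k::field_char_0"
  assumes closed: "alg_closed TYPE('k)" and \<alpha>: "\<alpha> \<noteq> 0"
  shows "proj_reduced 6 (line_ideal \<alpha>)"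
  unfolding proj_reduced_def
proof (intro ballI allI impI)
  fix f :: "'k mpoly" and e :: nat
  assume f: "f \<in> polyring 6" and e: "0 < e" and sat: "f ^ e \<in> saturation 6 (line_ideal \<alpha>)"
  have f0: "peval p f = 0" if p: "p \<in> line_zeros \<alpha>" "i < 6" "p i \<noteq> 0" for p i
  proof -
    obtain k where "Var i ^ k * f ^ e \<in> line_ideal \<alpha>" using sat p(2) by (auto simp: saturation_def)
    then have "peval p (Var i ^ k * f ^ e) = 0" using p(1) unfolding line_zeros_def by blast
    then show ?thesis using p(3) by simp
  qed
  obtain m where m: "f = (\<Sum>d<m. degree_part d f)" using degree_part_sum by blast
  have part0: "peval p (degree_part d f) = 0" if p: "p \<in> line_zeros \<alpha>" "i < 6" "p i \<noteq> 0" and "d < m" for p i d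
  proof -
    \<comment> \<open>Along the multiples \<open>s * p\<close> of the point, \<open>f\<close> is a
      polynomial in \<open>s\<close> whose coefficients are the values of the components at
      \<open>p\<close>; it vanishes for all nonzero \<open>s\<close>.\<close>
    have "coeff_poly (\<lambda>d. peval p (degree_part d f)) m = 0"
    proof (rule poly_eq_0_cofinite[of "{0}"])
      fix s :: 'k assume s: "s \<notin> {0}"
      have "peval (\<lambda>i. s * p i) f = 0"
        by (rule f0[of _ i]) (use p s in \<open>auto intro: line_zeros_scale\<close>)
      moreover have "peval (\<lambda>i. s * p i) f = (\<Sum>d<m. peval p (degree_part d f) * s ^ d)"
      proof -
        have "peval (\<lambda>i. s * p i) (degree_part d f) = s ^ d * peval p (degree_part d f)" for d
          by (rule peval_scale) (use degree_part_homog_part[OF f, of d] in \<open>simp add: homog_part_def\<close>)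
        then show ?thesis
          by (subst m) (simp only: peval.subst_sum mult.commute)
      qed
      ultimately show "poly (coeff_poly (\<lambda>d. peval p (degree_part d f)) m) s = 0" by simp
    qed simp
    then show ?thesis using \<open>d < m\<close> by (rule coeff_poly_eq_0D)
  qed
  \<comment> \<open>The factor \<open>Var i ^ 4\<close> lifts every component, even the constant
    one, to a degree where vanishing implies membership.\<close>
  have "Var i ^ 4 * f \<in> line_ideal \<alpha>" if i: "i < 6" for i
  proof -
    have "Var i ^ 4 * degree_part d f \<in> line_ideal \<alpha>" if "d < m" for d
    proof (rule homog_part_vanishing[OF closed \<alpha>, of "4 + d"])
      show "Var i ^ 4 * degree_part d f \<in> homog_part 6 (4 + d)"
        using degree_part_homog_part[OF f, of d] i homog_mult[OF homog_power[OF homog_Var[of i], of 4], of d "degree_part d f"]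
        by (simp add: homog_part_def)
      show "peval p (Var i ^ 4 * degree_part d f) = 0" if "p \<in> line_zeros \<alpha>" "j < 6" "p j \<noteq> 0" for p j
        using part0[OF that \<open>d < m\<close>] by simp
    qed simp
    then have "(\<Sum>d<m. Var i ^ 4 * degree_part d f) \<in> line_ideal \<alpha>"
      by (intro sum_in_line_ideal) auto
    then show ?thesis by (subst m) (simp add: sum_distrib_left)
  qed
  then show "f \<in> saturation 6 (line_ideal \<alpha>)" using f by (auto simp: saturation_def)
qed

section \<open>The Hilbert function as a dimension count\<close>

interpretation kscale: vector_space "kscale :: 'k::field \<Rightarrow> 'k mpoly \<Rightarrow> 'k mpoly"
  by unfold_locales (simp_all add: kscale_def Const_add Const_mult algebra_simps)

lemma homog_mon6: "homog (a + b + c + d + e + f) (mon6 a b c d e f)"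
  unfolding mon6_def using homog_power[OF homog_Var] by (intro homog_mult) auto

lemma mon6_homog_part: "a + b + c + d + e + f = n \<Longrightarrow> mon6 a b c d e f \<in> homog_part 6 n"
  using homog_mon6 by (auto simp: homog_part_def)

lemma std_homog_part:
  assumes "4 \<le> n" "t \<in> set (std n)" shows "mon6_of t \<in> homog_part 6 n"
proof -
  obtain a b c d e f where t: "t = (a, b, c, d, e, f)" by (cases t)
  have "a + b + c + d + e + f = n" using assms unfolding t std_def by auto
  then show ?thesis by (simp add: t mon6_homog_part)
qed

lemma homog_part_finite_span:
  "\<exists>T. finite T \<and> homog_part 6 n \<subseteq> kscale.span (T :: 'k::field mpoly set)"
proof (intro exI conjI subsetI)
  let ?T = "mon6_of ` ({..n} \<times> {..n} \<times> {..n} \<times> {..n} \<times> {..n} \<times> {..n}) :: 'k mpoly set"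
  show "finite ?T" by simp
  fix h :: "'k mpoly" assume h: "h \<in> homog_part 6 n"
  have "Const (Poly_Mapping.lookup h m) * mon6_of (mon6_exp m) \<in> kscale.span ?T"
    if "m \<in> Poly_Mapping.keys h" for m
  proof -
    obtain a b c d e f where m: "mon6_exp m = (a, b, c, d, e, f)" by (cases "mon6_exp m")
    have "a + b + c + d + e + f = n" by (rule homog_part_expand(2)[OF h that m])
    then have "mon6_of (mon6_exp m) \<in> ?T" unfolding m by (intro imageI) auto
    then show ?thesis
      using kscale.span_scale[OF kscale.span_base] by (simp add: kscale_def)
  qed
  then show "h \<in> kscale.span ?T"
    by (subst homog_part_expand(1)[OF h]) (intro kscale.span_sum)
qed

text \<open>A basis \<open>B\<close> of the ideal in degree \<open>n\<close> together with the
  standard monomials is a basis of all forms of that degree, so the difference of dimensions is the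
  number of standard monomials.\<close>

lemma hilbert_fun_line_ideal:
  fixes \<alpha> :: "'k::field_char_0"
  assumes closed: "alg_closed TYPE('k)" and \<alpha>: "\<alpha> \<noteq> 0" and n: "4 \<le> n"
  shows "hilbert_fun 6 (line_ideal \<alpha>) n = 20 * n - 20"
proof -
  let ?S = "homog_part 6 n :: 'k mpoly set" and ?I = "line_ideal \<alpha>"
  let ?M = "mon6_of ` set (std n) :: 'k mpoly set"
  have zero: "\<forall>t\<in>set (std n). c t = 0"
    if "(\<Sum>t\<in>set (std n). Const (c t) * mon6_of t) \<in> ?I" for c
    using that by (intro std_independent[OF closed \<alpha> n]) (auto simp: line_zeros_def)
  have inj: "inj_on (mon6_of :: _ \<Rightarrow> 'k mpoly) (set (std n))"
  proof (rule inj_onI, rule ccontr)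
    fix s t assume st: "s \<in> set (std n)" "t \<in> set (std n)" "mon6_of s = (mon6_of t :: 'k mpoly)" "s \<noteq> t"
    \<comment> \<open>Two equal monomials would give a nontrivial combination with value 0, which
      lies in the ideal.\<close>
    define c where "c x = (if x = s then 1 else 0) - (if x = t then 1 else (0::'k))" for x
    have "(\<Sum>x\<in>set (std n). Const (c x) * mon6_of x) = mon6_of s - (mon6_of t :: 'k mpoly)"
      by (simp only: c_def Const_diff left_diff_distrib sum_subtractf std_sum_single[OF st(1)]
          std_sum_single[OF st(2)])
    then have "\<forall>t\<in>set (std n). c t = 0" using st by (intro zero) simp
    then show False using st by (auto simp: c_def)
  qed
  obtain B where B: "B \<subseteq> ?I \<inter> ?S" "kscale.independent B" "?I \<inter> ?S \<subseteq> kscale.span B"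
      "card B = kscale.dim (?I \<inter> ?S)"
    by (rule kscale.basis_exists)
  obtain T :: "'k mpoly set" where "finite T" "?S \<subseteq> kscale.span T" using homog_part_finite_span by blast
  then have finB: "finite B" using kscale.independent_span_bound[OF _ B(2)] B(1) by blast
  have spanB: "(\<Sum>v\<in>B. Const (u v) * v) \<in> ?I" for u
    using B(1) by (intro sum_in_line_ideal line_scale) auto
  have sumM: "(\<Sum>v\<in>?M. kscale (u v) v) = (\<Sum>t\<in>set (std n). Const (u (mon6_of t)) * mon6_of t)" for u
    by (simp add: sum.reindex[OF inj] kscale_def)
  have disj: "B \<inter> ?M = {}"
  proof (rule ccontr)
    assume "B \<inter> ?M \<noteq> {}"
    then obtain v where "v \<in> B" "v \<in> ?M" by blast
    then obtain s where s: "s \<in> set (std n)" "mon6_of s \<in> ?I" using B(1) by blast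
    define c where "c x = (if x = s then 1 else (0::'k))" for x
    have "(\<Sum>x\<in>set (std n). Const (c x) * mon6_of x) = (mon6_of s :: 'k mpoly)"
      unfolding c_def by (rule std_sum_single[OF s(1)])
    then have "\<forall>t\<in>set (std n). c t = 0" using s by (intro zero) simp
    then show False using s by (auto simp: c_def)
  qed
  have indep: "kscale.independent (B \<union> ?M)"
  proof (rule kscale.independent_if_scalars_zero)
    show "finite (B \<union> ?M)" using finB by simp
    fix u x assume sum: "(\<Sum>v\<in>B \<union> ?M. kscale (u v) v) = 0" and x: "x \<in> B \<union> ?M"
    have eq: "(\<Sum>v\<in>B. kscale (u v) v) + (\<Sum>t\<in>set (std n). Const (u (mon6_of t)) * mon6_of t) = 0"
      using sum finB disj by (simp add: sum.union_disjoint sumM)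
    \<comment> \<open>The standard part is minus the ideal part, so it lies in the ideal and its
      coefficients vanish; then the independence of \<open>B\<close> finishes.\<close>
    then have "(\<Sum>t\<in>set (std n). Const (u (mon6_of t)) * mon6_of t) = - (\<Sum>v\<in>B. kscale (u v) v)"
      by (simp add: eq_neg_iff_add_eq_0 add.commute)
    also have "\<dots> \<in> ?I" using spanB[of u] by (simp add: kscale_def line_uminus)
    finally have M0: "\<forall>t\<in>set (std n). u (mon6_of t) = 0" by (rule zero)
    then have "(\<Sum>v\<in>B. kscale (u v) v) = 0" using eq by simp
    then have "\<forall>v\<in>B. u v = 0"
      using B(2) kscale.dependent_finite[OF finB] by blast
    with M0 x show "u x = 0" by auto
  qed
  have "?S \<subseteq> kscale.span (B \<union> ?M)"
  proof
    fix h assume h: "h \<in> ?S"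
    obtain c where c: "h - (\<Sum>t\<in>set (std n). Const (c t) * mon6_of t) \<in> ?I"
      using homog_part_std_reducible[OF \<alpha> n h] by (auto simp: std_reducible_def)
    have "(\<Sum>t\<in>set (std n). Const (c t) * mon6_of t) \<in> kscale.span ?M"
      using kscale.span_scale[OF kscale.span_base, of _ ?M]
      by (intro kscale.span_sum) (simp add: kscale_def)
    then have 1: "(\<Sum>t\<in>set (std n). Const (c t) * mon6_of t) \<in> kscale.span (B \<union> ?M)"
      using kscale.span_mono[of ?M "B \<union> ?M"] by blast
    have "(\<Sum>t\<in>set (std n). Const (c t) * mon6_of t) \<in> ?S"
      by (intro homog_part_sum homog_part_scale std_homog_part[OF n])
    then have "h - (\<Sum>t\<in>set (std n). Const (c t) * mon6_of t) \<in> ?S"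
      using h by (auto simp: homog_part_def intro: homog_diff)
    with c B(3) have "h - (\<Sum>t\<in>set (std n). Const (c t) * mon6_of t) \<in> kscale.span B" by blast
    then have "h - (\<Sum>t\<in>set (std n). Const (c t) * mon6_of t) \<in> kscale.span (B \<union> ?M)"
      using kscale.span_mono[of B "B \<union> ?M"] by blast
    from kscale.span_add[OF this 1] show "h \<in> kscale.span (B \<union> ?M)" by simp
  qed
  moreover have "B \<union> ?M \<subseteq> ?S" using B(1) std_homog_part[OF n] by auto
  ultimately have "kscale.dim ?S = card (B \<union> ?M)"
    using kscale.basis_card_eq_dim[OF _ _ indep] by metis
  also have "\<dots> = card B + (20 * n - 20)"
    using finB disj by (simp add: card_Un_disjoint card_image[OF inj] card_std[OF n])
  finally show ?thesis using B(4) by (simp add: hilbert_fun_def)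
qed

theorem theorem3p2:
  fixes \<alpha> :: "'k::field_char_0"
  assumes "alg_closed TYPE('k)"
    and "\<alpha> * (1 - \<alpha>^2) \<noteq> 0"
  shows "proj_reduced 6 (line_ideal \<alpha>) \<and> proj_degree 6 (line_ideal \<alpha>) 20"
proof
  have \<alpha>: "\<alpha> \<noteq> 0" using assms(2) by auto
  then show "proj_reduced 6 (line_ideal \<alpha>)" using assms(1) by (intro proj_reduced_line_ideal)
  \<comment> \<open>The Hilbert polynomial has degree 1, so the factorial is 1 and the degree is the
    leading coefficient 20.\<close>
  have "of_nat (hilbert_fun 6 (line_ideal \<alpha>) n) = poly [:- 20, 20 :: rat:] (of_nat n)" if "n \<ge> 4" for n
    using that by (simp add: hilbert_fun_line_ideal[OF assms(1) \<alpha>] of_nat_diff)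
  then show "proj_degree 6 (line_ideal \<alpha>) 20"
    unfolding proj_degree_def by (intro exI[of _ "[:- 20, 20:]"] exI[of _ 4]) simp
qed

end
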